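(* Let $N$ be a complex number such that $\Re(N)>1$, and let $\sigma$ be an arbitrary element of $\widehat{\mathbb C}$. Then for any integer $m\ge 0$ and for all values of $\arg z$ (i.e. for all $z\in\widehat{\mathbb C}$), $$F^{(m)}\left(z;\begin{array}{c}N,\ldots,N\\ \sigma,\ldots,\sigma\end{array}\right)=\mathbf{Y}_m\left(y_1,\ldots,y_m\right),\qquad y_k=\frac{(2\pi \mathrm{i})^{k-1}}{k}F^{(1)}\left(z;\begin{array}{c}kN-k+1\\ k\sigma\end{array}\right)\quad (k=1,\ldots,m),$$ where on the left-hand side $N$ and $\sigma$ are each repeated $m$ times.
   Context: $\widehat{\mathbb C}$ denotes the Riemann surface of the complex logarithm: its elements have a modulus in $(0,\infty)$ and an argument in $\mathbb R$; under multiplication moduli multiply and arguments add; multiplication by a positive number keeps the argument; $\mathrm{e}^{\mathrm{i}\alpha}$ with $\alpha\in\mathbb R$ acts by adding $\alpha$ to the argument; and $t^{a}=\exp(a(\log|t|+\mathrm{i}\arg t))$ for $t\in\widehat{\mathbb C}$, $a\in\mathbb C$. Write $\int_0^{[\eta]}$ for the integral along the ray from $0$ to $+\infty\,\mathrm{e}^{\mathrm{i}\eta}$, on which the integration variable has argument $\eta$. Hyperterminants. Put $F^{(0)}(z)=1$. For $m\ge 1$, complex numbers $N_1,\ldots,N_m$ with $\Re(N_k)>1$, and $\sigma_1,\ldots,\sigma_m\in\widehat{\mathbb C}$ with $\arg\sigma_k\ne\arg\sigma_{k+1}\pmod{2\pi}$ for $k=1,\ldots,m-1$, define for $|\arg(\sigma_1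 z)|<\pi$ $$F^{(m)}\left(z;\begin{array}{c}N_1,\ldots,N_m\\ \sigma_1,\ldots,\sigma_m\end{array}\right)=\int_0^{[\pi-\arg\sigma_1]}\cdots\int_0^{[\pi-\arg\sigma_m]}\frac{\mathrm{e}^{\sigma_1t_1}t_1^{N_1-1}}{z-t_1}\prod_{k=2}^m\frac{\mathrm{e}^{\sigma_kt_k}t_k^{N_k-1}}{t_{k-1}-t_k}\,\mathrm{d}t_m\cdots \mathrm{d}t_1 .$$ In particular $F^{(1)}\left(z;\begin{array}{c}N_1\\ \sigma_1\end{array}\right)=\int_0^{[\pi-\arg\sigma_1]}\frac{\mathrm{e}^{\sigma_1t_1}t_1^{N_1-1}}{z-t_1}\mathrm{d}t_1$. If $\arg\sigma_k=\arg\sigma_{k+1}\pmod{2\pi}$ for some $k$, define $$F^{(m)}\left(z;\begin{array}{c}N_1,\ldots,N_m\\ \sigma_1,\ldots,\sigma_m\end{array}\right)=\lim_{\varepsilon\to0^+}F^{(m)}\left(z;\begin{array}{c}N_1,\,N_2,\,\ldots,\,N_m\\ \sigma_1\mathrm{e}^{(m-1)\varepsilon \mathrm{i}},\,\sigma_2\mathrm{e}^{(m-2)\varepsilon \mathrm{i}},\,\ldots,\,\sigma_m\end{array}\right).$$ In all cases $F^{(m)}$ is extended to all other values of $\arg z$ (as a function of $z\in\widehat{\mathbb C}$) by analytic continuation. Complete Bell polynomials (in a non-standard normalisation): $\mathbf{Y}_0=1$ and, for $m\ge1$, $$\mathbf{Y}_m(y_1,\ldots,y_m)=\sum\prod_{j=1}^m\frac{y_j^{k_j}}{k_j!},$$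 where the sum is over all tuples of non-negative integers $(k_1,\ldots,k_m)$ with $k_1+2k_2+\cdots+mk_m=m$. *)

theory Defs
  imports "HOL-Analysis.Analysis" "HOL-Library.Real_Mod"
begin

section \<open>The Riemann surface of the complex logarithm\<close>

text \<open>A point is a pair of a modulus and an unrestricted real argument.\<close>

typedef lsurf = "{p :: real \<times> real. fst p > 0}"
  morphisms modarg Abs_lsurf
  by (rule exI[of _ "(1, 0)"]) simp

definition lmod :: "lsurf \<Rightarrow> real" where
  "lmod t = fst (modarg t)"

definition larg :: "lsurf \<Rightarrow> real" where
  "larg t = snd (modarg t)"

text \<open>Only meaningful for \<open>r > 0\<close>.\<close>

definition lpolar :: "real \<Rightarrow> real \<Rightarrow> lsurf" where
  "lpolar r \<theta> = Abs_lsurf (r, \<theta>)"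

lemma lmod_pos [simp]: "lmod t > 0"
  using modarg[of t] by (auto simp: lmod_def)

lemma lmod_lpolar [simp]: "r > 0 \<Longrightarrow> lmod (lpolar r \<theta>) = r"
  by (simp add: lmod_def lpolar_def Abs_lsurf_inverse)

lemma larg_lpolar [simp]: "r > 0 \<Longrightarrow> larg (lpolar r \<theta>) = \<theta>"
  by (simp add: larg_def lpolar_def Abs_lsurf_inverse)

lemma lpolar_lmod_larg [simp]: "lpolar (lmod t) (larg t) = t"
  by (simp add: lmod_def larg_def lpolar_def modarg_inverse)

definition lmult :: "lsurf \<Rightarrow> lsurf \<Rightarrow> lsurf" where
  "lmult s t = lpolar (lmod s * lmod t) (larg s + larg t)"

text \<open>Multiplication by a positive real number and by \<open>e\<^sup>i\<^sup>\<alpha>\<close>, respectively.\<close>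

definition lscale :: "real \<Rightarrow> lsurf \<Rightarrow> lsurf" where
  "lscale c t = lpolar (c * lmod t) (larg t)"

definition lrot :: "real \<Rightarrow> lsurf \<Rightarrow> lsurf" where
  "lrot \<alpha> t = lpolar (lmod t) (larg t + \<alpha>)"

text \<open>The underlying (non-zero) complex number.\<close>

definition lval :: "lsurf \<Rightarrow> complex" where
  "lval t = rcis (lmod t) (larg t)"

definition lpow :: "lsurf \<Rightarrow> complex \<Rightarrow> complex" where
  "lpow t a = exp (a * (complex_of_real (ln (lmod t)) + \<i> * complex_of_real (larg t)))"

text \<open>
  The inverse of the logarithm, which is a biholomorphic map from the complex plane onto the
  surface and thus a global chart; analyticity on the surface is expressed through it.
\<close>

definition lexp :: "complex \<Rightarrow> lsurf" where
  "lexp w = lpolar (exp (Re w)) (Im w)"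

definition lholomorphic :: "(lsurf \<Rightarrow> complex) \<Rightarrow> bool" where
  "lholomorphic f \<longleftrightarrow> (\<lambda>w. f (lexp w)) holomorphic_on UNIV"

text \<open>
  Analytic continuation of a function given on \<open>D\<close> to the whole surface. For a non-empty open
  \<open>D\<close> it is unique, because the surface is connected, so this is meaningful as soon as it exists.
\<close>

definition lcontinuation :: "lsurf set \<Rightarrow> (lsurf \<Rightarrow> complex) \<Rightarrow> lsurf \<Rightarrow> complex" where
  "lcontinuation D f = (THE g. lholomorphic g \<and> (\<forall>z\<in>D. g z = f z))"


section \<open>Hyperterminants\<close>

text \<open>
  The integral along the ray from \<open>0\<close> to \<open>\<infinity> e\<^sup>i\<^sup>\<eta>\<close>, parametrised by the modulus \<open>r\<close>;
  \<open>cis \<eta>\<close> comes from \<open>dt = e\<^sup>i\<^sup>\<eta> dr\<close>.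
\<close>

definition ray_integral :: "real \<Rightarrow> (lsurf \<Rightarrow> complex) \<Rightarrow> complex" where
  "ray_integral \<eta> f = (LINT r:{0<..}|lborel. f (lpolar r \<eta>) * cis \<eta>)"

text \<open>Iterated ray integrals; the first direction and variable belong to the outermost integral.\<close>

fun iter_ray_integral :: "real list \<Rightarrow> (lsurf list \<Rightarrow> complex) \<Rightarrow> complex" where
  "iter_ray_integral [] f = f []"
| "iter_ray_integral (\<eta> # \<eta>s) f =
     ray_integral \<eta> (\<lambda>t. iter_ray_integral \<eta>s (\<lambda>ts. f (t # ts)))"

text \<open>
  In what follows the parameters are the list \<open>[(N\<^sub>1, \<sigma>\<^sub>1), \<dots>, (N\<^sub>m, \<sigma>\<^sub>m)]\<close>, so that \<open>m\<close> is its length.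
  List positions start at \<open>0\<close>, whereas the subscripts start at \<open>1\<close>: \<open>ts ! k\<close> is \<open>t\<close> with subscript
  \<open>k + 1\<close>, and \<open>(z # ts) ! k\<close> is its predecessor, which is \<open>z\<close> for \<open>k = 0\<close>.
\<close>

definition hyp_integral :: "lsurf \<Rightarrow> (complex \<times> lsurf) list \<Rightarrow> complex" where
  "hyp_integral z ps =
     iter_ray_integral (map (\<lambda>(N, \<sigma>). pi - larg \<sigma>) ps)
       (\<lambda>ts. \<Prod>k<length ps. case ps ! k of (N, \<sigma>) \<Rightarrow>
          exp (lval (lmult \<sigma> (ts ! k))) * lpow (ts ! k) (N - 1) /
            (lval ((z # ts) ! k) - lval (ts ! k)))"

definition hyp_generic :: "(complex \<times> lsurf) list \<Rightarrow> bool" where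
  "hyp_generic ps \<longleftrightarrow>
     (\<forall>k. Suc k < length ps \<longrightarrow>
        \<not> [larg (snd (ps ! k)) = larg (snd (ps ! Suc k))] (rmod (2 * pi)))"

definition hyp_perturb :: "real \<Rightarrow> (complex \<times> lsurf) list \<Rightarrow> (complex \<times> lsurf) list" where
  "hyp_perturb \<epsilon> ps =
     map (\<lambda>k. case ps ! k of (N, \<sigma>) \<Rightarrow> (N, lrot (real (length ps - 1 - k) * \<epsilon>) \<sigma>)) [0..<length ps]"

text \<open>
  The hyperterminant on its initial sector. In the non-generic case the perturbed parameters are
  generic, and \<open>z\<close> lies in their initial sector, for all sufficiently small \<open>\<epsilon> > 0\<close>.
\<close>

definition hyp_sector :: "(complex \<times> lsurf) list \<Rightarrow> lsurf set" where
  "hyp_sector ps = {z. \<bar>larg (lmult (snd (hd ps)) z)\<bar> < pi}"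

definition hyp_on_sector :: "(complex \<times> lsurf) list \<Rightarrow> lsurf \<Rightarrow> complex" where
  "hyp_on_sector ps z =
     (if hyp_generic ps then hyp_integral z ps
      else Lim (at_right 0) (\<lambda>\<epsilon>. hyp_integral z (hyp_perturb \<epsilon> ps)))"

definition hyperterminant :: "lsurf \<Rightarrow> (complex \<times> lsurf) list \<Rightarrow> complex" where
  "hyperterminant z ps =
     (if ps = [] then 1 else lcontinuation (hyp_sector ps) (hyp_on_sector ps) z)"


section \<open>Complete Bell polynomials\<close>

text \<open>
  In the present normalisation. The tuples \<open>(k\<^sub>1, \<dots>, k\<^sub>m)\<close> are functions on \<open>{1..m}\<close>, made
  \<open>undefined\<close> elsewhere so that each tuple is counted once.
\<close>

definition bell_tuples :: "nat \<Rightarrow> (nat \<Rightarrow> nat) set" where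
  "bell_tuples m = {k \<in> {1..m} \<rightarrow>\<^sub>E UNIV. (\<Sum>j=1..m. j * k j) = m}"

definition bell_Y :: "nat \<Rightarrow> (nat \<Rightarrow> complex) \<Rightarrow> complex" where
  "bell_Y m y = (\<Sum>k\<in>bell_tuples m. \<Prod>j=1..m. y j ^ k j / fact (k j))"

lemma finite_bell_tuples: "finite (bell_tuples m)"
proof (rule finite_subset)
  show "bell_tuples m \<subseteq> {1..m} \<rightarrow>\<^sub>E {..m}"
  proof
    fix k assume k: "k \<in> bell_tuples m"
    have "k j \<le> m" if "j \<in> {1..m}" for j
    proof -
      have "k j \<le> j * k j" using that by simp
      also have "\<dots> \<le> (\<Sum>j=1..m. j * k j)"
        using that by (intro member_le_sum) auto
      also have "\<dots> = m" using k by (simp add: bell_tuples_def)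
      finally show ?thesis .
    qed
    with k show "k \<in> {1..m} \<rightarrow>\<^sub>E {..m}"
      by (auto simp: bell_tuples_def PiE_iff)
  qed
qed (auto intro: finite_PiE)

lemma bell_Y_0: "bell_Y 0 y = 1"
  by (simp add: bell_Y_def bell_tuples_def)

end

(*
  Put \<theta> = arg \<sigma>. In units of e^(i(\<pi>-\<theta>)), all variables run along the positive axis and the limit
  \<epsilon> \<rightarrow> 0+ means that each variable is approached by its predecessor from below. So, with
  f(u) = c exp (-|\<sigma>| u) u^(N-1), the functions F_m satisfy F_(m+1)(w) = \<integral> f(u) F_m(u - i0) / (w - u) du.
  The claimed right-hand sides satisfy the same recursion: their generating function is
  \<Phi>(w) = exp (-1/(2\<pi>i) \<integral> log (1 - 2\<pi>i x f(u)) / (w - u) du), whose boundary values fulfil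
  \<Phi>(u + i0) = (1 - 2\<pi>i x f(u)) \<Phi>(u - i0), and Cauchy's formula recovers \<Phi> from this jump.
  The limit itself is harmless because every contour can first be moved to a fixed ray below the axis.
  Finally, F^(1) solves a linear differential equation of first order whose coefficients are entire in
  log z, hence it continues to the whole surface, and so does every Bell polynomial of such functions.
*)
theory Submission
  imports Defs "HOL-Complex_Analysis.Complex_Analysis"
begin

section \<open>Integrals along horizontal lines\<close>

text \<open>In the logarithms of the variables the kernel of the Cauchy transform is periodic with
  period \<open>2 * pi * \<i>\<close>. The two sides of the cut are then the edges of a strip of
  width 2\<pi>, and Cauchy's formula for \<Phi> becomes the residue theorem on that strip. The price
  is that the ends differ: the kernel tends to -1 at one of them and decays at the other, so the
  transforms vanish to the right but are merely bounded to the left, and all estimates have to be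
  asymmetric.

  The initial sector is the open strip itself, with singular lines as its edges, while the residue
  theorem needs a closed strip of full width 2\<pi>. Room is gained by representing one and the same
  function with its cut at different heights: a lower cut continues the function beyond the lower
  edge.

  The generating function \<Phi> is never formed. Its coefficients are the Bell polynomials, and
  multiplication by 1 - 2\<pi>\<i>xf becomes a finite identity between two consecutive ones, so no
  convergence and no branch of a logarithm enters.\<close>

lemma exp_neg_nat_tendsto_0:
  assumes "b > 0"
  shows "(\<lambda>n. exp (- b * real n)) \<longlonglongrightarrow> 0"
proof -
  have "filterlim (\<lambda>n. b * real n) at_top sequentially"
    using assms by (intro filterlim_tendsto_pos_mult_at_top[OF tendsto_const] filterlim_real_sequentially)
  then show ?thesis
    by (intro filterlim_compose[OF exp_at_bot]) (simp add: filterlim_uminus_at_top[symmetric] filterlim_uminus_at_bot)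
qed

lemma integrable_exp_neg_abs:
  assumes "b > 0"
  shows "integrable lborel (\<lambda>x::real. exp (- b * \<bar>x\<bar>))"
proof -
  have "set_integrable lebesgue {0..} (\<lambda>x::real. exp (- b * x))"
    by (rule nonnegative_absolutely_integrable_1)
       (use assms integrable_on_exp_minus_to_infinity in auto)
  then have *: "integrable lborel (\<lambda>x::real. indicator {0..} x *\<^sub>R exp (- b * x))"
    unfolding set_integrable_def by (subst (asm) integrable_completion) auto
  from lborel_integrable_real_affine[OF *, of "-1" 0]
  have "integrable lborel (\<lambda>x::real. indicator {0..} (-x) *\<^sub>R exp (b * x))" by simp
  with * have "integrable lborel (\<lambda>x::real. indicator {0..} x *\<^sub>R exp (- b * x)
      + indicator {0..} (-x) *\<^sub>R exp (b * x))"
    by (rule Bochner_Integration.integrable_add)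
  \<comment> \<open>The two one-sided exponentials overlap at \<open>x = 0\<close>, where their sum
    is 2; they dominate the function without being equal to it.\<close>
  then show ?thesis
    by (rule Bochner_Integration.integrable_bound) (auto simp: indicator_def)
qed

text \<open>A Lebesgue integral rather than a limit of contour integrals, so that dominated
  convergence applies to it directly; the orientation is that of increasing real part.\<close>

definition line_integral :: "real \<Rightarrow> (complex \<Rightarrow> complex) \<Rightarrow> complex" where
  "line_integral \<eta> \<phi> = (LINT x|lborel. \<phi> (Complex x \<eta>))"

lemma continuous_on_Complex [continuous_intros]:
  assumes "continuous_on S f" "continuous_on S g"
  shows "continuous_on S (\<lambda>x. Complex (f x) (g x))"
  unfolding Complex_eq by (intro continuous_intros assms)

lemma continuous_along_line:
  assumes "continuous_on {z. Im z = \<eta>} \<phi>"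
  shows "continuous_on S (\<lambda>x. \<phi> (Complex x \<eta>))"
  by (rule continuous_on_compose2[OF assms]) (auto intro!: continuous_intros)

lemma borel_measurable_along_line:
  fixes \<phi> :: "complex \<Rightarrow> complex"
  assumes "continuous_on {z. Im z = \<eta>} \<phi>"
  shows "(\<lambda>x. \<phi> (Complex x \<eta>)) \<in> borel_measurable borel"
  by (intro borel_measurable_continuous_onI continuous_along_line assms)

lemma line_integrable:
  fixes \<phi> :: "complex \<Rightarrow> complex"
  assumes "continuous_on {z. Im z = \<eta>} \<phi>" "b > 0"
    and "\<And>x. norm (\<phi> (Complex x \<eta>)) \<le> B * exp (- b * \<bar>x\<bar>)"
  shows "integrable lborel (\<lambda>x. \<phi> (Complex x \<eta>))"
proof (rule Bochner_Integration.integrable_bound)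
  show "integrable lborel (\<lambda>x::real. B * exp (- b * \<bar>x\<bar>))"
    by (intro integrable_mult_right integrable_exp_neg_abs assms)
  show "AE x in lborel. norm (\<phi> (Complex x \<eta>)) \<le> norm (B * exp (- b * \<bar>x\<bar>))"
    using assms(3) by (auto intro!: AE_I2 order_trans[OF _ abs_ge_self])
qed (use borel_measurable_along_line[OF assms(1)] in simp)

text \<open>This is the passage from the Lebesgue integral to finite segments, on which contour
  integration and the residue theorem operate.\<close>

lemma tendsto_line_integral:
  assumes "integrable lborel (\<lambda>x. \<phi> (Complex x \<eta>))"
  shows "(\<lambda>n. integral {- real n..real n} (\<lambda>x. \<phi> (Complex x \<eta>))) \<longlonglongrightarrow> line_integral \<eta> \<phi>"
proof -
  have "(\<lambda>n. LINT x|lborel. indicator {- real n..real n} x *\<^sub>R \<phi> (Complex x \<eta>))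
      \<longlonglongrightarrow> (LINT x|lborel. \<phi> (Complex x \<eta>))"
  proof (rule integral_dominated_convergence)
    show "integrable lborel (\<lambda>x. norm (\<phi> (Complex x \<eta>)))" using assms by simp
    show "AE x in lborel. (\<lambda>n. indicator {- real n..real n} x *\<^sub>R \<phi> (Complex x \<eta>))
        \<longlonglongrightarrow> \<phi> (Complex x \<eta>)"
    proof (rule AE_I2)
      fix x :: real
      obtain m where m: "\<bar>x\<bar> \<le> real m" using real_arch_simple by blast
      have "\<forall>\<^sub>F n in sequentially. indicator {- real n..real n} x *\<^sub>R \<phi> (Complex x \<eta>)
          = \<phi> (Complex x \<eta>)"
        using eventually_ge_at_top[of m]
        by eventually_elim (use m in \<open>auto simp: indicator_def\<close>)
      then show "(\<lambda>n. indicator {- real n..real n} x *\<^sub>R \<phi> (Complex x \<eta>)) \<longlonglongrightarrow> \<phi> (Complex x \<eta>)"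
        by (rule tendsto_eventually)
    qed
  qed (use assms in \<open>auto simp: indicator_def\<close>)
  moreover have "(LINT x|lborel. indicator {- real n..real n} x *\<^sub>R \<phi> (Complex x \<eta>))
      = integral {- real n..real n} (\<lambda>x. \<phi> (Complex x \<eta>))" for n
  proof -
    have i: "set_integrable lborel {- real n..real n} (\<lambda>x. \<phi> (Complex x \<eta>))"
      unfolding set_integrable_def
      by (rule integrable_mult_indicator) (use assms in auto)
    show ?thesis
      using set_borel_integral_eq_integral(2)[OF i] by (simp add: set_lebesgue_integral_def)
  qed
  ultimately show ?thesis by (simp add: line_integral_def)
qed

text \<open>Multiplication by \<open>\<i>\<close> carries the horizontal segment to a vertical one,
  for which the formula is known.\<close>

lemma contour_integral_linepath_same_Im:
  assumes "continuous_on (closed_segment (Complex a c) (Complex b c)) f" "a < b"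
  shows "contour_integral (linepath (Complex a c) (Complex b c)) f =
    integral {a..b} (\<lambda>x. f (Complex x c))"
proof -
  have "contour_integral (linepath (\<i> * Complex a c) (\<i> * Complex b c)) (\<lambda>z. f (- \<i> * z))
      = \<i> * integral {a..b} (\<lambda>x. f (- \<i> * Complex (-c) x))"
    by (rule contour_integral_linepath_same_Re) (use assms in auto)
  also have "(\<lambda>x. - \<i> * Complex (-c) x) = (\<lambda>x. Complex x c)" by (auto simp: complex_eq_iff)
  then have "\<And>x. - \<i> * Complex (-c) x = Complex x c" by metis
  then have "\<i> * integral {a..b} (\<lambda>x. f (- \<i> * Complex (-c) x)) = \<i> * integral {a..b} (\<lambda>x. f (Complex x c))"
    by simp
  also have "contour_integral (linepath (\<i> * Complex a c) (\<i> * Complex b c)) (\<lambda>z. f (- \<i> * z))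
     = \<i> * contour_integral (linepath (Complex a c) (Complex b c)) f"
    by (simp add: contour_integral_integral linepath_def algebra_simps scaleR_conv_of_real)
       (simp flip: right_diff_distrib add: mult.assoc)
  finally show ?thesis by simp
qed

text \<open>Kernel estimates valid at every height hold only at some distance from the poles, so
  decay is asked for in the tails alone. On the compact middle part continuity gives a bound
  \<open>C\<close>, and the factor \<open>exp (b * \<bar>R\<bar>)\<close> turns it into a bound of
  exponential type.\<close>

lemma line_integrable_decay:
  fixes \<phi> :: "complex \<Rightarrow> complex"
  assumes cont: "continuous_on {z. Im z = \<eta>} \<phi>" and "b > 0"
    and bound: "\<And>x. \<bar>x\<bar> \<ge> R \<Longrightarrow> norm (\<phi> (Complex x \<eta>)) \<le> B * exp (- b * \<bar>x\<bar>)"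
  shows "integrable lborel (\<lambda>x. \<phi> (Complex x \<eta>))"
proof -
  have "compact ((\<lambda>x. \<phi> (Complex x \<eta>)) ` {- \<bar>R\<bar>..\<bar>R\<bar>})"
    by (intro compact_continuous_image continuous_along_line cont) auto
  then obtain C where "C > 0" and C: "\<And>x. \<bar>x\<bar> \<le> \<bar>R\<bar> \<Longrightarrow> norm (\<phi> (Complex x \<eta>)) \<le> C"
    by (auto dest!: compact_imp_bounded simp: bounded_pos abs_le_iff)
  have "norm (\<phi> (Complex x \<eta>)) \<le> (\<bar>B\<bar> + C * exp (b * \<bar>R\<bar>)) * exp (- b * \<bar>x\<bar>)" for x
  proof (cases "\<bar>x\<bar> \<le> \<bar>R\<bar>")
    case True
    have "C * 1 \<le> C * exp (b * (\<bar>R\<bar> - \<bar>x\<bar>))"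
      using \<open>C > 0\<close> \<open>b > 0\<close> True by (intro mult_left_mono) auto
    also have "\<dots> = C * exp (b * \<bar>R\<bar>) * exp (- b * \<bar>x\<bar>)"
      by (simp add: algebra_simps flip: exp_add)
    also have "\<dots> \<le> (\<bar>B\<bar> + C * exp (b * \<bar>R\<bar>)) * exp (- b * \<bar>x\<bar>)"
      by (intro mult_right_mono) auto
    finally show ?thesis using C[OF True] by simp
  next
    case False
    then have "norm (\<phi> (Complex x \<eta>)) \<le> B * exp (- b * \<bar>x\<bar>)"
      by (intro bound) auto
    also have "\<dots> \<le> (\<bar>B\<bar> + C * exp (b * \<bar>R\<bar>)) * exp (- b * \<bar>x\<bar>)"
      using \<open>C > 0\<close> by (intro mult_right_mono) (auto intro: add_increasing2)
    finally show ?thesis .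
  qed
  from line_integrable[OF cont \<open>b > 0\<close> this] show ?thesis .
qed

lemma holomorphic_decay_integrable:
  fixes \<phi> :: "complex \<Rightarrow> complex"
  assumes "\<phi> holomorphic_on S" "{z. Im z = \<eta>} \<subseteq> S" "b > 0"
    and "\<And>z. Im z = \<eta> \<Longrightarrow> \<bar>Re z\<bar> \<ge> R \<Longrightarrow> norm (\<phi> z) \<le> B * exp (- b * \<bar>Re z\<bar>)"
  shows "integrable lborel (\<lambda>x. \<phi> (Complex x \<eta>))"
proof (rule line_integrable_decay[where R = R and B = B])
  show "continuous_on {z. Im z = \<eta>} \<phi>"
    using assms(1,2) by (meson holomorphic_on_imp_continuous_on holomorphic_on_subset)
  show "norm (\<phi> (Complex x \<eta>)) \<le> B * exp (- b * \<bar>x\<bar>)" if "R \<le> \<bar>x\<bar>" for x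
    using assms(4)[of "Complex x \<eta>"] that by simp
qed (fact \<open>b > 0\<close>)

section \<open>Strips and the shift of horizontal contours\<close>

definition strip :: "real \<Rightarrow> real \<Rightarrow> complex set" where
  "strip \<alpha> \<beta> = {z. \<alpha> < Im z \<and> Im z < \<beta>}"

lemma open_strip [simp]: "open (strip \<alpha> \<beta>)"
  unfolding strip_def by (intro open_Collect_conj open_Collect_less continuous_intros)

lemma convex_strip [simp]: "convex (strip \<alpha> \<beta>)"
proof -
  have "strip \<alpha> \<beta> = {z. Im z > \<alpha>} \<inter> {z. Im z < \<beta>}" by (auto simp: strip_def)
  then show ?thesis using convex_halfspace_Im_gt convex_halfspace_Im_lt convex_Int by metis
qed

lemma connected_strip [simp]: "connected (strip \<alpha> \<beta>)"
  by (simp add: convex_connected)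

text \<open>The boundary of a rectangle of half-width \<open>n\<close> runs to the right at height
  \<open>\<alpha>\<close> and to the left at height \<open>\<beta>\<close>, whence the difference;
  the vertical sides vanish in the limit by the decay bound. The margins \<open>\<alpha>'\<close>
  and \<open>\<beta>'\<close> place the closed rectangle in an open set.\<close>

lemma line_integral_residue:
  fixes \<phi> :: "complex \<Rightarrow> complex"
  assumes order: "\<alpha>' < \<alpha>" "\<alpha> < \<beta>" "\<beta> < \<beta>'" and "finite P"
    and P: "\<And>p. p \<in> P \<Longrightarrow> p \<in> strip \<alpha> \<beta>"
    and holo: "\<phi> holomorphic_on (strip \<alpha>' \<beta>' - P)" and "b > 0"
    and bound: "\<And>z. \<alpha> \<le> Im z \<Longrightarrow> Im z \<le> \<beta> \<Longrightarrow> \<bar>Re z\<bar> \<ge> R \<Longrightarrow> norm (\<phi> z) \<le> B * exp (- b * \<bar>Re z\<bar>)"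
  shows "line_integral \<alpha> \<phi> - line_integral \<beta> \<phi> = 2 * pi * \<i> * (\<Sum>p\<in>P. residue \<phi> p)"
proof -
  define r where "r = 2 * pi * \<i> * (\<Sum>p\<in>P. residue \<phi> p)"
  have line: "integrable lborel (\<lambda>x. \<phi> (Complex x \<eta>))" if "\<eta> = \<alpha> \<or> \<eta> = \<beta>" for \<eta>
    by (rule holomorphic_decay_integrable[OF holo _ \<open>b > 0\<close>])
       (use that P order bound in \<open>force simp: strip_def\<close>)+
  define J where "J = (\<lambda>n \<eta>. integral {- real n..real n} (\<lambda>x. \<phi> (Complex x \<eta>)))"
  have J: "(\<lambda>n. J n \<eta>) \<longlonglongrightarrow> line_integral \<eta> \<phi>" if "\<eta> = \<alpha> \<or> \<eta> = \<beta>" for \<eta>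
    unfolding J_def by (rule tendsto_line_integral[OF line[OF that]])
  \<comment> \<open>Once its half-width reaches \<open>R'\<close>, the rectangle encloses all of
    \<open>P\<close>, and every winding number is 1.\<close>
  obtain R' where R': "\<And>p. p \<in> P \<Longrightarrow> \<bar>Re p\<bar> < R'"
  proof -
    have "bounded (Re ` P)" using \<open>finite P\<close> by (intro finite_imp_bounded) auto
    then obtain a where "\<And>p. p \<in> P \<Longrightarrow> \<bar>Re p\<bar> \<le> a" unfolding bounded_iff by auto
    then show ?thesis by (intro that[of "a + 1"]) force
  qed
  have est: "norm (J n \<alpha> - J n \<beta> - r) \<le> 2 * (\<bar>B\<bar> * exp (- b * real n) * (\<beta> - \<alpha>))"
    if n: "real n \<ge> R" "real n \<ge> R'" "real n > 0" for n
  proof -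
    let ?n = "real n"
    let ?a = "Complex (-?n) \<alpha>" and ?b = "Complex ?n \<alpha>"
      and ?c = "Complex ?n \<beta>" and ?d = "Complex (-?n) \<beta>"
    have seg: "closed_segment ?a ?b \<subseteq> strip \<alpha>' \<beta>' - P" "closed_segment ?b ?c \<subseteq> strip \<alpha>' \<beta>' - P"
      "closed_segment ?c ?d \<subseteq> strip \<alpha>' \<beta>' - P" "closed_segment ?d ?a \<subseteq> strip \<alpha>' \<beta>' - P"
    proof -
      have *: "z \<in> strip \<alpha>' \<beta>' - P" if "Im z = \<alpha> \<or> Im z = \<beta> \<or> \<bar>Re z\<bar> = ?n \<and> \<alpha> \<le> Im z \<and> Im z \<le> \<beta>" for z
      proof -
        have "z \<notin> P"
          using that P[of z] R'[of z] n by (auto simp: strip_def)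
        then show ?thesis using that order by (auto simp: strip_def)
      qed
      show "closed_segment ?a ?b \<subseteq> strip \<alpha>' \<beta>' - P" "closed_segment ?c ?d \<subseteq> strip \<alpha>' \<beta>' - P"
        by (auto simp: closed_segment_same_Im simp del: Diff_iff intro!: *)
      show "closed_segment ?b ?c \<subseteq> strip \<alpha>' \<beta>' - P" "closed_segment ?d ?a \<subseteq> strip \<alpha>' \<beta>' - P"
        using order n by (auto simp: closed_segment_same_Re closed_segment_eq_real_ivl simp del: Diff_iff intro!: *)
    qed
    have "contour_integral (rectpath ?a ?c) \<phi>
        = 2 * pi * \<i> * (\<Sum>p\<in>P. winding_number (rectpath ?a ?c) p * residue \<phi> p)"
    proof (rule Residue_theorem[of "strip \<alpha>' \<beta>'"])
      show "path_image (rectpath ?a ?c) \<subseteq> strip \<alpha>' \<beta>' - P"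
        using seg by (auto simp: rectpath_def Let_def path_image_join)
      show "\<forall>z. z \<notin> strip \<alpha>' \<beta>' \<longrightarrow> winding_number (rectpath ?a ?c) z = 0"
        using order n by (auto intro!: winding_number_rectpath_outside simp: in_cbox_complex_iff strip_def)
    qed (use holo \<open>finite P\<close> in auto)
    also have "(\<Sum>p\<in>P. winding_number (rectpath ?a ?c) p * residue \<phi> p) = (\<Sum>p\<in>P. residue \<phi> p)"
    proof (rule sum.cong)
      fix p assume p: "p \<in> P"
      have "p \<in> box ?a ?c"
        using P[OF p] R'[OF p] n by (auto simp: in_box_complex_iff strip_def)
      then show "winding_number (rectpath ?a ?c) p * residue \<phi> p = residue \<phi> p"
        by (simp add: winding_number_rectpath)
    qed auto
    finally have rect: "contour_integral (rectpath ?a ?c) \<phi> = r"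
      by (simp add: r_def)
    have cont: "continuous_on (strip \<alpha>' \<beta>' - P) \<phi>"
      using holo by (rule holomorphic_on_imp_continuous_on)
    have conts: "continuous_on (closed_segment ?a ?b) \<phi>" "continuous_on (closed_segment ?b ?c) \<phi>"
      "continuous_on (closed_segment ?c ?d) \<phi>" "continuous_on (closed_segment ?d ?a) \<phi>"
      using seg cont continuous_on_subset by blast+
    note int = conts[THEN contour_integrable_continuous_linepath]
    have "contour_integral (rectpath ?a ?c) \<phi> =
        contour_integral (linepath ?a ?b) \<phi> + contour_integral (linepath ?b ?c) \<phi>
        + contour_integral (linepath ?c ?d) \<phi> + contour_integral (linepath ?d ?a) \<phi>"
      using int by (simp add: rectpath_def Let_def contour_integrable_joinI)
    moreover have "contour_integral (linepath ?a ?b) \<phi> = J n \<alpha>"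
      using conts n unfolding J_def by (intro contour_integral_linepath_same_Im) auto
    moreover have "contour_integral (linepath ?c ?d) \<phi> = - J n \<beta>"
    proof -
      have "continuous_on (closed_segment ?d ?c) \<phi>"
        using conts by (simp add: closed_segment_commute)
      then have "contour_integral (linepath ?d ?c) \<phi> = J n \<beta>"
        using n unfolding J_def by (intro contour_integral_linepath_same_Im) auto
      then show ?thesis
        using contour_integral_reverse_linepath[OF \<open>continuous_on (closed_segment ?d ?c) \<phi>\<close>]
        by (metis minus_minus)
    qed
    moreover have side: "norm (contour_integral (linepath u v) \<phi>)
        \<le> \<bar>B\<bar> * exp (- b * ?n) * (\<beta> - \<alpha>)"
      if "u = ?b \<and> v = ?c \<or> u = ?d \<and> v = ?a" for u v
    proof -
      have "norm (contour_integral (linepath u v) \<phi>) \<le> \<bar>B\<bar> * exp (- b * ?n) * norm (v - u)"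
      proof (rule contour_integral_bound_linepath)
        show "\<phi> contour_integrable_on linepath u v" using that int by auto
        fix z assume "z \<in> closed_segment u v"
        then have z: "\<alpha> \<le> Im z" "Im z \<le> \<beta>" "\<bar>Re z\<bar> = ?n"
          using that order n
          by (auto simp: closed_segment_same_Re closed_segment_eq_real_ivl split: if_splits)
        have "norm (\<phi> z) \<le> B * exp (- b * \<bar>Re z\<bar>)"
          by (rule bound) (use z n in auto)
        then show "norm (\<phi> z) \<le> \<bar>B\<bar> * exp (- b * ?n)"
          using z by (smt (verit) exp_gt_zero mult_right_mono)
      qed auto
      also have "norm (v - u) = \<beta> - \<alpha>"
        using that order by (auto simp: cmod_def)
      finally show ?thesis .
    qed
    ultimately have "J n \<alpha> - J n \<beta> - r =
        - (contour_integral (linepath ?b ?c) \<phi> + contour_integral (linepath ?d ?a) \<phi>)"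
      using rect by (simp add: algebra_simps)
    then have "norm (J n \<alpha> - J n \<beta> - r) \<le>
        norm (contour_integral (linepath ?b ?c) \<phi>) + norm (contour_integral (linepath ?d ?a) \<phi>)"
      by (simp only: norm_minus_cancel norm_triangle_ineq)
    with side[of ?b ?c] side[of ?d ?a] show ?thesis by simp
  qed
  have "(\<lambda>n. J n \<alpha> - J n \<beta> - r) \<longlonglongrightarrow> 0"
  proof (rule Lim_null_comparison)
    show "\<forall>\<^sub>F n in sequentially. norm (J n \<alpha> - J n \<beta> - r) \<le> 2 * (\<bar>B\<bar> * exp (- b * real n) * (\<beta> - \<alpha>))"
      using eventually_ge_at_top[of "nat \<lceil>R\<rceil>"] eventually_ge_at_top[of "nat \<lceil>R'\<rceil>"] eventually_gt_at_top[of 0]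
      by eventually_elim (rule est, linarith+)
    have "(\<lambda>n. 2 * (\<bar>B\<bar> * exp (- b * real n) * (\<beta> - \<alpha>))) \<longlonglongrightarrow> 2 * (\<bar>B\<bar> * 0 * (\<beta> - \<alpha>))"
      by (intro tendsto_intros exp_neg_nat_tendsto_0 \<open>b > 0\<close>)
    then show "(\<lambda>n. 2 * (\<bar>B\<bar> * exp (- b * real n) * (\<beta> - \<alpha>))) \<longlonglongrightarrow> 0" by simp
  qed
  moreover have "(\<lambda>n. J n \<alpha> - J n \<beta> - r) \<longlonglongrightarrow> line_integral \<alpha> \<phi> - line_integral \<beta> \<phi> - r"
    by (intro tendsto_intros J) auto
  ultimately have "line_integral \<alpha> \<phi> - line_integral \<beta> \<phi> - r = 0"
    using LIMSEQ_unique by blast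
  then show ?thesis by (simp add: r_def)
qed

lemma line_integral_shift:
  fixes \<phi> :: "complex \<Rightarrow> complex"
  assumes "\<alpha>' < \<alpha>" "\<alpha> < \<beta>" "\<beta> < \<beta>'" "\<phi> holomorphic_on strip \<alpha>' \<beta>'" "b > 0"
    and "\<And>z. \<alpha> \<le> Im z \<Longrightarrow> Im z \<le> \<beta> \<Longrightarrow> \<bar>Re z\<bar> \<ge> R \<Longrightarrow> norm (\<phi> z) \<le> B * exp (- b * \<bar>Re z\<bar>)"
  shows "line_integral \<alpha> \<phi> = line_integral \<beta> \<phi>"
  using line_integral_residue[of \<alpha>' \<alpha> \<beta> \<beta>' "{}" \<phi> b R B] assms by auto


section \<open>Cauchy transforms in the logarithmic coordinate\<close>

text \<open>The Cauchy kernel in logarithmic form: exp(v) / (exp(\<zeta>) - exp(v)) is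
  \<open>kern (\<zeta> - v)\<close>. It tends to -1 as the real part of its argument goes to minus
  infinity and decays exponentially in the other direction.\<close>

definition kern :: "complex \<Rightarrow> complex" where
  "kern z = 1 / (exp z - 1)"

lemma kern_periodic: "kern (z + 2 * pi * \<i>) = kern z" "kern (z - 2 * pi * \<i>) = kern z"
  by (simp_all add: kern_def exp_add exp_diff mult.commute)

lemma exp_neq_1_strip:
  assumes "z \<in> strip (- (2 * pi)) 0"
  shows "exp z \<noteq> 1"
proof
  assume "exp z = 1"
  then obtain n :: int where n: "Im z = of_int (2 * n) * pi" by (auto simp: exp_eq_1)
  with assms have "of_int (2 * n) * pi < 0 * pi" "- 2 * pi < of_int (2 * n) * pi"
    by (auto simp: strip_def)
  then have "real_of_int (2 * n) < 0" "- 2 < real_of_int (2 * n)"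
    by (simp_all only: mult_less_cancel_right_pos[OF pi_gt_zero])
  then have "n < 0" "- 1 < n" by linarith+
  then show False by linarith
qed

text \<open>The point \<open>exp z\<close> lies at an angle of at least \<open>\<delta>\<close> from
  the positive axis. With \<open>r\<close> its modulus and \<open>c = cos \<delta>\<close>,
  completing the square in \<open>r\<^sup>2 - 2 * (r * c) + 1\<close> with respect to
  \<open>r\<close> gives one bound, and with respect to the constant 1 the other.\<close>

lemma norm_exp_minus_1_ge:
  assumes "0 < \<delta>" "\<delta> \<le> pi / 2" "- (2 * pi) + \<delta> \<le> Im z" "Im z \<le> - \<delta>"
  shows "norm (exp z - 1) \<ge> sin \<delta>" "norm (exp z - 1) \<ge> sin \<delta> * exp (Re z)"
proof -
  define r c where "r = exp (Re z)" and "c = cos \<delta>"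
  have "cos (Im z) \<le> c"
  proof (cases "Im z \<ge> - pi")
    case True
    then have "cos (- Im z) \<le> cos \<delta>"
      using assms by (intro cos_monotone_0_pi_le) auto
    then show ?thesis by (simp add: c_def)
  next
    case False
    then have "cos (Im z + 2 * pi) \<le> cos \<delta>"
      using assms by (intro cos_monotone_0_pi_le) auto
    then show ?thesis by (simp add: c_def)
  qed
  then have "r * cos (Im z) \<le> r * c"
    by (simp add: r_def)
  moreover have "(norm (exp z - 1))\<^sup>2 = r\<^sup>2 - 2 * (r * cos (Im z)) + 1"
    unfolding cmod_power2
    by (simp add: Re_exp Im_exp power2_diff power_mult_distrib sin_squared_eq flip: r_def)
       (simp add: algebra_simps)
  ultimately have *: "(norm (exp z - 1))\<^sup>2 \<ge> r\<^sup>2 - 2 * (r * c) + 1"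
    by simp
  have s: "(sin \<delta>)\<^sup>2 = 1 - c\<^sup>2" by (simp add: c_def sin_squared_eq)
  have "r\<^sup>2 - 2 * (r * c) + 1 = (r - c)\<^sup>2 + (sin \<delta>)\<^sup>2"
    unfolding s by (simp add: power2_eq_square algebra_simps)
  then have "(sin \<delta>)\<^sup>2 \<le> (norm (exp z - 1))\<^sup>2"
    using * by (smt (verit) zero_le_power2)
  then show "norm (exp z - 1) \<ge> sin \<delta>" by (rule power2_le_imp_le) simp
  have "r\<^sup>2 - 2 * (r * c) + 1 = (r * c - 1)\<^sup>2 + (sin \<delta> * r)\<^sup>2"
    unfolding power_mult_distrib s by (simp add: power2_eq_square algebra_simps)
  then have "(sin \<delta> * r)\<^sup>2 \<le> (norm (exp z - 1))\<^sup>2"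
    using * by (smt (verit) zero_le_power2)
  then show "norm (exp z - 1) \<ge> sin \<delta> * exp (Re z)"
    unfolding r_def by (rule power2_le_imp_le) simp
qed

text \<open>The first bound serves for integrability, the second for decay to the right, and the
  third controls the factor that appears when the kernel is differentiated.\<close>

lemma kern_bound:
  assumes "0 < \<delta>" "\<delta> \<le> pi / 2" "- (2 * pi) + \<delta> \<le> Im z" "Im z \<le> - \<delta>"
  shows "norm (kern z) \<le> 1 / sin \<delta>" "norm (kern z) \<le> exp (- Re z) / sin \<delta>"
    "norm (exp z * kern z) \<le> 1 / sin \<delta>"
proof -
  have s: "sin \<delta> > 0" using assms by (intro sin_gt_zero) auto
  note * = norm_exp_minus_1_ge[OF assms]
  have e: "norm (exp z - 1) > 0" using * s by linarith
  show "norm (kern z) \<le> 1 / sin \<delta>"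
    using * s e by (simp add: kern_def norm_divide frac_le)
  show **: "norm (kern z) \<le> exp (- Re z) / sin \<delta>"
    using * s e by (simp add: kern_def norm_divide exp_minus field_simps)
  have "norm (exp z * kern z) \<le> exp (Re z) * (exp (- Re z) / sin \<delta>)"
    using ** unfolding norm_mult norm_exp_eq_Re by (intro mult_left_mono) auto
  then show "norm (exp z * kern z) \<le> 1 / sin \<delta>" by (simp add: exp_minus)
qed

text \<open>When a contour is moved across a pole, the imaginary part passes through 0 and bounds
  that rest on an angle fail. Far from the imaginary axis the moduli of \<open>exp z\<close> and 1
  already differ enough, at every height.\<close>

lemma kern_far:
  shows "Re z \<le> - 1 \<Longrightarrow> norm (kern z) \<le> 2" "Re z \<ge> 1 \<Longrightarrow> norm (kern z) \<le> 2 * exp (- Re z)"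
proof -
  have e: "2 \<le> exp (1::real)" using exp_ge_add_one_self[of 1] by simp
  have *: "norm (exp z - 1) \<ge> \<bar>exp (Re z) - 1\<bar>"
    using norm_triangle_ineq3[of "exp z" 1] by simp
  show "norm (kern z) \<le> 2" if "Re z \<le> - 1"
  proof -
    have "exp (Re z) \<le> exp (-1)" using that by simp
    also have "\<dots> \<le> 1 / 2" using e by (simp add: exp_minus field_simps)
    finally have "norm (exp z - 1) \<ge> 1 / 2" using * by linarith
    then have "1 / norm (exp z - 1) \<le> 1 / (1 / 2)" by (intro divide_left_mono mult_pos_pos) linarith+
    then show ?thesis by (simp add: kern_def norm_divide)
  qed
  show "norm (kern z) \<le> 2 * exp (- Re z)" if "Re z \<ge> 1"
  proof -
    have "exp (Re z) \<ge> exp 1" using that by simp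
    then have "exp (Re z) \<ge> 2" using e by linarith
    then have "norm (exp z - 1) \<ge> exp (Re z) / 2" using * by linarith
    moreover have "norm (exp z - 1) > 0" using calculation by (smt (verit) exp_gt_zero half_gt_zero)
    ultimately show ?thesis by (simp add: kern_def norm_divide exp_minus field_simps)
  qed
qed

lemma exp_quotient_tendsto: "((\<lambda>h::complex. (exp h - 1) / h) \<longlongrightarrow> 1) (at 0)"
  using DERIV_exp[of "0::complex"] by (simp add: has_field_derivative_iff)

text \<open>The sign comes from the integration variable entering as
  \<open>\<zeta> - v\<close>.\<close>

lemma kern_residue:
  assumes "open S" "\<zeta> \<in> S" "g holomorphic_on S"
  shows "residue (\<lambda>v. g v * kern (\<zeta> - v)) \<zeta> = - g \<zeta>"
proof (rule residue_simple')
  \<comment> \<open>Radius 1 is smaller than the distance 2\<pi> to the neighbouring poles.\<close>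
  show "open (S \<inter> ball \<zeta> 1)" "\<zeta> \<in> S \<inter> ball \<zeta> 1" using assms by auto
  show "(\<lambda>v. g v * kern (\<zeta> - v)) holomorphic_on S \<inter> ball \<zeta> 1 - {\<zeta>}"
    unfolding kern_def
  proof (intro holomorphic_intros)
    show "g holomorphic_on S \<inter> ball \<zeta> 1 - {\<zeta>}"
      using assms(3) by (rule holomorphic_on_subset) auto
    fix v assume v: "v \<in> S \<inter> ball \<zeta> 1 - {\<zeta>}"
    show "exp (\<zeta> - v) - 1 \<noteq> 0"
    proof
      assume "exp (\<zeta> - v) - 1 = 0"
      then have "exp (\<zeta> - v) = exp 0" by simp
      moreover have "\<bar>Im (\<zeta> - v) - Im 0\<bar> < 2 * pi"
        using v abs_Im_le_cmod[of "\<zeta> - v"] pi_gt3 by (simp add: dist_norm)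
      ultimately have "\<zeta> - v = 0" by (rule exp_complex_eqI[rotated])
      with v show False by simp
    qed
  qed
  have "((\<lambda>v. (exp (\<zeta> - v) - 1) / (\<zeta> - v)) \<longlongrightarrow> 1) (at \<zeta>)"
  proof (rule filterlim_compose[OF exp_quotient_tendsto])
    show "filterlim (\<lambda>v. \<zeta> - v) (at 0) (at \<zeta>)"
      unfolding filterlim_at by (auto intro!: tendsto_eq_intros simp: eventually_at_filter)
  qed
  moreover have "(g \<longlongrightarrow> g \<zeta>) (at \<zeta>)"
    using assms holomorphic_on_imp_continuous_on continuous_on_eq_continuous_at isCont_def by blast
  ultimately have "((\<lambda>v. - g v / ((exp (\<zeta> - v) - 1) / (\<zeta> - v))) \<longlongrightarrow> - g \<zeta> / 1) (at \<zeta>)"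
    by (intro tendsto_intros) auto
  then show "((\<lambda>v. g v * kern (\<zeta> - v) * (v - \<zeta>)) \<longlongrightarrow> - g \<zeta>) (at \<zeta>)"
    by (simp add: kern_def field_simps)
qed

section \<open>Cauchy transforms along a line: analyticity, contour shifts and decay\<close>

definition ctrans :: "real \<Rightarrow> (complex \<Rightarrow> complex) \<Rightarrow> complex \<Rightarrow> complex" where
  "ctrans \<eta> g \<zeta> = line_integral \<eta> (\<lambda>v. g v * kern (\<zeta> - v))"

lemma ctrans_periodic: "ctrans \<eta> g (\<zeta> - 2 * pi * \<i>) = ctrans \<eta> g \<zeta>"
proof -
  have "kern (\<zeta> - 2 * pi * \<i> - v) = kern (\<zeta> - v)" for v
    using kern_periodic(2)[of "\<zeta> - v"] by (simp add: algebra_simps)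
  then show ?thesis by (simp add: ctrans_def)
qed

lemma kern_measurable [measurable]: "kern \<in> borel_measurable borel"
proof -
  have [measurable]: "(exp :: complex \<Rightarrow> complex) \<in> borel_measurable borel"
    by (intro borel_measurable_continuous_onI continuous_intros)
  show ?thesis unfolding kern_def[abs_def] by measurable
qed

lemma Complex_measurable [measurable]: "(\<lambda>x. Complex x \<eta>) \<in> borel_measurable borel"
  by (intro borel_measurable_continuous_onI continuous_intros)

lemma ctrans_integrable:
  assumes g: "integrable lborel (\<lambda>x. g (Complex x \<eta>))"
    and \<delta>: "0 < \<delta>" "\<delta> \<le> pi / 2" "\<eta> - 2 * pi + \<delta> \<le> Im \<zeta>" "Im \<zeta> \<le> \<eta> - \<delta>"
  shows "integrable lborel (\<lambda>x. g (Complex x \<eta>) * kern (\<zeta> - Complex x \<eta>))"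
proof (rule Bochner_Integration.integrable_bound)
  show "integrable lborel (\<lambda>x. norm (g (Complex x \<eta>)) * (1 / sin \<delta>))"
    using g by (intro integrable_mult_left integrable_norm)
  have [measurable]: "(\<lambda>x. g (Complex x \<eta>)) \<in> borel_measurable borel"
    using g by (auto dest: borel_measurable_integrable)
  show "(\<lambda>x. g (Complex x \<eta>) * kern (\<zeta> - Complex x \<eta>)) \<in> borel_measurable lborel"
    by simp
  have "norm (kern (\<zeta> - Complex x \<eta>)) \<le> 1 / sin \<delta>" for x
    using \<delta> by (intro kern_bound(1)) auto
  then have "norm (g (Complex x \<eta>)) * norm (kern (\<zeta> - Complex x \<eta>))
      \<le> norm (g (Complex x \<eta>)) * (1 / sin \<delta>)" for x
    by (rule mult_left_mono) simp
  moreover have "sin \<delta> > 0" using \<delta> by (intro sin_gt_zero) auto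
  ultimately show "AE x in lborel. norm (g (Complex x \<eta>) * kern (\<zeta> - Complex x \<eta>))
      \<le> norm (norm (g (Complex x \<eta>)) * (1 / sin \<delta>))"
    by (intro AE_I2) (simp add: norm_mult)
qed

lemma norm_ctrans_le:
  assumes g: "integrable lborel (\<lambda>x. g (Complex x \<eta>))"
    and \<delta>: "0 < \<delta>" "\<delta> \<le> pi / 2" "\<eta> - 2 * pi + \<delta> \<le> Im \<zeta>" "Im \<zeta> \<le> \<eta> - \<delta>"
  shows "norm (ctrans \<eta> g \<zeta>) \<le> (LINT x|lborel. norm (g (Complex x \<eta>))) / sin \<delta>"
proof -
  have "norm (ctrans \<eta> g \<zeta>) \<le> (LINT x|lborel. norm (g (Complex x \<eta>) * kern (\<zeta> - Complex x \<eta>)))"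
    unfolding ctrans_def line_integral_def by (rule integral_norm_bound)
  also have "\<dots> \<le> (LINT x|lborel. norm (g (Complex x \<eta>)) * (1 / sin \<delta>))"
  proof (rule integral_mono)
    have "norm (kern (\<zeta> - Complex x \<eta>)) \<le> 1 / sin \<delta>" for x
      using \<delta> by (intro kern_bound(1)) auto
    then show "norm (g (Complex x \<eta>) * kern (\<zeta> - Complex x \<eta>)) \<le> norm (g (Complex x \<eta>)) * (1 / sin \<delta>)" for x
      unfolding norm_mult by (intro mult_left_mono) auto
  qed (use g ctrans_integrable[OF assms] in auto)
  also have "\<dots> = (LINT x|lborel. norm (g (Complex x \<eta>))) / sin \<delta>"
    by simp
  finally show ?thesis .
qed

lemma gap_strip:
  assumes "\<zeta> \<in> strip (\<eta> - 2 * pi) \<eta>"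
  obtains \<delta> where "0 < \<delta>" "\<delta> \<le> pi / 2" "\<eta> - 2 * pi + 2 * \<delta> \<le> Im \<zeta>" "Im \<zeta> \<le> \<eta> - 2 * \<delta>"
  using assms by (intro that[of "min (\<eta> - Im \<zeta>) (Im \<zeta> - (\<eta> - 2 * pi)) / 2"]) (auto simp: strip_def min_def)

text \<open>Differentiation under the integral sign by dominated convergence along sequences; an
  exact factorisation of the difference quotient of the kernel supplies the majorant.\<close>

lemma ctrans_has_derivative:
  assumes g: "integrable lborel (\<lambda>x. g (Complex x \<eta>))"
    and \<zeta>: "\<zeta> \<in> strip (\<eta> - 2 * pi) \<eta>"
  shows "(ctrans \<eta> g has_field_derivative
      line_integral \<eta> (\<lambda>v. - (g v * exp (\<zeta> - v) * (kern (\<zeta> - v))\<^sup>2))) (at \<zeta>)"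
proof -
  \<comment> \<open>A margin of \<open>2 * \<delta>\<close> at \<open>\<zeta>\<close> leaves
    \<open>\<delta>\<close> for all points within distance \<open>\<delta>\<close>.\<close>
  obtain \<delta> where \<delta>: "0 < \<delta>" "\<delta> \<le> pi / 2" "\<eta> - 2 * pi + 2 * \<delta> \<le> Im \<zeta>" "Im \<zeta> \<le> \<eta> - 2 * \<delta>"
    using gap_strip[OF \<zeta>] .
  have s: "sin \<delta> > 0" using \<delta> by (intro sin_gt_zero) auto
  have "\<forall>\<^sub>F h in at (0::complex). norm ((exp h - 1) / h) < 2"
    using order_tendstoD(2)[OF tendsto_norm[OF exp_quotient_tendsto], of 2] by simp
  then obtain r0 where "r0 > 0" and r0: "\<And>h::complex. h \<noteq> 0 \<Longrightarrow> norm h < r0 \<Longrightarrow> norm ((exp h - 1) / h) < 2"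
    unfolding eventually_at by (auto simp: dist_norm)
  define r where "r = min r0 \<delta>"
  have "r > 0" using \<open>r0 > 0\<close> \<delta> by (simp add: r_def)
  have [measurable]: "(\<lambda>x. g (Complex x \<eta>)) \<in> borel_measurable borel"
    using g by (auto dest: borel_measurable_integrable)
  have [measurable]: "(exp :: complex \<Rightarrow> complex) \<in> borel_measurable borel"
    by (intro borel_measurable_continuous_onI continuous_intros)
  have im: "\<eta> - 2 * pi + \<delta> \<le> Im (\<zeta> + h)" "Im (\<zeta> + h) \<le> \<eta> - \<delta>" if "norm h < r" for h
    using abs_Im_le_cmod[of h] that \<delta> by (auto simp: r_def)
  \<comment> \<open>The three factors are bounded separately, by 2, \<open>1 / sin \<delta>\<close>
    and \<open>1 / sin \<delta>\<close>.\<close>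
  have quot: "(kern (z + h) - kern z) / h = - ((exp h - 1) / h * (exp z * kern z) * kern (z + h))"
    if "exp z \<noteq> 1" "exp (z + h) \<noteq> 1" "h \<noteq> 0" for z h
    using that by (simp add: kern_def divide_simps exp_add) (simp add: algebra_simps)
  have ne: "exp (\<zeta> + h - Complex x \<eta>) \<noteq> 1" if "norm h < r" for h x
    using im[OF that] \<delta> by (intro exp_neq_1_strip) (auto simp: strip_def)
  have "((\<lambda>h. (ctrans \<eta> g (\<zeta> + h) - ctrans \<eta> g \<zeta>) / h) \<longlongrightarrow>
      line_integral \<eta> (\<lambda>v. - (g v * exp (\<zeta> - v) * (kern (\<zeta> - v))\<^sup>2))) (at 0 within ball 0 r)"
    unfolding tendsto_at_iff_sequentially
  proof (intro allI impI)
    fix X :: "nat \<Rightarrow> complex"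
    assume "\<forall>i. X i \<in> ball 0 r - {0}" and lim: "X \<longlonglongrightarrow> 0"
    then have X: "norm (X i) < r" "X i \<noteq> 0" for i by auto
    have "(\<lambda>i. LINT x|lborel. g (Complex x \<eta>) * ((kern (\<zeta> - Complex x \<eta> + X i) - kern (\<zeta> - Complex x \<eta>)) / X i))
       \<longlonglongrightarrow> (LINT x|lborel. - (g (Complex x \<eta>) * exp (\<zeta> - Complex x \<eta>) * (kern (\<zeta> - Complex x \<eta>))\<^sup>2))"
    proof (rule integral_dominated_convergence)
      show "integrable lborel (\<lambda>x. norm (g (Complex x \<eta>)) * (2 * (1 / sin \<delta>) * (1 / sin \<delta>)))"
        using g by (intro integrable_mult_left integrable_norm)
      show "AE x in lborel. norm (g (Complex x \<eta>) * ((kern (\<zeta> - Complex x \<eta> + X i) - kern (\<zeta> - Complex x \<eta>)) / X i))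
          \<le> norm (g (Complex x \<eta>)) * (2 * (1 / sin \<delta>) * (1 / sin \<delta>))" for i
      proof (rule AE_I2)
        fix x
        let ?z = "\<zeta> - Complex x \<eta>"
        have e: "exp ?z \<noteq> 1" "exp (?z + X i) \<noteq> 1"
          using ne[of 0 x] ne[of "X i" x] X \<open>r > 0\<close> by (auto simp: algebra_simps)
        have "norm ((exp (X i) - 1) / X i) \<le> 2"
          using r0[of "X i"] X[of i] by (simp add: r_def)
        moreover have "norm (exp ?z * kern ?z) \<le> 1 / sin \<delta>"
          using im[of 0] \<open>r > 0\<close> \<delta> by (intro kern_bound) auto
        moreover have "norm (kern (?z + X i)) \<le> 1 / sin \<delta>"
          using im[of "X i"] X \<delta> by (intro kern_bound) auto
        ultimately have "norm ((kern (?z + X i) - kern ?z) / X i) \<le> 2 * (1 / sin \<delta>) * (1 / sin \<delta>)"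
          unfolding quot[OF e X(2)] norm_minus_cancel norm_mult[of "_ * _" "kern (?z + X i)"]
            norm_mult[of "(exp (X i) - 1) / X i"]
          using s by (intro mult_mono) auto
        then show "norm (g (Complex x \<eta>) * ((kern (?z + X i) - kern ?z) / X i))
            \<le> norm (g (Complex x \<eta>)) * (2 * (1 / sin \<delta>) * (1 / sin \<delta>))"
          unfolding norm_mult[of "g _"] by (intro mult_left_mono) auto
      qed
      show "AE x in lborel. (\<lambda>i. g (Complex x \<eta>) * ((kern (\<zeta> - Complex x \<eta> + X i) - kern (\<zeta> - Complex x \<eta>)) / X i))
          \<longlonglongrightarrow> - (g (Complex x \<eta>) * exp (\<zeta> - Complex x \<eta>) * (kern (\<zeta> - Complex x \<eta>))\<^sup>2)"
      proof (rule AE_I2)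
        fix x
        let ?z = "\<zeta> - Complex x \<eta>"
        have e: "exp ?z \<noteq> 1" using ne[of 0 x] \<open>r > 0\<close> by simp
        then have "(kern has_field_derivative - exp ?z * (kern ?z)\<^sup>2) (at ?z)"
          unfolding kern_def by (auto intro!: derivative_eq_intros simp: power2_eq_square field_simps)
        then have "((\<lambda>h. (kern (?z + h) - kern ?z) / h) \<longlongrightarrow> - exp ?z * (kern ?z)\<^sup>2) (at 0)"
          unfolding DERIV_def .
        moreover have "filterlim X (at 0) sequentially"
          using X lim by (simp add: filterlim_at)
        ultimately have "(\<lambda>i. (kern (?z + X i) - kern ?z) / X i) \<longlonglongrightarrow> - exp ?z * (kern ?z)\<^sup>2"
          by (rule filterlim_compose)
        from tendsto_mult[OF tendsto_const[of "g (Complex x \<eta>)"] this]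
        show "(\<lambda>i. g (Complex x \<eta>) * ((kern (?z + X i) - kern ?z) / X i))
          \<longlonglongrightarrow> - (g (Complex x \<eta>) * exp ?z * (kern ?z)\<^sup>2)" by (simp add: mult.assoc)
      qed
    qed measurable
    moreover have "(ctrans \<eta> g (\<zeta> + X i) - ctrans \<eta> g \<zeta>) / X i =
       (LINT x|lborel. g (Complex x \<eta>) * ((kern (\<zeta> - Complex x \<eta> + X i) - kern (\<zeta> - Complex x \<eta>)) / X i))" for i
    proof -
      have "integrable lborel (\<lambda>x. g (Complex x \<eta>) * kern (\<zeta> + X i - Complex x \<eta>))"
        using im[of "X i"] X \<delta> by (intro ctrans_integrable[OF g \<delta>(1,2)]) auto
      moreover have "integrable lborel (\<lambda>x. g (Complex x \<eta>) * kern (\<zeta> - Complex x \<eta>))"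
        using im[of 0] \<open>r > 0\<close> \<delta> by (intro ctrans_integrable[OF g \<delta>(1,2)]) auto
      ultimately have "ctrans \<eta> g (\<zeta> + X i) - ctrans \<eta> g \<zeta> =
          (LINT x|lborel. g (Complex x \<eta>) * kern (\<zeta> + X i - Complex x \<eta>) - g (Complex x \<eta>) * kern (\<zeta> - Complex x \<eta>))"
        by (simp add: ctrans_def line_integral_def)
      also have "\<dots> / X i = (LINT x|lborel. (g (Complex x \<eta>) * kern (\<zeta> + X i - Complex x \<eta>) - g (Complex x \<eta>) * kern (\<zeta> - Complex x \<eta>)) / X i)"
        by simp
      finally show ?thesis by (simp add: algebra_simps diff_divide_distrib)
    qed
    ultimately show "((\<lambda>h. (ctrans \<eta> g (\<zeta> + h) - ctrans \<eta> g \<zeta>) / h) \<circ> X) \<longlonglongrightarrow>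
      line_integral \<eta> (\<lambda>v. - (g v * exp (\<zeta> - v) * (kern (\<zeta> - v))\<^sup>2))"
      by (simp only: o_def line_integral_def)
  qed
  then show ?thesis
    unfolding DERIV_def using at_within_open[of 0 "ball 0 r :: complex set"] \<open>r > 0\<close> by simp
qed

lemma ctrans_holomorphic:
  assumes "integrable lborel (\<lambda>x. g (Complex x \<eta>))"
  shows "ctrans \<eta> g holomorphic_on strip (\<eta> - 2 * pi) \<eta>"
  using ctrans_has_derivative[OF assms] holomorphic_on_open open_strip by blast

text \<open>To the right the kernel is only bounded and the decay is that of \<open>g\<close>; to
  the left the kernel decays with rate 1 and \<open>g\<close> need only be bounded. This is why the
  common rate satisfies \<open>b \<le> 1\<close>.\<close>

lemma kern_product_decay:
  assumes b: "0 < b" "b \<le> 1"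
    and R: "\<And>z. z \<in> S \<Longrightarrow> Re z \<ge> R \<Longrightarrow> norm (g z) \<le> B * exp (- b * Re z)"
    and L: "\<And>z. z \<in> S \<Longrightarrow> Re z \<le> - R \<Longrightarrow> norm (g z) \<le> B"
    and z: "z \<in> S" "\<bar>Re z\<bar> \<ge> \<bar>R\<bar> + \<bar>Re \<zeta>\<bar> + 1"
  shows "norm (g z * kern (\<zeta> - z)) \<le> 2 * \<bar>B\<bar> * exp \<bar>Re \<zeta>\<bar> * exp (- b * \<bar>Re z\<bar>)"
proof (cases "Re z \<ge> 0")
  case True
  have "norm (g z) \<le> \<bar>B\<bar> * exp (- b * Re z)"
    using R[OF z(1)] z(2) True by (smt (verit) exp_gt_zero mult_right_mono)
  moreover have "norm (kern (\<zeta> - z)) \<le> 2 * exp \<bar>Re \<zeta>\<bar>"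
    using kern_far(1)[of "\<zeta> - z"] z(2) True by (smt (verit) one_le_exp_iff minus_complex.sel(1))
  ultimately have "norm (g z) * norm (kern (\<zeta> - z)) \<le> (\<bar>B\<bar> * exp (- b * Re z)) * (2 * exp \<bar>Re \<zeta>\<bar>)"
    by (intro mult_mono) auto
  then show ?thesis using True by (simp add: norm_mult mult_ac)
next
  case False
  have "norm (g z) \<le> \<bar>B\<bar>"
    using L[OF z(1)] z(2) False by linarith
  moreover have "norm (kern (\<zeta> - z)) \<le> 2 * exp (- Re (\<zeta> - z))"
    using kern_far(2)[of "\<zeta> - z"] z(2) False by simp
  moreover have "b * \<bar>Re z\<bar> \<le> \<bar>Re z\<bar>"
    using b by (simp add: mult_left_le_one_le)
  then have "- Re (\<zeta> - z) \<le> \<bar>Re \<zeta>\<bar> - b * \<bar>Re z\<bar>"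
    using False unfolding minus_complex.sel by linarith
  then have "exp (- Re (\<zeta> - z)) \<le> exp \<bar>Re \<zeta>\<bar> * exp (- b * \<bar>Re z\<bar>)"
    by (simp flip: exp_add)
  ultimately have "norm (g z) * norm (kern (\<zeta> - z)) \<le> \<bar>B\<bar> * (2 * (exp \<bar>Re \<zeta>\<bar> * exp (- b * \<bar>Re z\<bar>)))"
    by (intro mult_mono) auto
  then show ?thesis by (simp add: norm_mult mult_ac)
qed

lemma exp_diff_minus_1_neq_0:
  assumes "\<zeta> - v \<in> strip (- (2 * pi)) 0 \<or> \<zeta> - v \<in> strip 0 (2 * pi) \<or> (Im \<zeta> = Im v \<and> \<zeta> \<noteq> v)"
  shows "exp (\<zeta> - v) - 1 \<noteq> 0"
proof
  assume "exp (\<zeta> - v) - 1 = 0"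
  then have "exp (\<zeta> - v) = exp 0" by simp
  moreover have "\<bar>Im (\<zeta> - v) - Im 0\<bar> < 2 * pi"
    using assms by (auto simp: strip_def)
  ultimately have "\<zeta> - v = 0" by (rule exp_complex_eqI[rotated])
  with assms show False by (auto simp: strip_def)
qed

lemma ctrans_shift_residue:
  assumes order: "\<alpha>' < \<alpha>" "\<alpha> < \<beta>" "\<beta> < \<beta>'" "\<beta> - \<alpha> \<le> 2 * pi" and \<zeta>: "\<zeta> \<in> strip \<alpha> \<beta>"
    and holo: "g holomorphic_on strip \<alpha>' \<beta>'" and b: "0 < b" "b \<le> 1"
    and bound: "\<And>z. \<alpha> \<le> Im z \<Longrightarrow> Im z \<le> \<beta> \<Longrightarrow> Re z \<ge> R \<Longrightarrow> norm (g z) \<le> B * exp (- b * Re z)"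
      "\<And>z. \<alpha> \<le> Im z \<Longrightarrow> Im z \<le> \<beta> \<Longrightarrow> Re z \<le> - R \<Longrightarrow> norm (g z) \<le> B"
  shows "ctrans \<alpha> g \<zeta> - ctrans \<beta> g \<zeta> = - (2 * pi * \<i> * g \<zeta>)"
proof -
  \<comment> \<open>In the strip cut down in this way \<open>\<zeta>\<close> is the only pole; its
    translates by 2\<pi>\<i> are at best on the boundary.\<close>
  define \<alpha>1 \<beta>1 where "\<alpha>1 = max \<alpha>' (Im \<zeta> - 2 * pi)" and "\<beta>1 = min \<beta>' (Im \<zeta> + 2 * pi)"
  have order1: "\<alpha>1 < \<alpha>" "\<beta> < \<beta>1" using order \<zeta> by (auto simp: \<alpha>1_def \<beta>1_def strip_def)
  have h: "(\<lambda>v. g v * kern (\<zeta> - v)) holomorphic_on strip \<alpha>1 \<beta>1 - {\<zeta>}"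
    unfolding kern_def
  proof (intro holomorphic_intros)
    show "g holomorphic_on strip \<alpha>1 \<beta>1 - {\<zeta>}"
      using holo by (rule holomorphic_on_subset) (auto simp: strip_def \<alpha>1_def \<beta>1_def)
    show "exp (\<zeta> - v) - 1 \<noteq> 0" if "v \<in> strip \<alpha>1 \<beta>1 - {\<zeta>}" for v
      using that by (intro exp_diff_minus_1_neq_0) (auto simp: strip_def \<alpha>1_def \<beta>1_def)
  qed
  have "line_integral \<alpha> (\<lambda>v. g v * kern (\<zeta> - v)) - line_integral \<beta> (\<lambda>v. g v * kern (\<zeta> - v))
      = 2 * pi * \<i> * (\<Sum>p\<in>{\<zeta>}. residue (\<lambda>v. g v * kern (\<zeta> - v)) p)"
  proof (rule line_integral_residue[OF order1(1) order(2) order1(2) _ _ h b(1)])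
    fix z :: complex
    assume z: "\<alpha> \<le> Im z" "Im z \<le> \<beta>" "\<bar>Re z\<bar> \<ge> \<bar>R\<bar> + \<bar>Re \<zeta>\<bar> + 1"
    show "norm (g z * kern (\<zeta> - z)) \<le> 2 * \<bar>B\<bar> * exp \<bar>Re \<zeta>\<bar> * exp (- b * \<bar>Re z\<bar>)"
      by (rule kern_product_decay[OF b, of "{z. \<alpha> \<le> Im z \<and> Im z \<le> \<beta>}" R]) (use z bound in auto)
  qed (use \<zeta> in auto)
  moreover have "residue (\<lambda>v. g v * kern (\<zeta> - v)) \<zeta> = - g \<zeta>"
    by (rule kern_residue[OF open_strip _ holo]) (use \<zeta> order in \<open>auto simp: strip_def\<close>)
  ultimately show ?thesis by (simp add: ctrans_def)
qed

lemma ctrans_shift: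
  assumes order: "\<alpha>' < \<alpha>" "\<alpha> < \<beta>" "\<beta> < \<beta>'" and \<zeta>: "\<zeta> \<in> strip (\<beta> - 2 * pi) \<alpha>"
    and holo: "g holomorphic_on strip \<alpha>' \<beta>'" and b: "0 < b" "b \<le> 1"
    and bound: "\<And>z. \<alpha> \<le> Im z \<Longrightarrow> Im z \<le> \<beta> \<Longrightarrow> Re z \<ge> R \<Longrightarrow> norm (g z) \<le> B * exp (- b * Re z)"
      "\<And>z. \<alpha> \<le> Im z \<Longrightarrow> Im z \<le> \<beta> \<Longrightarrow> Re z \<le> - R \<Longrightarrow> norm (g z) \<le> B"
  shows "ctrans \<alpha> g \<zeta> = ctrans \<beta> g \<zeta>"
proof -
  \<comment> \<open>The strip is cut down to the heights between the poles \<open>\<zeta>\<close>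
    and \<open>\<zeta>\<close> + 2\<pi>\<i>, where the integrand is holomorphic.\<close>
  define \<alpha>1 \<beta>1 where "\<alpha>1 = max \<alpha>' (Im \<zeta>)" and "\<beta>1 = min \<beta>' (Im \<zeta> + 2 * pi)"
  have order1: "\<alpha>1 < \<alpha>" "\<beta> < \<beta>1" using order \<zeta> by (auto simp: \<alpha>1_def \<beta>1_def strip_def)
  have h: "(\<lambda>v. g v * kern (\<zeta> - v)) holomorphic_on strip \<alpha>1 \<beta>1"
    unfolding kern_def
  proof (intro holomorphic_intros)
    show "g holomorphic_on strip \<alpha>1 \<beta>1"
      using holo by (rule holomorphic_on_subset) (auto simp: strip_def \<alpha>1_def \<beta>1_def)
    show "exp (\<zeta> - v) - 1 \<noteq> 0" if "v \<in> strip \<alpha>1 \<beta>1" for v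
      using that by (intro exp_diff_minus_1_neq_0) (auto simp: strip_def \<alpha>1_def \<beta>1_def)
  qed
  show ?thesis unfolding ctrans_def
  proof (rule line_integral_shift[OF order1(1) order(2) order1(2) h b(1)])
    fix z :: complex
    assume z: "\<alpha> \<le> Im z" "Im z \<le> \<beta>" "\<bar>Re z\<bar> \<ge> \<bar>R\<bar> + \<bar>Re \<zeta>\<bar> + 1"
    show "norm (g z * kern (\<zeta> - z)) \<le> 2 * \<bar>B\<bar> * exp \<bar>Re \<zeta>\<bar> * exp (- b * \<bar>Re z\<bar>)"
      by (rule kern_product_decay[OF b, of "{z. \<alpha> \<le> Im z \<and> Im z \<le> \<beta>}" R]) (use z bound in auto)
  qed
qed

text \<open>The decay rate \<open>b\<close> of \<open>g\<close> is split in halves: one is traded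
  for decay in \<open>Re \<zeta>\<close>, the other keeps the integral over the line finite.\<close>

lemma ctrans_decay:
  assumes cont: "continuous_on {z. Im z = \<eta>} g" and b: "0 < b" "b \<le> 1"
    and g: "\<And>x. norm (g (Complex x \<eta>)) \<le> B * exp (- b * \<bar>x\<bar>)"
    and \<delta>: "0 < \<delta>" "\<delta> \<le> pi / 2" "\<eta> - 2 * pi + \<delta> \<le> Im \<zeta>" "Im \<zeta> \<le> \<eta> - \<delta>"
  shows "norm (ctrans \<eta> g \<zeta>) \<le> B / sin \<delta> * (LINT x|lborel. exp (- (b / 2) * \<bar>x\<bar>)) * min 1 (exp (- (b / 2) * Re \<zeta>))"
proof -
  let ?h = "\<lambda>x. exp (- (b / 2) * \<bar>x\<bar>) :: real"
  define d where "d = min 1 (exp (- (b / 2) * Re \<zeta>))"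
  have s: "sin \<delta> > 0" using \<delta> by (intro sin_gt_zero) auto
  have "0 \<le> B" using order_trans[OF norm_ge_zero g[of 0]] by simp
  have ptw: "norm (g (Complex x \<eta>) * kern (\<zeta> - Complex x \<eta>)) \<le> B / sin \<delta> * d * ?h x" for x
  proof -
    define u where "u = Re \<zeta> - x"
    have k: "norm (kern (\<zeta> - Complex x \<eta>)) \<le> 1 / sin \<delta>"
      "norm (kern (\<zeta> - Complex x \<eta>)) \<le> exp (- u) / sin \<delta>"
      using kern_bound[of \<delta> "\<zeta> - Complex x \<eta>"] \<delta> by (auto simp: u_def)
    \<comment> \<open>The minimum of two positive numbers is at most any weighted geometric mean of
      them, here with weights \<open>1 - b / 2\<close> and \<open>b / 2\<close>.\<close>
    have "min 1 (exp (- u)) \<le> exp (- (b / 2) * u)"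
    proof (cases "u \<ge> 0")
      case True
      have "(b / 2) * u \<le> 1 * u" using b True by (intro mult_right_mono) auto
      then show ?thesis by (intro min.coboundedI2) simp
    next
      case False
      then have "(b / 2) * u \<le> 0" using b by (intro mult_nonneg_nonpos) auto
      then show ?thesis by (intro min.coboundedI1) simp
    qed
    moreover have "norm (kern (\<zeta> - Complex x \<eta>)) \<le> min 1 (exp (- u)) / sin \<delta>"
      using k by (simp add: min_def)
    ultimately have k': "norm (kern (\<zeta> - Complex x \<eta>)) \<le> exp (- (b / 2) * u) / sin \<delta>"
      using s by (meson divide_right_mono less_imp_le order_trans)
    have A: "exp (- b * \<bar>x\<bar>) \<le> ?h x" using b by simp
    have "exp (- b * \<bar>x\<bar>) * exp (- (b / 2) * u) \<le> exp (- (b / 2) * Re \<zeta>) * ?h x"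
      unfolding exp_add[symmetric] using mult_left_mono[of x "\<bar>x\<bar>" "b / 2"] b
      by (simp add: u_def algebra_simps)
    then have "exp (- b * \<bar>x\<bar>) * norm (kern (\<zeta> - Complex x \<eta>)) \<le> exp (- (b / 2) * Re \<zeta>) * ?h x / sin \<delta>"
      using mult_left_mono[OF k', of "exp (- b * \<bar>x\<bar>)"] s by (smt (verit) divide_right_mono exp_ge_zero times_divide_eq_right)
    moreover have "exp (- b * \<bar>x\<bar>) * norm (kern (\<zeta> - Complex x \<eta>)) \<le> ?h x * (1 / sin \<delta>)"
      using A k(1) by (intro mult_mono) auto
    ultimately have "exp (- b * \<bar>x\<bar>) * norm (kern (\<zeta> - Complex x \<eta>)) \<le> d * ?h x / sin \<delta>"
      by (simp add: d_def min_def)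
    from mult_left_mono[OF this \<open>0 \<le> B\<close>]
    have "B * exp (- b * \<bar>x\<bar>) * norm (kern (\<zeta> - Complex x \<eta>)) \<le> B / sin \<delta> * d * ?h x"
      by (simp add: mult_ac)
    moreover have "norm (g (Complex x \<eta>)) * norm (kern (\<zeta> - Complex x \<eta>)) \<le> B * exp (- b * \<bar>x\<bar>) * norm (kern (\<zeta> - Complex x \<eta>))"
      using g by (intro mult_right_mono) auto
    ultimately show ?thesis by (simp add: norm_mult)
  qed
  have int: "integrable lborel (\<lambda>x. g (Complex x \<eta>) * kern (\<zeta> - Complex x \<eta>))"
    by (rule ctrans_integrable[OF line_integrable[OF cont b(1) g] \<delta>])
  have "norm (ctrans \<eta> g \<zeta>) \<le> (LINT x|lborel. norm (g (Complex x \<eta>) * kern (\<zeta> - Complex x \<eta>)))"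
    unfolding ctrans_def line_integral_def by (rule integral_norm_bound)
  also have "\<dots> \<le> (LINT x|lborel. B / sin \<delta> * d * ?h x)"
    by (rule integral_mono) (use int ptw integrable_exp_neg_abs[of "b/2"] b in \<open>auto intro!: integrable_mult_right\<close>)
  also have "\<dots> = B / sin \<delta> * d * (LINT x|lborel. ?h x)" by (rule integral_mult_right_zero)
  finally show ?thesis by (simp add: d_def mult_ac)
qed


section \<open>Complete Bell polynomials\<close>

text \<open>Entries beyond \<open>m\<close> must vanish, since each \<open>j * k j\<close> is at
  most the total \<open>m\<close>. Padding with zeros lets Bell polynomials of different orders be
  compared over tuples of one length.\<close>

lemma bell_Y_eq_sum:
  assumes "m \<le> M"
  shows "bell_Y m y = (\<Sum>k | k \<in> {1..M} \<rightarrow>\<^sub>E UNIV \<and> (\<Sum>j=1..M. j * k j) = m.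
    \<Prod>j=1..M. y j ^ k j / fact (k j))"
proof -
  have split: "{1..M} = {1..m} \<union> {m<..M}" "{1..m} \<inter> {m<..M} = {}" using assms by auto
  have zero: "k i = 0" if "(\<Sum>j=1..M. j * k j) = m" "m < i" "i \<le> M" for k :: "nat \<Rightarrow> nat" and i
  proof (rule ccontr)
    assume "k i \<noteq> 0"
    then have "i \<le> i * k i" by simp
    also have "\<dots> \<le> (\<Sum>j=1..M. j * k j)" using that by (intro member_le_sum) auto
    finally show False using that by simp
  qed
  show ?thesis unfolding bell_Y_def bell_tuples_def
  proof (rule sum.reindex_bij_witness[of _ "\<lambda>k. restrict k {1..m}"
        "\<lambda>k. \<lambda>j\<in>{1..M}. if j \<le> m then k j else 0"], goal_cases)
    case (1 k)
    then show ?case using assms by (auto simp: PiE_iff extensional_def fun_eq_iff)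
  next
    case (2 k)
    have "(\<Sum>j=1..M. j * (if j \<le> m then k j else 0)) = (\<Sum>j=1..m. j * k j)"
      by (rule sum.mono_neutral_cong_right) (use assms in auto)
    then show ?case using 2 by auto
  next
    case (3 k)
    show ?case
    proof
      fix i
      show "(\<lambda>j\<in>{1..M}. if j \<le> m then restrict k {1..m} j else 0) i = k i"
        using 3 zero[of k i] by (cases "i \<in> {1..M}") (auto simp: PiE_iff extensional_def)
    qed
  next
    case (4 k)
    have "(\<Sum>j=1..M. j * k j) = (\<Sum>j=1..m. j * k j)"
      by (rule sum.mono_neutral_right) (use 4 zero[of k] assms in auto)
    then show ?case using 4 by auto
  next
    case (5 k)
    show ?case
      by (rule prod.mono_neutral_cong_right) (use assms in auto)
  qed
qed

text \<open>The logarithmic derivative of the generating function, coefficient by coefficient. Each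
  tuple is weighted by \<open>m\<close>, written as the sum of all \<open>j * k j\<close>; the
  factor \<open>k j\<close> cancels against the factorial, which amounts to removing one part of
  size \<open>j\<close>.\<close>

lemma bell_Y_recursion:
  "of_nat m * bell_Y m y = (\<Sum>j=1..m. of_nat j * y j * bell_Y (m - j) y)"
proof -
  let ?U = "\<lambda>n. {k. k \<in> {1..m} \<rightarrow>\<^sub>E UNIV \<and> (\<Sum>j=1..m. j * k j) = n}"
  let ?w = "\<lambda>k. \<Prod>j=1..m. y j ^ k j / fact (k j)"
  have fin: "finite (?U m)"
    using finite_bell_tuples[of m] by (simp add: bell_tuples_def)
  have "of_nat m * bell_Y m y = (\<Sum>k\<in>?U m. (\<Sum>j=1..m. of_nat j * of_nat (k j)) * ?w k)"
    unfolding bell_Y_eq_sum[OF order_refl] sum_distrib_left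
    by (intro sum.cong) (auto simp flip: of_nat_mult of_nat_sum)
  also have "\<dots> = (\<Sum>j=1..m. of_nat j * (\<Sum>k\<in>?U m. of_nat (k j) * ?w k))"
    unfolding sum_distrib_left sum_distrib_right
    by (subst sum.swap) (simp add: mult_ac)
  also have "\<dots> = (\<Sum>j=1..m. of_nat j * y j * bell_Y (m - j) y)"
  proof (rule sum.cong[OF refl])
    fix j assume j: "j \<in> {1..m}"
    have "(\<Sum>k\<in>?U m. of_nat (k j) * ?w k) = (\<Sum>k | k \<in> ?U m \<and> k j > 0. of_nat (k j) * ?w k)"
      by (rule sum.mono_neutral_right) (use fin in auto)
    also have "\<dots> = (\<Sum>k\<in>?U (m - j). y j * ?w k)"
    proof (rule sum.reindex_bij_witness[of _ "\<lambda>k. k(j := k j + 1)" "\<lambda>k. k(j := k j - 1)"], goal_cases)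
      case (1 k)
      then show ?case by (auto simp: fun_eq_iff)
    next
      case (2 k)
      have "(\<Sum>i=1..m. i * k i) = j * k j + (\<Sum>i\<in>{1..m}-{j}. i * k i)"
        using j by (subst sum.remove[of _ j]) auto
      moreover have "(\<Sum>i=1..m. i * (k(j := k j - 1)) i) = j * (k j - 1) + (\<Sum>i\<in>{1..m}-{j}. i * k i)"
        using j by (subst sum.remove[of _ j]) auto
      moreover have "j * k j = j + j * (k j - 1)"
        using 2 by (cases "k j") auto
      ultimately show ?case using 2 j by (auto simp: PiE_iff extensional_def)
    next
      case (3 k)
      then show ?case by (auto simp: fun_eq_iff)
    next
      case (4 k)
      have "(\<Sum>i=1..m. i * k i) = j * k j + (\<Sum>i\<in>{1..m}-{j}. i * k i)"
        using j by (subst sum.remove[of _ j]) auto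
      moreover have "(\<Sum>i=1..m. i * (k(j := k j + 1)) i) = j * (k j + 1) + (\<Sum>i\<in>{1..m}-{j}. i * k i)"
        using j by (subst sum.remove[of _ j]) auto
      ultimately show ?case using 4 j by (auto simp: PiE_iff extensional_def)
    next
      case (5 k)
      have "?w k = y j ^ k j / fact (k j) * (\<Prod>i\<in>{1..m}-{j}. y i ^ k i / fact (k i))"
        using j by (subst prod.remove[of _ j]) auto
      moreover have "?w (k(j := k j - 1)) = y j ^ (k j - 1) / fact (k j - 1) * (\<Prod>i\<in>{1..m}-{j}. y i ^ k i / fact (k i))"
        using j by (subst prod.remove[of _ j]) auto
      moreover have "of_nat (k j) * (y j ^ k j / fact (k j)) = y j * (y j ^ (k j - 1) / fact (k j - 1))"
        using 5 by (cases "k j") (simp_all del: of_nat_Suc)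
      ultimately show ?case by (metis (no_types, lifting) mult.assoc)
    qed
    also have "\<dots> = y j * bell_Y (m - j) y"
      by (subst bell_Y_eq_sum[of "m - j" m]) (auto simp: sum_distrib_left)
    finally show "of_nat j * (\<Sum>k\<in>?U m. of_nat (k j) * ?w k) = of_nat j * y j * bell_Y (m - j) y"
      by (simp add: mult.assoc)
  qed
  finally show ?thesis .
qed

lemma bell_Y_cong: "(\<And>j. 1 \<le> j \<Longrightarrow> j \<le> m \<Longrightarrow> y j = y' j) \<Longrightarrow> bell_Y m y = bell_Y m y'"
  unfolding bell_Y_def by (intro sum.cong prod.cong) auto

text \<open>
  In terms of generating functions, replacing \<open>y\<^sub>k\<close> by \<open>y\<^sub>k - t\<^sup>k / k\<close> multiplies
  \<open>exp (\<Sum>k. y\<^sub>k x\<^sup>k)\<close> by \<open>1 - t x\<close>.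
\<close>

lemma bell_Y_shift:
  "bell_Y (Suc m) (\<lambda>k. y k - t ^ k / of_nat k) = bell_Y (Suc m) y - t * bell_Y m y"
proof -
  define y' where "y' = (\<lambda>k. y k - t ^ k / of_nat k)"
  \<comment> \<open>These are the coefficients of the product of the old generating function with 1
    - tx. The recursion for \<open>y'\<close> determines its Bell polynomials from those of smaller
    order, so it suffices that \<open>Z\<close> obeys it.\<close>
  define Z where "Z = (\<lambda>m. case m of 0 \<Rightarrow> 1 | Suc n \<Rightarrow> bell_Y (Suc n) y - t * bell_Y n y)"
  have "bell_Y n y' = Z n" for n
  proof (induction n rule: less_induct)
    case (less n)
    show ?case
    proof (cases n)
      case 0
      then show ?thesis by (simp add: bell_Y_0 Z_def)
    next
      case (Suc l)
      have Z: "Z i = bell_Y i y - (if i = 0 then 0 else t * bell_Y (i - 1) y)" for i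
        by (cases i) (auto simp: Z_def bell_Y_0)
      \<comment> \<open>The sum telescopes because each \<open>Z\<close> is a difference of
        consecutive terms; only \<open>Z 0\<close> lacks the subtracted term, whence the case
        \<open>i = n\<close> in the partial sums.\<close>
      have tel: "(\<Sum>j=1..n. t ^ j * Z (n - j)) = t * bell_Y l y" 
      proof -
        have "(\<Sum>j=1..i. t ^ j * Z (n - j)) = t * bell_Y l y - (if i = n then 0 else t ^ Suc i * bell_Y (l - i) y)"
          if "i \<le> n" for i
          using that
        proof (induction i)
          case 0
          then show ?case using Suc by simp
        next
          case (Suc i)
          have e: "n - Suc i = l - i" using \<open>n = Suc l\<close> by simp
          show ?case using Suc \<open>n = Suc l\<close> by (simp add: Z e algebra_simps)
        qed
        from this[of n] show ?thesis by simp
      qed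
      have "of_nat n * bell_Y n y' = (\<Sum>j=1..n. of_nat j * y' j * Z (n - j))"
        unfolding bell_Y_recursion by (intro sum.cong) (auto simp: less)
      also have "\<dots> = (\<Sum>j=1..n. of_nat j * y j * Z (n - j)) - (\<Sum>j=1..n. t ^ j * Z (n - j))"
        unfolding sum_subtractf[symmetric] by (intro sum.cong) (auto simp: y'_def field_simps)
      also have "(\<Sum>j=1..n. of_nat j * y j * Z (n - j)) =
          (\<Sum>j=1..n. of_nat j * y j * bell_Y (n - j) y)
          - (\<Sum>j=1..n. if n - j = 0 then 0 else of_nat j * y j * (t * bell_Y (n - j - 1) y))"
        unfolding sum_subtractf[symmetric] by (intro sum.cong) (auto simp: Z algebra_simps)
      also have "(\<Sum>j=1..n. of_nat j * y j * bell_Y (n - j) y) = of_nat n * bell_Y n y"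
        by (rule bell_Y_recursion[symmetric])
      also have "(\<Sum>j=1..n. if n - j = 0 then 0 else of_nat j * y j * (t * bell_Y (n - j - 1) y))
         = t * (of_nat l * bell_Y l y)"
        unfolding bell_Y_recursion sum_distrib_left
        by (rule sum.mono_neutral_cong_right) (auto simp: Suc mult_ac diff_diff_add)
      finally have "of_nat n * bell_Y n y' = of_nat n * Z n"
        unfolding tel by (simp add: Suc Z algebra_simps)
      then show ?thesis using Suc by (simp del: of_nat_Suc)
    qed
  qed
  from this[of "Suc m"] show ?thesis by (simp add: y'_def Z_def)
qed

lemma bell_Y_holomorphic:
  assumes "\<And>j. 1 \<le> j \<Longrightarrow> j \<le> m \<Longrightarrow> y j holomorphic_on S"
  shows "(\<lambda>z. bell_Y m (\<lambda>j. y j z)) holomorphic_on S"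
  unfolding bell_Y_def using assms by (intro holomorphic_intros) auto

text \<open>For \<open>m \<ge> 1\<close> every tuple has a positive entry, so every product contains
  a factor \<open>d\<close>, and \<open>d \<le> 1\<close> absorbs the remaining ones. The
  non-constant Bell polynomials thus inherit the decay of their arguments.\<close>

lemma bell_Y_bound:
  assumes "0 \<le> d" "d \<le> 1" "0 \<le> D" "m \<ge> 1"
    and "\<And>j. 1 \<le> j \<Longrightarrow> j \<le> m \<Longrightarrow> norm (y j) \<le> D * d"
  shows "norm (bell_Y m y) \<le> (\<Sum>k\<in>bell_tuples m. \<Prod>j=1..m. D ^ k j) * d"
proof -
  have "norm (\<Prod>j=1..m. y j ^ k j / fact (k j)) \<le> (\<Prod>j=1..m. D ^ k j) * d" if k: "k \<in> bell_tuples m" for k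
  proof -
    have "norm (\<Prod>j=1..m. y j ^ k j / fact (k j)) \<le> (\<Prod>j=1..m. D ^ k j * d ^ k j)"
      unfolding prod_norm[symmetric]
    proof (intro prod_mono conjI)
      fix j assume j: "j \<in> {1..m}"
      have "norm (y j ^ k j / fact (k j)) \<le> norm (y j) ^ k j"
        by (simp add: norm_divide norm_power divide_le_eq mult_left_le_one_le mult_le_cancel_left1 fact_ge_1)
      also have "\<dots> \<le> (D * d) ^ k j" using assms(5) j by (intro power_mono) auto
      finally show "norm (y j ^ k j / fact (k j)) \<le> D ^ k j * d ^ k j" by (simp add: power_mult_distrib)
    qed auto
    also have "\<dots> = (\<Prod>j=1..m. D ^ k j) * d ^ (\<Sum>j=1..m. k j)"
      by (simp add: prod.distrib power_sum)
    also have "\<dots> \<le> (\<Prod>j=1..m. D ^ k j) * d ^ 1"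
    proof (intro mult_left_mono power_decreasing)
      show "1 \<le> (\<Sum>j=1..m. k j)"
      proof (rule ccontr)
        assume "\<not> 1 \<le> (\<Sum>j=1..m. k j)"
        then have "(\<Sum>j=1..m. k j) = 0" by linarith
        then have "(\<Sum>j=1..m. j * k j) = 0" by (simp add: sum_eq_0_iff)
        with k \<open>m \<ge> 1\<close> show False by (simp add: bell_tuples_def)
      qed
    qed (use assms in \<open>auto intro: prod_nonneg\<close>)
    finally show ?thesis by simp
  qed
  then show ?thesis
    unfolding bell_Y_def sum_distrib_right by (intro sum_norm_le)
qed


section \<open>The perturbed hyperterminants and their limit\<close>

lemma line_subset_strip: "\<alpha> < \<eta> \<Longrightarrow> \<eta> < \<beta> \<Longrightarrow> {z. Im z = \<eta>} \<subseteq> strip \<alpha> \<beta>"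
  by (auto simp: strip_def)

lemma continuous_on_line:
  assumes "g holomorphic_on strip \<alpha> \<beta>" "\<alpha> < \<eta>" "\<eta> < \<beta>"
  shows "continuous_on {z. Im z = \<eta>} g"
  using continuous_on_subset[OF holomorphic_on_imp_continuous_on[OF assms(1)] line_subset_strip[OF assms(2,3)]] .

text \<open>
  With \<open>\<theta> = arg \<sigma>\<close>, write every variable of a hyperterminant as \<open>exp (v + i (\<pi> - \<theta>))\<close>. Rays become horizontal
  lines, \<open>dt / (z - t)\<close> becomes \<open>kern (\<zeta> - v) dv\<close>, and the initial sector becomes \<open>-2\<pi> < Im \<zeta> < 0\<close>.
  The weight belonging to \<open>\<sigma>\<close> rotated by \<open>\<epsilon>\<close> is \<open>f \<epsilon>\<close>, and \<open>G \<epsilon> m\<close> is the perturbed hyperterminant.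
\<close>

locale hyp_family =
  fixes f :: "real \<Rightarrow> complex \<Rightarrow> complex" and M b \<tau> :: real
  assumes b: "0 < b" "b \<le> 1" and \<tau>: "0 < \<tau>" "\<tau> \<le> pi / 2"
    and holo: "f \<epsilon> holomorphic_on UNIV"
    and bound: "0 \<le> \<epsilon> \<Longrightarrow> \<epsilon> \<le> \<tau> \<Longrightarrow> - \<tau> \<le> Im v \<Longrightarrow> Im v \<le> 0 \<Longrightarrow>
      norm (f \<epsilon> v) \<le> M * exp (- b * \<bar>Re v\<bar>)"
    and lim: "- \<tau> \<le> Im v \<Longrightarrow> Im v \<le> 0 \<Longrightarrow> ((\<lambda>\<epsilon>. f \<epsilon> v) \<longlongrightarrow> f 0 v) (at_right 0)"
begin

text \<open>Each step adds a new outermost variable. Rotating \<open>\<sigma>\<close> by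
  \<open>m * \<epsilon>\<close> lowers the argument of its ray by as much, so the line of
  integration descends to height \<open>- (m * \<epsilon>)\<close>.\<close>

fun G :: "real \<Rightarrow> nat \<Rightarrow> complex \<Rightarrow> complex" where
  "G \<epsilon> 0 \<zeta> = 1"
| "G \<epsilon> (Suc m) \<zeta> = ctrans (- (real m * \<epsilon>)) (\<lambda>v. f (real m * \<epsilon>) v * G \<epsilon> m v) \<zeta>"

lemma M_nonneg: "0 \<le> M"
  using order_trans[OF norm_ge_zero bound[of 0 0]] \<tau> by simp

lemma f_holo: "f \<epsilon> holomorphic_on S"
  using holo by (rule holomorphic_on_subset) auto

lemma prod_bound:
  assumes "0 \<le> \<epsilon>" "\<epsilon> \<le> \<tau>" "- \<tau> \<le> Im v" "Im v \<le> 0" "norm (g v) \<le> C"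
  shows "norm (f \<epsilon> v * g v) \<le> M * C * exp (- b * \<bar>Re v\<bar>)"
proof -
  have "norm (f \<epsilon> v) * norm (g v) \<le> M * exp (- b * \<bar>Re v\<bar>) * C"
    using assms by (intro mult_mono bound mult_nonneg_nonneg M_nonneg) auto
  then show ?thesis by (simp add: norm_mult mult_ac)
qed

lemma prod_integrable:
  assumes "0 \<le> \<epsilon>" "\<epsilon> \<le> \<tau>" "- \<tau> \<le> \<eta>" "\<eta> \<le> 0"
    and cont: "continuous_on {z. Im z = \<eta>} g" and C: "\<And>v. Im v = \<eta> \<Longrightarrow> norm (g v) \<le> C"
  shows "integrable lborel (\<lambda>x. f \<epsilon> (Complex x \<eta>) * g (Complex x \<eta>))"
    "(LINT x|lborel. norm (f \<epsilon> (Complex x \<eta>) * g (Complex x \<eta>))) \<le> M * C * (LINT x|lborel. exp (- b * \<bar>x\<bar>))"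
proof -
  have *: "norm (f \<epsilon> (Complex x \<eta>) * g (Complex x \<eta>)) \<le> M * C * exp (- b * \<bar>x\<bar>)" for x
    using prod_bound[of \<epsilon> "Complex x \<eta>" g C] assms by simp
  have "continuous_on {z. Im z = \<eta>} (\<lambda>v. f \<epsilon> v * g v)"
    by (intro continuous_intros cont holomorphic_on_imp_continuous_on f_holo)
  from line_integrable[OF this b(1) *]
  show int: "integrable lborel (\<lambda>x. f \<epsilon> (Complex x \<eta>) * g (Complex x \<eta>))" .
  have "(LINT x|lborel. norm (f \<epsilon> (Complex x \<eta>) * g (Complex x \<eta>))) \<le> (LINT x|lborel. M * C * exp (- b * \<bar>x\<bar>))"
    by (rule integral_mono) (use int * integrable_exp_neg_abs[OF b(1)] in \<open>auto intro!: integrable_mult_right\<close>)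
  also have "\<dots> = M * C * (LINT x|lborel. exp (- b * \<bar>x\<bar>))" by (rule integral_mult_right_zero)
  finally show "(LINT x|lborel. norm (f \<epsilon> (Complex x \<eta>) * g (Complex x \<eta>))) \<le> M * C * (LINT x|lborel. exp (- b * \<bar>x\<bar>))" .
qed

text \<open>For \<open>m \<ge> 1\<close> the cut of \<open>G \<epsilon> m\<close> is at height
  \<open>(1 - m) * \<epsilon>\<close>, whereas the next integration takes place at height
  \<open>- (m * \<epsilon>)\<close>: a gap of \<open>\<epsilon>\<close> separates them. The bound
  obtained from it degenerates as \<open>\<epsilon>\<close> tends to 0. Height \<open>- pi\<close>
  is below all contours in use and well above the lower edge.\<close>

lemma G_regular:
  assumes "0 < \<epsilon>" "real m * \<epsilon> \<le> \<tau>"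
  shows "G \<epsilon> m holomorphic_on strip (- (2 * pi)) ((1 - real m) * \<epsilon>)" (is "?P m")
    and "\<exists>C. \<forall>\<zeta>. - pi \<le> Im \<zeta> \<longrightarrow> Im \<zeta> \<le> - (real m * \<epsilon>) \<longrightarrow> norm (G \<epsilon> m \<zeta>) \<le> C" (is "?Q m")
proof -
  have "?P m \<and> ?Q m" using assms(2)
  proof (induction m)
    case 0
    have "G \<epsilon> 0 = (\<lambda>_. 1)" by (simp add: fun_eq_iff)
    then show ?case by (auto intro!: exI[of _ 1])
  next
    case (Suc m)
    let ?\<eta> = "- (real m * \<epsilon>)"
    have m: "real m * \<epsilon> \<le> \<tau>" "0 \<le> real m * \<epsilon>"
      using Suc.prems assms(1) by (auto simp: algebra_simps)
    with Suc.IH obtain C where h: "G \<epsilon> m holomorphic_on strip (- (2 * pi)) ((1 - real m) * \<epsilon>)"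
      and C: "\<And>\<zeta>. - pi \<le> Im \<zeta> \<Longrightarrow> Im \<zeta> \<le> ?\<eta> \<Longrightarrow> norm (G \<epsilon> m \<zeta>) \<le> C" by auto
    have int: "integrable lborel (\<lambda>x. f (real m * \<epsilon>) (Complex x ?\<eta>) * G \<epsilon> m (Complex x ?\<eta>))"
      by (rule prod_integrable(1)[where C = C])
         (use m \<tau> assms(1) C in \<open>auto intro!: continuous_on_line[OF h] simp: algebra_simps\<close>)
    from ctrans_holomorphic[where g = "\<lambda>v. f (real m * \<epsilon>) v * G \<epsilon> m v", OF int]
    have "(\<lambda>\<zeta>. G \<epsilon> (Suc m) \<zeta>) holomorphic_on strip (?\<eta> - 2 * pi) ?\<eta>"
      unfolding G.simps .
    then have "?P (Suc m)"
      by (rule holomorphic_on_subset) (use m in \<open>auto simp: strip_def\<close>)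
    moreover have "norm (G \<epsilon> (Suc m) \<zeta>) \<le> (LINT x|lborel. norm (f (real m * \<epsilon>) (Complex x ?\<eta>) * G \<epsilon> m (Complex x ?\<eta>))) / sin (min \<epsilon> (pi / 2))"
      if "- pi \<le> Im \<zeta>" "Im \<zeta> \<le> - (real (Suc m) * \<epsilon>)" for \<zeta>
      unfolding G.simps
    proof (rule norm_ctrans_le[where g = "\<lambda>v. f (real m * \<epsilon>) v * G \<epsilon> m v", OF int])
      have s: "real (Suc m) * \<epsilon> = \<epsilon> + real m * \<epsilon>" by (simp add: algebra_simps)
      show "?\<eta> - 2 * pi + min \<epsilon> (pi / 2) \<le> Im \<zeta>"
        using m that(1) pi_gt_zero min.cobounded2[of \<epsilon> "pi / 2"] by linarith
      show "Im \<zeta> \<le> ?\<eta> - min \<epsilon> (pi / 2)"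
        using that(2) min.cobounded1[of \<epsilon> "pi / 2"] unfolding s by linarith
    qed (use assms(1) in auto)
    ultimately show ?case by blast
  qed
  then show "?P m" "?Q m" by auto
qed

text \<open>The cut of \<open>G \<epsilon> m\<close> lies above both lines and the pole
  \<open>\<zeta>\<close> below both, so nothing is crossed on the way to a height independent of
  \<open>\<epsilon>\<close>.\<close>

lemma G_shift:
  assumes "0 < \<epsilon>" "real m * \<epsilon> < \<delta>" "\<delta> \<le> \<tau>" and \<zeta>: "\<zeta> \<in> strip (- (2 * pi)) (- \<delta>)"
  shows "G \<epsilon> (Suc m) \<zeta> = ctrans (- \<delta>) (\<lambda>v. f (real m * \<epsilon>) v * G \<epsilon> m v) \<zeta>"
proof -
  have m: "real m * \<epsilon> \<le> \<tau>" "0 \<le> real m * \<epsilon>" using assms by auto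
  from G_regular[OF assms(1) m(1)] obtain C where
    h: "G \<epsilon> m holomorphic_on strip (- (2 * pi)) ((1 - real m) * \<epsilon>)" and
    C: "\<And>\<zeta>. - pi \<le> Im \<zeta> \<Longrightarrow> Im \<zeta> \<le> - (real m * \<epsilon>) \<Longrightarrow> norm (G \<epsilon> m \<zeta>) \<le> C" by auto
  have p: "norm (f (real m * \<epsilon>) z * G \<epsilon> m z) \<le> M * C * exp (- b * \<bar>Re z\<bar>)"
    if "- \<delta> \<le> Im z" "Im z \<le> - (real m * \<epsilon>)" for z
  proof (rule prod_bound)
    show "norm (G \<epsilon> m z) \<le> C" using that assms \<tau> by (intro C) auto
    show "- \<tau> \<le> Im z" "Im z \<le> 0" using that m assms by linarith+
  qed (use m in auto)
  have "norm (G \<epsilon> m (Complex 0 (- \<delta>))) \<le> C"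
    using assms \<tau> by (intro C) auto
  then have "0 \<le> C" using order_trans[OF norm_ge_zero] by blast
  have "ctrans (- \<delta>) (\<lambda>v. f (real m * \<epsilon>) v * G \<epsilon> m v) \<zeta> = ctrans (- (real m * \<epsilon>)) (\<lambda>v. f (real m * \<epsilon>) v * G \<epsilon> m v) \<zeta>"
  proof (rule ctrans_shift[OF _ _ _ _ _ b])
    show "(\<lambda>v. f (real m * \<epsilon>) v * G \<epsilon> m v) holomorphic_on strip (- (2 * pi)) ((1 - real m) * \<epsilon>)"
      by (intro holomorphic_intros f_holo h)
    show "norm (f (real m * \<epsilon>) z * G \<epsilon> m z) \<le> M * C * exp (- b * Re z)"
      if "- \<delta> \<le> Im z" "Im z \<le> - (real m * \<epsilon>)" "0 \<le> Re z" for z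
      using p[of z] that by simp
    show "norm (f (real m * \<epsilon>) z * G \<epsilon> m z) \<le> M * C"
      if "- \<delta> \<le> Im z" "Im z \<le> - (real m * \<epsilon>)" "Re z \<le> - 0" for z
    proof -
      have "exp (- b * \<bar>Re z\<bar>) \<le> 1" using b by simp
      then have "M * C * exp (- b * \<bar>Re z\<bar>) \<le> M * C * 1"
        using M_nonneg \<open>0 \<le> C\<close> by (intro mult_left_mono) auto
      then show ?thesis using p[of z] that by simp
    qed
    show "\<zeta> \<in> strip (- (real m * \<epsilon>) - 2 * pi) (- \<delta>)"
      using \<zeta> m unfolding strip_def mem_Collect_eq by linarith
    show "- (real m * \<epsilon>) < (1 - real m) * \<epsilon>"
      using assms by (simp add: algebra_simps)
  qed (use assms m \<tau> pi_gt_zero in \<open>auto simp del: pi_gt_zero\<close>)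
  then show ?thesis by simp
qed

text \<open>With the contour moved to height \<open>- (\<delta> / 2)\<close>, its distance to the
  points considered is at least \<open>\<delta> / 2\<close> for every small
  \<open>\<epsilon>\<close>. Each step uses up half of the margin, so the induction has to range
  over all \<open>\<delta>\<close>.\<close>

lemma G_uniform:
  assumes "0 < \<delta>" "\<delta> \<le> \<tau>"
  shows "\<exists>C. \<exists>\<epsilon>0>0. \<forall>\<epsilon>\<in>{0<..<\<epsilon>0}. \<forall>\<zeta>. - pi \<le> Im \<zeta> \<longrightarrow> Im \<zeta> \<le> - \<delta> \<longrightarrow> norm (G \<epsilon> m \<zeta>) \<le> C"
  using assms
proof (induction m arbitrary: \<delta>)
  case 0
  then show ?case by (auto intro!: exI[of _ 1])
next
  case (Suc m)
  obtain C e where "e > 0" and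
    C: "\<And>\<epsilon> \<zeta>. 0 < \<epsilon> \<Longrightarrow> \<epsilon> < e \<Longrightarrow> - pi \<le> Im \<zeta> \<Longrightarrow> Im \<zeta> \<le> - (\<delta> / 2) \<Longrightarrow> norm (G \<epsilon> m \<zeta>) \<le> C"
  proof -
    have "0 < \<delta> / 2" "\<delta> / 2 \<le> \<tau>" using Suc.prems by auto
    from Suc.IH[OF this] obtain C e where "e > 0"
      "\<forall>\<epsilon>\<in>{0<..<e}. \<forall>\<zeta>. - pi \<le> Im \<zeta> \<longrightarrow> Im \<zeta> \<le> - (\<delta> / 2) \<longrightarrow> norm (G \<epsilon> m \<zeta>) \<le> C" by blast
    then show ?thesis by (intro that[of e C]) auto
  qed
  \<comment> \<open>This keeps the original contour, at depth \<open>m * \<epsilon>\<close>, above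
    the new one; the successor avoids a division by zero for \<open>m = 0\<close>.\<close>
  define e' where "e' = min e (\<delta> / (2 * real (Suc m)))"
  have "e' > 0" using \<open>e > 0\<close> Suc.prems by (simp add: e'_def)
  let ?I = "LINT x|lborel. exp (- b * \<bar>x\<bar>)"
  have "norm (G \<epsilon> (Suc m) \<zeta>) \<le> M * C * ?I / sin (\<delta> / 2)"
    if \<epsilon>: "0 < \<epsilon>" "\<epsilon> < e'" and \<zeta>: "- pi \<le> Im \<zeta>" "Im \<zeta> \<le> - \<delta>" for \<epsilon> \<zeta>
  proof -
    have "real m * \<epsilon> < real (Suc m) * (\<delta> / (2 * real (Suc m)))"
      using \<epsilon> by (intro mult_strict_mono) (auto simp: e'_def)
    also have "\<dots> = \<delta> / 2" by (simp del: of_nat_Suc)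
    finally have m: "real m * \<epsilon> < \<delta> / 2" .
    have "G \<epsilon> (Suc m) \<zeta> = ctrans (- (\<delta> / 2)) (\<lambda>v. f (real m * \<epsilon>) v * G \<epsilon> m v) \<zeta>"
      by (rule G_shift) (use \<epsilon> \<zeta> m Suc.prems \<tau> pi_gt_zero in \<open>auto simp: strip_def simp del: pi_gt_zero\<close>)
    have cont: "continuous_on {z. Im z = - (\<delta> / 2)} (G \<epsilon> m)"
      by (rule continuous_on_line[OF G_regular(1)]) (use \<epsilon> m Suc.prems \<tau> in \<open>auto simp: algebra_simps\<close>)
    have bd: "norm (G \<epsilon> m v) \<le> C" if "Im v = - (\<delta> / 2)" for v
      using that \<epsilon> Suc.prems \<tau> by (intro C) (auto simp: e'_def)
    have *: "0 \<le> real m * \<epsilon>" "real m * \<epsilon> \<le> \<tau>" "- \<tau> \<le> - (\<delta> / 2)" "- (\<delta> / 2) \<le> 0"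
      using \<epsilon> m Suc.prems by auto
    note i = prod_integrable[OF * cont bd]
    have "norm (ctrans (- (\<delta> / 2)) (\<lambda>v. f (real m * \<epsilon>) v * G \<epsilon> m v) \<zeta>)
        \<le> (LINT x|lborel. norm (f (real m * \<epsilon>) (Complex x (- (\<delta> / 2))) * G \<epsilon> m (Complex x (- (\<delta> / 2))))) / sin (\<delta> / 2)"
      by (rule norm_ctrans_le) (use i \<zeta> Suc.prems \<tau> in auto)
    also have "\<dots> \<le> M * C * ?I / sin (\<delta> / 2)"
      by (intro divide_right_mono i sin_ge_zero) (use Suc.prems \<tau> in auto)
    finally show ?thesis using \<open>G \<epsilon> (Suc m) \<zeta> = _\<close> by simp
  qed
  then show ?case using \<open>e' > 0\<close> by (intro exI[of _ "M * C * ?I / sin (\<delta> / 2)"] exI[of _ e']) auto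
qed

section \<open>The Bell polynomial side: contour shifts, jump and decay\<close>

lemma f_power_bound:
  assumes "k \<ge> 1" "- \<tau> \<le> Im v" "Im v \<le> 0"
  shows "norm (f 0 v ^ k) \<le> M ^ k * exp (- b * \<bar>Re v\<bar>)"
proof -
  have "norm (f 0 v) ^ k \<le> (M * exp (- b * \<bar>Re v\<bar>)) ^ k"
    using assms \<tau> by (intro power_mono bound) auto
  also have "\<dots> = M ^ k * exp (- b * \<bar>Re v\<bar>) ^ k" by (rule power_mult_distrib)
  also have "\<dots> \<le> M ^ k * exp (- b * \<bar>Re v\<bar>) ^ 1"
    using assms(1) b M_nonneg by (intro mult_left_mono power_decreasing) auto
  finally show ?thesis by (simp add: norm_power)
qed

lemma f_power_continuous: "continuous_on S (\<lambda>v. f 0 v ^ k)"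
  by (intro continuous_intros holomorphic_on_imp_continuous_on f_holo)

lemma f_power_integrable:
  assumes "k \<ge> 1" "- \<tau> \<le> \<eta>" "\<eta> \<le> 0"
  shows "integrable lborel (\<lambda>x. f 0 (Complex x \<eta>) ^ k)"
  by (rule line_integrable[OF f_power_continuous b(1), where B = "M ^ k"])
     (use f_power_bound[of k "Complex _ \<eta>"] assms in simp)

text \<open>The arguments of the Bell polynomial, with the cut at height \<open>\<eta>\<close>.
  Height 0 gives those of the theorem; a negative height represents the same functions further down,
  beyond the edge at -2\<pi>.\<close>

definition Y :: "real \<Rightarrow> nat \<Rightarrow> complex \<Rightarrow> complex" where
  "Y \<eta> k \<zeta> = (2 * of_real pi * \<i>) ^ (k - 1) / of_nat k * ctrans \<eta> (\<lambda>v. f 0 v ^ k) \<zeta>"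

definition H :: "nat \<Rightarrow> complex \<Rightarrow> complex" where
  "H m \<zeta> = bell_Y m (\<lambda>k. Y 0 k \<zeta>)"

lemma Y_holomorphic:
  assumes "k \<ge> 1" "- \<tau> \<le> \<eta>" "\<eta> \<le> 0"
  shows "Y \<eta> k holomorphic_on strip (\<eta> - 2 * pi) \<eta>"
proof -
  have "(\<lambda>\<zeta>. ctrans \<eta> (\<lambda>v. f 0 v ^ k) \<zeta>) holomorphic_on strip (\<eta> - 2 * pi) \<eta>"
    using f_power_integrable[OF assms] by (rule ctrans_holomorphic)
  then show ?thesis unfolding Y_def[abs_def] by (intro holomorphic_intros)
qed

lemma Y_shift:
  assumes "k \<ge> 1" "0 < \<delta>" "\<delta> \<le> \<tau>" "\<zeta> \<in> strip (- (2 * pi)) (- \<delta>)"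
  shows "Y (- \<delta>) k \<zeta> = Y 0 k \<zeta>"
proof -
  have p: "norm (f 0 z ^ k) \<le> M ^ k * exp (- b * \<bar>Re z\<bar>)" if "- \<delta> \<le> Im z" "Im z \<le> 0" for z
    using that assms by (intro f_power_bound) auto
  have "ctrans (- \<delta>) (\<lambda>v. f 0 v ^ k) \<zeta> = ctrans 0 (\<lambda>v. f 0 v ^ k) \<zeta>"
  proof (rule ctrans_shift[OF _ _ _ _ _ b])
    show "(\<lambda>v. f 0 v ^ k) holomorphic_on strip (- \<delta> - 1) 1" by (intro holomorphic_intros f_holo)
    show "norm (f 0 z ^ k) \<le> M ^ k * exp (- b * Re z)" if "- \<delta> \<le> Im z" "Im z \<le> 0" "0 \<le> Re z" for z
      using p[of z] that by simp
    show "norm (f 0 z ^ k) \<le> M ^ k" if "- \<delta> \<le> Im z" "Im z \<le> 0" "Re z \<le> - 0" for z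
    proof -
      have "M ^ k * exp (- b * \<bar>Re z\<bar>) \<le> M ^ k * 1"
        using M_nonneg b by (intro mult_left_mono) auto
      then show ?thesis using p[of z] that by simp
    qed
  qed (use assms in \<open>auto simp: strip_def\<close>)
  then show ?thesis by (simp add: Y_def)
qed

text \<open>Lowering the cut past \<open>\<zeta>\<close> picks up a residue, and periodicity moves
  the point down by 2\<pi>. The prefactor of \<open>Y\<close> makes the jump exactly
  \<open>t ^ k / k\<close> with \<open>t\<close> = 2\<pi>\<i> \<open>f 0 \<zeta>\<close>, the shape
  to which \<open>bell_Y_shift\<close> applies.\<close>

lemma Y_jump:
  assumes "k \<ge> 1" "0 < \<delta>" "\<delta> \<le> \<tau>" "\<zeta> \<in> strip (- \<delta>) 0"
  shows "Y (- \<delta>) k (\<zeta> - 2 * pi * \<i>) = Y 0 k \<zeta> - (2 * pi * \<i> * f 0 \<zeta>) ^ k / of_nat k"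
proof -
  have p: "norm (f 0 z ^ k) \<le> M ^ k * exp (- b * \<bar>Re z\<bar>)" if "- \<delta> \<le> Im z" "Im z \<le> 0" for z
    using that assms by (intro f_power_bound) auto
  have "ctrans (- \<delta>) (\<lambda>v. f 0 v ^ k) \<zeta> - ctrans 0 (\<lambda>v. f 0 v ^ k) \<zeta> = - (2 * pi * \<i> * f 0 \<zeta> ^ k)"
  proof (rule ctrans_shift_residue[OF _ _ _ _ _ _ b])
    show "(\<lambda>v. f 0 v ^ k) holomorphic_on strip (- \<delta> - 1) 1" by (intro holomorphic_intros f_holo)
    show "norm (f 0 z ^ k) \<le> M ^ k * exp (- b * Re z)" if "- \<delta> \<le> Im z" "Im z \<le> 0" "0 \<le> Re z" for z
      using p[of z] that by simp
    show "norm (f 0 z ^ k) \<le> M ^ k" if "- \<delta> \<le> Im z" "Im z \<le> 0" "Re z \<le> - 0" for z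
    proof -
      have "M ^ k * exp (- b * \<bar>Re z\<bar>) \<le> M ^ k * 1"
        using M_nonneg b by (intro mult_left_mono) auto
      then show ?thesis using p[of z] that by simp
    qed
    show "0 - - \<delta> \<le> 2 * pi" using assms \<tau> pi_gt_zero by linarith
  qed (use assms in \<open>auto simp: strip_def\<close>)
  then have c: "ctrans (- \<delta>) (\<lambda>v. f 0 v ^ k) \<zeta> = ctrans 0 (\<lambda>v. f 0 v ^ k) \<zeta> - 2 * pi * \<i> * f 0 \<zeta> ^ k"
    by (simp add: algebra_simps)
  have "(2 * pi * \<i> * f 0 \<zeta>) ^ k = (2 * of_real pi * \<i>) ^ (k - 1) * (2 * pi * \<i> * f 0 \<zeta> ^ k)"
    using assms(1) by (cases k) (auto simp: power_mult_distrib)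
  then show ?thesis
    unfolding Y_def ctrans_periodic c by (simp add: right_diff_distrib)
qed

lemma Y_decay:
  assumes "k \<ge> 1" "- \<tau> \<le> \<eta>" "\<eta> \<le> 0" and \<delta>: "0 < \<delta>" "\<delta> \<le> pi / 2"
  shows "\<exists>D\<ge>0. \<forall>\<zeta>. \<eta> - 2 * pi + \<delta> \<le> Im \<zeta> \<longrightarrow> Im \<zeta> \<le> \<eta> - \<delta> \<longrightarrow>
    norm (Y \<eta> k \<zeta>) \<le> D * min 1 (exp (- (b / 2) * Re \<zeta>))"
proof -
  define c where "c = norm ((2 * of_real pi * \<i>) ^ (k - 1) / of_nat k :: complex)"
  define D where "D = M ^ k / sin \<delta> * (LINT x|lborel. exp (- (b / 2) * \<bar>x\<bar>))"
  have "0 < sin \<delta>" using \<delta> by (intro sin_gt_zero) auto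
  then have "0 \<le> c * D" unfolding c_def D_def using M_nonneg
    by (intro mult_nonneg_nonneg divide_nonneg_pos zero_le_power Bochner_Integration.integral_nonneg) auto
  moreover have "norm (Y \<eta> k \<zeta>) \<le> c * D * min 1 (exp (- (b / 2) * Re \<zeta>))"
    if "\<eta> - 2 * pi + \<delta> \<le> Im \<zeta>" "Im \<zeta> \<le> \<eta> - \<delta>" for \<zeta>
  proof -
    have "norm (ctrans \<eta> (\<lambda>v. f 0 v ^ k) \<zeta>) \<le> D * min 1 (exp (- (b / 2) * Re \<zeta>))"
      unfolding D_def
      by (rule ctrans_decay[OF f_power_continuous b _ \<delta> that])
         (use f_power_bound[of k "Complex _ \<eta>"] assms in simp)
    then have "c * norm (ctrans \<eta> (\<lambda>v. f 0 v ^ k) \<zeta>) \<le> c * (D * min 1 (exp (- (b / 2) * Re \<zeta>)))"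
      by (intro mult_left_mono) (auto simp: c_def)
    then show ?thesis unfolding Y_def norm_mult c_def by (simp add: mult.assoc)
  qed
  ultimately show ?thesis by blast
qed

lemma bell_Y_decay:
  assumes "m \<ge> 1" "- \<tau> \<le> \<eta>" "\<eta> \<le> 0" and \<delta>: "0 < \<delta>" "\<delta> \<le> pi / 2"
  shows "\<exists>D\<ge>0. \<forall>\<zeta>. \<eta> - 2 * pi + \<delta> \<le> Im \<zeta> \<longrightarrow> Im \<zeta> \<le> \<eta> - \<delta> \<longrightarrow>
    norm (bell_Y m (\<lambda>k. Y \<eta> k \<zeta>)) \<le> D * min 1 (exp (- (b / 2) * Re \<zeta>))"
proof -
  have "\<forall>k. \<exists>D\<ge>0. k \<ge> 1 \<longrightarrow> (\<forall>\<zeta>. \<eta> - 2 * pi + \<delta> \<le> Im \<zeta> \<longrightarrow> Im \<zeta> \<le> \<eta> - \<delta> \<longrightarrow>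
      norm (Y \<eta> k \<zeta>) \<le> D * min 1 (exp (- (b / 2) * Re \<zeta>)))"
    using Y_decay[OF _ assms(2-)] by blast
  then obtain D where D: "\<And>k. 0 \<le> D k" "\<And>k \<zeta>. k \<ge> 1 \<Longrightarrow> \<eta> - 2 * pi + \<delta> \<le> Im \<zeta> \<Longrightarrow> Im \<zeta> \<le> \<eta> - \<delta> \<Longrightarrow>
      norm (Y \<eta> k \<zeta>) \<le> D k * min 1 (exp (- (b / 2) * Re \<zeta>))" by metis
  define D' where "D' = (\<Sum>k=1..m. D k)"
  have D': "0 \<le> D'" "\<And>k. 1 \<le> k \<Longrightarrow> k \<le> m \<Longrightarrow> D k \<le> D'"
    unfolding D'_def by (auto intro!: sum_nonneg member_le_sum D)
  have "norm (bell_Y m (\<lambda>k. Y \<eta> k \<zeta>)) \<le> (\<Sum>k\<in>bell_tuples m. \<Prod>j=1..m. D' ^ k j) * min 1 (exp (- (b / 2) * Re \<zeta>))"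
    if "\<eta> - 2 * pi + \<delta> \<le> Im \<zeta>" "Im \<zeta> \<le> \<eta> - \<delta>" for \<zeta>
  proof (rule bell_Y_bound)
    fix k assume k: "1 \<le> k" "k \<le> m"
    have "D k * min 1 (exp (- (b / 2) * Re \<zeta>)) \<le> D' * min 1 (exp (- (b / 2) * Re \<zeta>))"
      using D'(2)[OF k] by (intro mult_right_mono) auto
    with D(2)[OF k(1) that] show "norm (Y \<eta> k \<zeta>) \<le> D' * min 1 (exp (- (b / 2) * Re \<zeta>))" by linarith
  qed (use D' assms(1) in auto)
  moreover have "0 \<le> (\<Sum>k\<in>bell_tuples m. \<Prod>j=1..m. D' ^ k j)"
    using D' by (intro sum_nonneg prod_nonneg) auto
  ultimately show ?thesis by blast
qed

lemma H_holomorphic: "H m holomorphic_on strip (- (2 * pi)) 0"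
proof -
  have "(\<lambda>\<zeta>. bell_Y m (\<lambda>k. Y 0 k \<zeta>)) holomorphic_on strip (- (2 * pi)) 0"
    by (intro bell_Y_holomorphic) (use Y_holomorphic[of _ 0] \<tau> in auto)
  then show ?thesis by (simp add: H_def[abs_def])
qed

lemma H_bounded:
  assumes "0 < \<delta>" "\<delta> \<le> pi / 2"
  shows "\<exists>C. \<forall>\<zeta>. - (2 * pi) + \<delta> \<le> Im \<zeta> \<longrightarrow> Im \<zeta> \<le> - \<delta> \<longrightarrow> norm (H m \<zeta>) \<le> C"
proof (cases "m = 0")
  case True
  then show ?thesis by (auto simp: H_def bell_Y_0 intro!: exI[of _ 1])
next
  case False
  then obtain D where "D \<ge> 0" and D: "\<And>\<zeta>. - (2 * pi) + \<delta> \<le> Im \<zeta> \<Longrightarrow> Im \<zeta> \<le> - \<delta> \<Longrightarrow>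
      norm (H m \<zeta>) \<le> D * min 1 (exp (- (b / 2) * Re \<zeta>))"
    using bell_Y_decay[of m 0 \<delta>] assms \<tau> by (auto simp: H_def)
  have "D * min 1 (exp (- (b / 2) * Re \<zeta>)) \<le> D * 1" for \<zeta>
    using \<open>D \<ge> 0\<close> by (intro mult_left_mono) auto
  then show ?thesis using D by (metis mult.right_neutral order_trans)
qed

text \<open>
  Across its cut the function \<open>H (Suc m)\<close> jumps by \<open>2\<pi>i f H\<^sub>m\<close>. Cauchy's formula over a strip of
  width \<open>2\<pi>\<close>, whose lower edge lies beyond the cut, turns this into an integral equation.
\<close>

lemma H_recursion:
  assumes \<delta>: "0 < \<delta>" "\<delta> < \<tau>" and \<zeta>: "\<zeta> \<in> strip (- (2 * pi)) (- \<delta>)"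
  shows "H (Suc m) \<zeta> = ctrans (- \<delta>) (\<lambda>v. f 0 v * H m v) \<zeta>"
proof -
  \<comment> \<open>The initial strip and its downward translate by \<open>\<tau>\<close>; together
    they have width 2\<pi> + \<open>\<tau>\<close>, which leaves room for a closed strip of width
    2\<pi>.\<close>
  define A B where "A = strip (- (2 * pi)) 0" and "B = strip (- \<tau> - 2 * pi) (- \<tau>)"
  \<comment> \<open>Both representations agree on the overlap by a contour shift, so this is a
    single holomorphic function on the union.\<close>
  define Yc where "Yc = (\<lambda>k \<zeta>. if \<zeta> \<in> A then Y 0 k \<zeta> else Y (- \<tau>) k \<zeta>)"
  define g where "g = (\<lambda>\<zeta>. bell_Y (Suc m) (\<lambda>k. Yc k \<zeta>))"
  have pi: "\<tau> < pi" "0 < pi" using \<tau> pi_gt_zero by linarith+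
  have YcB: "Yc k \<zeta> = Y (- \<tau>) k \<zeta>" if "k \<ge> 1" "\<zeta> \<in> B" for k \<zeta>
    using Y_shift[of k \<tau> \<zeta>] that \<tau> by (auto simp: Yc_def A_def B_def strip_def)
  have gA: "g v = H (Suc m) v" if "v \<in> A" for v
    using that by (simp add: g_def H_def Yc_def)
  have gB: "g v = bell_Y (Suc m) (\<lambda>k. Y (- \<tau>) k v)" if "v \<in> B" for v
    unfolding g_def by (rule bell_Y_cong) (use that YcB in auto)
  have "Yc k holomorphic_on (A \<union> B)" if "k \<ge> 1" for k
    unfolding Yc_def
  proof (rule holomorphic_on_If_Un)
    show "Y 0 k holomorphic_on A" unfolding A_def using Y_holomorphic[of k 0] that \<tau> by simp
    show "Y (- \<tau>) k holomorphic_on B" unfolding B_def using Y_holomorphic[of k "- \<tau>"] that \<tau> by simp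
    show "Y 0 k z = Y (- \<tau>) k z" if "z \<in> A" "z \<in> B" for z
      using YcB[OF \<open>k \<ge> 1\<close> that(2)] that(1) by (simp add: Yc_def)
  qed (simp_all add: A_def B_def)
  then have "g holomorphic_on (A \<union> B)"
    unfolding g_def by (intro bell_Y_holomorphic) auto
  moreover have "A \<union> B = strip (- \<tau> - 2 * pi) 0"
    using \<tau> pi by (auto simp: A_def B_def strip_def)
  ultimately have g: "g holomorphic_on strip (- \<tau> - 2 * pi) 0" by simp
  \<comment> \<open>The jump of all the arguments at once multiplies the generating function by a
    linear factor; its coefficient of order \<open>Suc m\<close> involves
    \<open>H m\<close>.\<close>
  have jump: "g (v - 2 * pi * \<i>) = g v - 2 * pi * \<i> * (f 0 v * H m v)" if v: "v \<in> strip (- \<tau>) 0" for v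
  proof -
    have "v \<in> A" "v - 2 * pi * \<i> \<in> B" using v pi by (auto simp: A_def B_def strip_def)
    have "g (v - 2 * pi * \<i>) = bell_Y (Suc m) (\<lambda>k. Y 0 k v - (2 * pi * \<i> * f 0 v) ^ k / of_nat k)"
      unfolding gB[OF \<open>v - 2 * pi * \<i> \<in> B\<close>] using Y_jump[OF _ \<tau>(1) order_refl v] by (intro bell_Y_cong) auto
    also have "\<dots> = g v - 2 * pi * \<i> * f 0 v * H m v"
      unfolding bell_Y_shift gA[OF \<open>v \<in> A\<close>] H_def ..
    finally show ?thesis by simp
  qed
  \<comment> \<open>The height \<open>- \<delta>\<close> is at distance \<open>\<delta>\<close> from
    the upper edge of the union, and the height \<open>- \<delta> - 2 * pi\<close> at distance
    \<open>\<tau> - \<delta>\<close> from the lower one.\<close>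
  have "0 < min \<delta> (\<tau> - \<delta>)" "min \<delta> (\<tau> - \<delta>) \<le> pi / 2"
    using \<delta> \<tau> min.cobounded1[of \<delta> "\<tau> - \<delta>"] by (auto simp del: min.cobounded1)
  from bell_Y_decay[of "Suc m" 0, OF _ _ _ this] bell_Y_decay[of "Suc m" "- \<tau>", OF _ _ _ this] \<tau>
  obtain D1 D2 where D: "D1 \<ge> 0" "D2 \<ge> 0"
    "\<And>\<zeta>. - (2 * pi) + min \<delta> (\<tau> - \<delta>) \<le> Im \<zeta> \<Longrightarrow> Im \<zeta> \<le> - min \<delta> (\<tau> - \<delta>) \<Longrightarrow>
      norm (bell_Y (Suc m) (\<lambda>k. Y 0 k \<zeta>)) \<le> D1 * min 1 (exp (- (b / 2) * Re \<zeta>))"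
    "\<And>\<zeta>. - \<tau> - 2 * pi + min \<delta> (\<tau> - \<delta>) \<le> Im \<zeta> \<Longrightarrow> Im \<zeta> \<le> - \<tau> - min \<delta> (\<tau> - \<delta>) \<Longrightarrow>
      norm (bell_Y (Suc m) (\<lambda>k. Y (- \<tau>) k \<zeta>)) \<le> D2 * min 1 (exp (- (b / 2) * Re \<zeta>))"
    by auto
  have gbound: "norm (g v) \<le> (D1 + D2) * min 1 (exp (- (b / 2) * Re v))"
    if v: "- \<delta> - 2 * pi \<le> Im v" "Im v \<le> - \<delta>" for v
  proof (cases "Im v \<ge> - pi")
    case True
    then have "v \<in> A" using v \<delta> pi by (auto simp: A_def strip_def)
    then have "norm (g v) \<le> D1 * min 1 (exp (- (b / 2) * Re v))"
      unfolding gA[OF \<open>v \<in> A\<close>] H_def using True v \<delta> \<tau> pi by (intro D) auto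
    also have "\<dots> \<le> (D1 + D2) * min 1 (exp (- (b / 2) * Re v))"
      using D by (intro mult_right_mono) auto
    finally show ?thesis .
  next
    case False
    then have "v \<in> B" using v \<delta> pi by (auto simp: B_def strip_def)
    then have "norm (g v) \<le> D2 * min 1 (exp (- (b / 2) * Re v))"
      unfolding gB[OF \<open>v \<in> B\<close>] using False v \<delta> \<tau> pi by (intro D) auto
    also have "\<dots> \<le> (D1 + D2) * min 1 (exp (- (b / 2) * Re v))"
      using D by (intro mult_right_mono) auto
    finally show ?thesis .
  qed
  have gR: "norm (g v) \<le> (D1 + D2) * exp (- (b / 2) * Re v)" and gL: "norm (g v) \<le> D1 + D2"
    if v: "- \<delta> - 2 * pi \<le> Im v" "Im v \<le> - \<delta>" for v
  proof -
    have "(D1 + D2) * min 1 (exp (- (b / 2) * Re v)) \<le> (D1 + D2) * exp (- (b / 2) * Re v)"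
      "(D1 + D2) * min 1 (exp (- (b / 2) * Re v)) \<le> (D1 + D2) * 1"
      using D by (intro mult_left_mono; simp)+
    from order_trans[OF gbound[OF v] this(1)] order_trans[OF gbound[OF v] this(2)]
    show "norm (g v) \<le> (D1 + D2) * exp (- (b / 2) * Re v)" "norm (g v) \<le> D1 + D2" by simp_all
  qed
  have b': "0 < b / 2" "b / 2 \<le> 1" using b by auto
  obtain \<delta>' where \<delta>': "0 < \<delta>'" "\<delta>' \<le> pi / 2" "- \<delta> - 2 * pi + 2 * \<delta>' \<le> Im \<zeta>" "Im \<zeta> \<le> - \<delta> - 2 * \<delta>'"
    using gap_strip[of \<zeta> "- \<delta>"] \<zeta> \<delta> by (auto simp: strip_def)
  obtain C where C: "\<And>v. - (2 * pi) + \<delta> \<le> Im v \<Longrightarrow> Im v \<le> - \<delta> \<Longrightarrow> norm (H m v) \<le> C"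
    using H_bounded[of \<delta> m] \<delta> \<tau> by auto
  have fH: "integrable lborel (\<lambda>x. f 0 (Complex x (- \<delta>)) * H m (Complex x (- \<delta>)))"
    by (rule prod_integrable(1)[where C = C])
       (use \<delta> \<tau> pi in \<open>auto intro!: C continuous_on_line[OF H_holomorphic]\<close>)
  have fHk: "integrable lborel (\<lambda>x. f 0 (Complex x (- \<delta>)) * H m (Complex x (- \<delta>)) * kern (\<zeta> - Complex x (- \<delta>)))"
    by (rule ctrans_integrable[where g = "\<lambda>v. f 0 v * H m v", OF fH \<delta>'(1,2)]) (use \<delta>' in auto)
  have gk: "integrable lborel (\<lambda>x. g (Complex x (- \<delta>)) * kern (\<zeta> - Complex x (- \<delta>)))"
  proof (rule holomorphic_decay_integrable[OF _ _ b'(1)])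
    show "(\<lambda>v. g v * kern (\<zeta> - v)) holomorphic_on strip (Im \<zeta>) 0"
      unfolding kern_def
    proof (intro holomorphic_intros)
      show "g holomorphic_on strip (Im \<zeta>) 0"
        using g by (rule holomorphic_on_subset) (use \<zeta> \<tau> in \<open>auto simp: strip_def\<close>)
      show "exp (\<zeta> - v) - 1 \<noteq> 0" if "v \<in> strip (Im \<zeta>) 0" for v
        using that \<zeta> by (intro exp_diff_minus_1_neq_0) (auto simp: strip_def)
    qed
    show "{z. Im z = - \<delta>} \<subseteq> strip (Im \<zeta>) 0" using \<zeta> \<delta> by (auto simp: strip_def)
    fix z assume z: "Im z = - \<delta>" "\<bar>0\<bar> + \<bar>Re \<zeta>\<bar> + 1 \<le> \<bar>Re z\<bar>"
    show "norm (g z * kern (\<zeta> - z)) \<le> 2 * \<bar>D1 + D2\<bar> * exp \<bar>Re \<zeta>\<bar> * exp (- (b / 2) * \<bar>Re z\<bar>)"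
      by (rule kern_product_decay[OF b', of "{z. Im z = - \<delta>}" 0]) (use z gR gL pi in auto)
  qed
  \<comment> \<open>The kernel takes the same values on both edges, so the two integrals differ only
    by the jump of \<open>g\<close>.\<close>
  have "line_integral (- \<delta> - 2 * pi) (\<lambda>v. g v * kern (\<zeta> - v))
      = (LINT x|lborel. g (Complex x (- \<delta>)) * kern (\<zeta> - Complex x (- \<delta>))
           - 2 * pi * \<i> * (f 0 (Complex x (- \<delta>)) * H m (Complex x (- \<delta>)) * kern (\<zeta> - Complex x (- \<delta>))))"
    unfolding line_integral_def
  proof (rule Bochner_Integration.integral_cong[OF refl])
    fix x
    have e: "Complex x (- \<delta> - 2 * pi) = Complex x (- \<delta>) - 2 * pi * \<i>" by (simp add: complex_eq_iff)
    have "kern (\<zeta> - (Complex x (- \<delta>) - 2 * pi * \<i>)) = kern (\<zeta> - Complex x (- \<delta>))"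
      using kern_periodic(1)[of "\<zeta> - Complex x (- \<delta>)"] by (simp add: algebra_simps)
    note k = this
    have v: "Complex x (- \<delta>) \<in> strip (- \<tau>) 0" using \<delta> by (auto simp: strip_def)
    show "g (Complex x (- \<delta> - 2 * pi)) * kern (\<zeta> - Complex x (- \<delta> - 2 * pi)) =
      g (Complex x (- \<delta>)) * kern (\<zeta> - Complex x (- \<delta>))
           - 2 * pi * \<i> * (f 0 (Complex x (- \<delta>)) * H m (Complex x (- \<delta>)) * kern (\<zeta> - Complex x (- \<delta>)))"
      unfolding e k jump[OF v] by (simp only: left_diff_distrib mult.assoc)
  qed
  also have "\<dots> = ctrans (- \<delta>) g \<zeta> - 2 * pi * \<i> * ctrans (- \<delta>) (\<lambda>v. f 0 v * H m v) \<zeta>"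
    unfolding ctrans_def line_integral_def
    using gk fHk by (subst Bochner_Integration.integral_diff) auto
  finally have "ctrans (- \<delta> - 2 * pi) g \<zeta> = \<dots>" by (simp add: ctrans_def)
  \<comment> \<open>The same difference of edge integrals, now evaluated through the only pole
    between them.\<close>
  moreover have "ctrans (- \<delta> - 2 * pi) g \<zeta> - ctrans (- \<delta>) g \<zeta> = - (2 * pi * \<i> * g \<zeta>)"
    by (rule ctrans_shift_residue[OF _ _ _ _ _ g b', where R = 0 and B = "D1 + D2"])
       (use \<delta> \<zeta> pi gR gL in \<open>auto simp: strip_def\<close>)
  moreover have "p * y = p * x" if "L = c - p * x" "L - c = - (p * y)" for L c p x y :: complex
    using that by auto
  ultimately have "2 * pi * \<i> * g \<zeta> = 2 * pi * \<i> * ctrans (- \<delta>) (\<lambda>v. f 0 v * H m v) \<zeta>"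
    by blast
  then have "g \<zeta> = ctrans (- \<delta>) (\<lambda>v. f 0 v * H m v) \<zeta>" by simp
  moreover have "\<zeta> \<in> A" using \<zeta> \<delta> by (auto simp: A_def strip_def)
  ultimately show ?thesis by (simp add: gA)
qed

text \<open>Induction on the number of integrals: \<open>G\<close> and \<open>H\<close> obey the
  same recursion on one line that does not depend on \<open>\<epsilon>\<close>, and the uniform
  bound for \<open>G\<close> provides the integrable majorant.\<close>

lemma G_tendsto:
  assumes "\<zeta> \<in> strip (- (2 * pi)) 0"
  shows "((\<lambda>\<epsilon>. G \<epsilon> m \<zeta>) \<longlongrightarrow> H m \<zeta>) (at_right 0)"
  using assms
proof (induction m arbitrary: \<zeta>)
  case 0
  then show ?case by (simp add: H_def bell_Y_0)
next
  case (Suc m)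
  \<comment> \<open>The halves make both inequalities strict: \<open>\<delta> < \<tau>\<close>, as
    \<open>H_recursion\<close> demands, and \<open>\<zeta>\<close> below the line.\<close>
  define \<delta> where "\<delta> = min (\<tau> / 2) (- Im \<zeta> / 2)"
  have \<delta>: "0 < \<delta>" "\<delta> < \<tau>" "Im \<zeta> < - \<delta>" and \<delta>2: "\<delta> \<le> pi / 2"
    using Suc.prems \<tau> by (auto simp: \<delta>_def strip_def min_def)
  have \<zeta>: "\<zeta> \<in> strip (- (2 * pi)) (- \<delta>)"
    using Suc.prems \<delta> by (auto simp: strip_def)
  obtain C e where "e > 0" and
    C: "\<And>\<epsilon> v. 0 < \<epsilon> \<Longrightarrow> \<epsilon> < e \<Longrightarrow> - pi \<le> Im v \<Longrightarrow> Im v \<le> - \<delta> \<Longrightarrow> norm (G \<epsilon> m v) \<le> C"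
  proof -
    from G_uniform[of \<delta> m] \<delta> obtain C e where "e > 0"
      "\<forall>\<epsilon>\<in>{0<..<e}. \<forall>\<zeta>. - pi \<le> Im \<zeta> \<longrightarrow> Im \<zeta> \<le> - \<delta> \<longrightarrow> norm (G \<epsilon> m \<zeta>) \<le> C" by (auto simp: less_imp_le)
    then show ?thesis by (intro that[of e C]) auto
  qed
  define e' where "e' = min e (\<delta> / real (Suc m))"
  have "e' > 0" using \<open>e > 0\<close> \<delta> by (simp add: e'_def)
  have small: "0 \<le> real m * \<epsilon>" "real m * \<epsilon> < \<delta>" if "0 < \<epsilon>" "\<epsilon> < e'" for \<epsilon>
  proof -
    have "real m * \<epsilon> < real (Suc m) * (\<delta> / real (Suc m))"
      using that by (intro mult_strict_mono) (auto simp: e'_def)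
    also have "\<dots> = \<delta>" by (simp del: of_nat_Suc)
    finally show "real m * \<epsilon> < \<delta>" .
  qed (use that in auto)
  obtain \<delta>' where \<delta>': "0 < \<delta>'" "\<delta>' \<le> pi / 2" "- \<delta> - 2 * pi + 2 * \<delta>' \<le> Im \<zeta>" "Im \<zeta> \<le> - \<delta> - 2 * \<delta>'"
    using gap_strip[of \<zeta> "- \<delta>"] \<zeta> \<delta> by (auto simp: strip_def)
  have s: "sin \<delta>' > 0" using \<delta>' by (intro sin_gt_zero) auto
  have im: "- \<tau> \<le> - \<delta>" "- \<delta> \<le> 0" "- pi \<le> - \<delta>" using \<delta> \<tau> pi_gt_zero by linarith+
  \<comment> \<open>For \<open>m = 0\<close> the parameter is constantly 0 and does not approach 0
    from the right, so this case is separate.\<close>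
  have pw: "((\<lambda>\<epsilon>. f (real m * \<epsilon>) v) \<longlongrightarrow> f 0 v) (at_right 0)" if "Im v = - \<delta>" for v
  proof (cases "m = 0")
    case False
    have "filterlim (\<lambda>\<epsilon>. real m * \<epsilon>) (at_right 0) (at_right 0)"
    proof -
      have "((\<lambda>\<epsilon>. real m * \<epsilon>) \<longlongrightarrow> 0) (at_right 0)" by (rule tendsto_mult_right_zero) (rule tendsto_ident_at)
      moreover have "\<forall>\<^sub>F \<epsilon> in at_right 0. real m * \<epsilon> \<in> {0<..} \<and> real m * \<epsilon> \<noteq> 0"
        using eventually_at_right_less[of "0::real"] by eventually_elim (use False in auto)
      ultimately show ?thesis unfolding filterlim_at by blast
    qed
    moreover have "((\<lambda>\<epsilon>. f \<epsilon> v) \<longlongrightarrow> f 0 v) (at_right 0)" using lim[of v] that im by auto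
    ultimately show ?thesis by (rule filterlim_compose[rotated])
  qed simp
  \<comment> \<open>Restricting the filter to \<open>\<epsilon> < e'\<close> makes the uniform bound
    hold for every member of a sequence, not just eventually.\<close>
  have "((\<lambda>\<epsilon>. ctrans (- \<delta>) (\<lambda>v. f (real m * \<epsilon>) v * G \<epsilon> m v) \<zeta>) \<longlongrightarrow> ctrans (- \<delta>) (\<lambda>v. f 0 v * H m v) \<zeta>)
      (at 0 within {0<..<e'})"
    unfolding tendsto_at_iff_sequentially
  proof (intro allI impI)
    fix X :: "nat \<Rightarrow> real"
    assume "\<forall>i. X i \<in> {0<..<e'} - {0}" and lim: "X \<longlonglongrightarrow> 0"
    then have X: "0 < X i" "X i < e'" for i by auto
    have right: "filterlim X (at_right 0) sequentially"
      unfolding filterlim_at using X(1) lim by (auto simp: less_imp_neq[OF X(1), symmetric])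
    have hG: "G (X i) m holomorphic_on strip (- (2 * pi)) ((1 - real m) * X i)" for i
      using small[OF X, of i] \<delta> X by (intro G_regular(1)) auto
    have cont: "continuous_on {z. Im z = - \<delta>} (\<lambda>v. f (real m * X i) v * G (X i) m v)" for i
      using small[OF X, of i] X[of i] \<delta> \<tau> pi_gt_zero
      by (intro continuous_intros holomorphic_on_imp_continuous_on f_holo continuous_on_line[OF hG])
         (auto simp: algebra_simps simp del: pi_gt_zero)
    have contH: "continuous_on {z. Im z = - \<delta>} (\<lambda>v. f 0 v * H m v)"
      using \<delta> \<tau> pi_gt_zero
      by (intro continuous_intros holomorphic_on_imp_continuous_on f_holo continuous_on_line[OF H_holomorphic])
         (auto simp del: pi_gt_zero)
    note [measurable] = borel_measurable_along_line[OF cont] borel_measurable_along_line[OF contH]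
    have "(\<lambda>i. LINT x|lborel. f (real m * X i) (Complex x (- \<delta>)) * G (X i) m (Complex x (- \<delta>)) * kern (\<zeta> - Complex x (- \<delta>)))
       \<longlonglongrightarrow> (LINT x|lborel. f 0 (Complex x (- \<delta>)) * H m (Complex x (- \<delta>)) * kern (\<zeta> - Complex x (- \<delta>)))"
    proof (rule integral_dominated_convergence)
      show "integrable lborel (\<lambda>x. (M * C * (1 / sin \<delta>')) * exp (- b * \<bar>x\<bar>))"
        by (intro integrable_mult_right integrable_exp_neg_abs b)
      show "AE x in lborel. norm (f (real m * X i) (Complex x (- \<delta>)) * G (X i) m (Complex x (- \<delta>)) * kern (\<zeta> - Complex x (- \<delta>)))
          \<le> (M * C * (1 / sin \<delta>')) * exp (- b * \<bar>x\<bar>)" for i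
      proof (rule AE_I2)
        fix x
        let ?v = "Complex x (- \<delta>)"
        have "norm (f (real m * X i) ?v * G (X i) m ?v) \<le> M * C * exp (- b * \<bar>Re ?v\<bar>)"
          using small[OF X, of i] X[of i] \<delta> \<tau> im by (intro prod_bound C) (auto simp: e'_def)
        moreover have "norm (kern (\<zeta> - ?v)) \<le> 1 / sin \<delta>'"
          using \<delta>' by (intro kern_bound(1)) auto
        ultimately have "norm (f (real m * X i) ?v * G (X i) m ?v) * norm (kern (\<zeta> - ?v)) \<le> (M * C * exp (- b * \<bar>Re ?v\<bar>)) * (1 / sin \<delta>')"
          by (rule mult_mono') auto
        then show "norm (f (real m * X i) ?v * G (X i) m ?v * kern (\<zeta> - ?v)) \<le> (M * C * (1 / sin \<delta>')) * exp (- b * \<bar>x\<bar>)"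
          unfolding norm_mult[of "_ * _" "kern _"] by (simp only: complex.sel mult_ac)
      qed
      show "AE x in lborel. (\<lambda>i. f (real m * X i) (Complex x (- \<delta>)) * G (X i) m (Complex x (- \<delta>)) * kern (\<zeta> - Complex x (- \<delta>)))
        \<longlonglongrightarrow> f 0 (Complex x (- \<delta>)) * H m (Complex x (- \<delta>)) * kern (\<zeta> - Complex x (- \<delta>))"
      proof (rule AE_I2)
        fix x
        let ?v = "Complex x (- \<delta>)"
        have "?v \<in> strip (- (2 * pi)) 0" using \<delta> \<tau> pi_gt_zero by (auto simp: strip_def simp del: pi_gt_zero)
        from filterlim_compose[OF Suc.IH[OF this] right] filterlim_compose[OF pw[of ?v] right]
        show "(\<lambda>i. f (real m * X i) ?v * G (X i) m ?v * kern (\<zeta> - ?v)) \<longlonglongrightarrow> f 0 ?v * H m ?v * kern (\<zeta> - ?v)"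
          by (intro tendsto_intros) auto
      qed
    qed measurable
    then show "((\<lambda>\<epsilon>. ctrans (- \<delta>) (\<lambda>v. f (real m * \<epsilon>) v * G \<epsilon> m v) \<zeta>) \<circ> X) \<longlonglongrightarrow> ctrans (- \<delta>) (\<lambda>v. f 0 v * H m v) \<zeta>"
      by (simp add: o_def ctrans_def line_integral_def)
  qed
  moreover have "at 0 within {0<..<e'} = at_right 0"
    by (rule at_within_nhd[of _ "{-1<..<e'}"]) (use \<open>e' > 0\<close> in auto)
  moreover have "\<forall>\<^sub>F \<epsilon> in at_right 0. ctrans (- \<delta>) (\<lambda>v. f (real m * \<epsilon>) v * G \<epsilon> m v) \<zeta> = G \<epsilon> (Suc m) \<zeta>"
    unfolding eventually_at_right_field
    by (rule exI[of _ e']) (use \<open>e' > 0\<close> small \<delta> \<zeta> in \<open>auto intro!: G_shift[symmetric] simp del: G.simps\<close>)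
  ultimately have "((\<lambda>\<epsilon>. G \<epsilon> (Suc m) \<zeta>) \<longlongrightarrow> ctrans (- \<delta>) (\<lambda>v. f 0 v * H m v) \<zeta>) (at_right 0)"
    by (simp only: Lim_transform_eventually)
  then show ?case using H_recursion[OF \<delta>(1,2) \<zeta>] by simp
qed

end


section \<open>The exponential weight\<close>

text \<open>With \<open>a\<close> the modulus of \<open>\<sigma>\<close>, this is exp(\<sigma>t)
  t^(N-1) in the logarithmic coordinate: the constant \<open>c\<close> collects the argument of the
  ray. The exponent is N - 1 because the factor exp(v) of dt belongs to the kernel.\<close>

definition weight :: "complex \<Rightarrow> real \<Rightarrow> complex \<Rightarrow> real \<Rightarrow> complex \<Rightarrow> complex" where
  "weight c a N \<epsilon> v = c * exp (- (a * cis \<epsilon> * exp v) + (N - 1) * v)"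

text \<open>Origin of the parameters in the theorem: a power multiplies both \<open>a\<close> and N
  - 1 by \<open>k\<close>, and k(N - 1) + 1 is kN - k + 1.\<close>

lemma weight_power:
  "weight c a N 0 v ^ k = weight (c ^ k) (real k * a) (of_nat k * N - of_nat k + 1) 0 v"
  by (simp add: weight_def power_mult_distrib exp_of_nat_mult[symmetric] algebra_simps)

text \<open>To the right \<open>exp x\<close> exceeds half the square of \<open>x\<close>, and
  completing the square produces the constant \<open>n\<^sup>2 / a\<close>; to the left the linear
  term alone decays. The rate is capped at 1, as the kernel estimates require.\<close>

lemma exp_neg_exp_decay:
  fixes a n x :: real
  assumes "a > 0" "n > 1"
  shows "exp (- (a / 2 * exp x) + (n - 1) * x) \<le> exp (n\<^sup>2 / a) * exp (- min 1 (n - 1) * \<bar>x\<bar>)"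
proof -
  define b where "b = min 1 (n - 1)"
  have "- (a / 2 * exp x) + (n - 1) * x \<le> n\<^sup>2 / a - b * \<bar>x\<bar>"
  proof (cases "x \<ge> 0")
    case True
    have "a / 2 * (x\<^sup>2 / 2) \<le> a / 2 * exp x"
      using exp_lower_Taylor_quadratic[OF True] True assms by (intro mult_left_mono) auto
    moreover have "(n - 1 + b) * x \<le> n * x"
      using True by (intro mult_right_mono) (auto simp: b_def)
    moreover have "0 \<le> a / 4 * (x - 2 * n / a)\<^sup>2" using assms by simp
    moreover have "a / 4 * (x - 2 * n / a)\<^sup>2 = a / 4 * x\<^sup>2 - n * x + n\<^sup>2 / a"
      using assms by (simp add: power2_eq_square field_simps)
    ultimately show ?thesis using True by (simp add: algebra_simps)
  next
    case False
    have "(n - 1) * x \<le> b * x"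
      using False by (intro mult_right_mono_neg) (auto simp: b_def)
    moreover have "0 \<le> a / 2 * exp x" "0 \<le> n\<^sup>2 / a" using assms by auto
    moreover have "\<bar>x\<bar> = - x" using False by simp
    ultimately show ?thesis by (simp add: algebra_simps)
  qed
  then show ?thesis by (simp add: b_def flip: exp_add)
qed

text \<open>The rotation \<open>\<epsilon>\<close> and the height \<open>Im v\<close> have opposite
  signs, so their sum stays within \<pi>/3 of 0, and its cosine is at least 1/2: half of the decay
  survives. The imaginary part of \<open>N\<close> costs only a constant factor.\<close>

lemma hyp_family_weight:
  assumes "a > 0" "Re N > 1"
  shows "\<exists>M. hyp_family (weight c a N) M (min 1 (Re N - 1)) (pi / 3)"
proof
  let ?M = "norm c * exp (\<bar>Im N\<bar> * (pi / 3)) * exp ((Re N)\<^sup>2 / a)"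
  show "hyp_family (weight c a N) ?M (min 1 (Re N - 1)) (pi / 3)"
  proof
    show "weight c a N \<epsilon> holomorphic_on UNIV" for \<epsilon>
      unfolding weight_def[abs_def] by (intro holomorphic_intros)
    show "((\<lambda>\<epsilon>. weight c a N \<epsilon> v) \<longlongrightarrow> weight c a N 0 v) (at_right 0)" for v
      unfolding weight_def cis_conv_exp by (intro tendsto_intros)
    fix \<epsilon> :: real and v :: complex
    assume \<epsilon>: "0 \<le> \<epsilon>" "\<epsilon> \<le> pi / 3" and v: "- (pi / 3) \<le> Im v" "Im v \<le> 0"
    have "\<bar>\<epsilon> + Im v\<bar> \<le> pi / 3" using \<epsilon> v by linarith
    then have "cos (pi / 3) \<le> cos \<bar>\<epsilon> + Im v\<bar>"
      by (intro cos_monotone_0_pi_le) auto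
    then have "1 / 2 \<le> cos (\<epsilon> + Im v)" by (simp add: cos_60)
    then have "a * exp (Re v) * (1 / 2) \<le> a * exp (Re v) * cos (\<epsilon> + Im v)"
      using assms by (intro mult_left_mono) auto
    moreover have "- (Im N * Im v) \<le> \<bar>Im N\<bar> * (pi / 3)"
    proof -
      have "\<bar>Im N * Im v\<bar> \<le> \<bar>Im N\<bar> * (pi / 3)"
        unfolding abs_mult using v by (intro mult_left_mono) auto
      then show ?thesis by linarith
    qed
    moreover have "a * cis \<epsilon> * exp v = of_real (a * exp (Re v)) * cis (\<epsilon> + Im v)"
      by (simp add: exp_eq_polar cis_mult mult_ac)
    then have "Re (a * cis \<epsilon> * exp v) = a * exp (Re v) * cos (\<epsilon> + Im v)"
      by (simp del: of_real_mult)
    ultimately have "Re (- (a * cis \<epsilon> * exp v) + (N - 1) * v)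
        \<le> \<bar>Im N\<bar> * (pi / 3) + (- (a / 2 * exp (Re v)) + (Re N - 1) * Re v)"
      by (simp add: algebra_simps)
    then have "norm (weight c a N \<epsilon> v) \<le> norm c * exp (\<bar>Im N\<bar> * (pi / 3) + (- (a / 2 * exp (Re v)) + (Re N - 1) * Re v))"
      unfolding weight_def norm_mult norm_exp_eq_Re by (intro mult_left_mono) auto
    also have "\<dots> = norm c * exp (\<bar>Im N\<bar> * (pi / 3)) * exp (- (a / 2 * exp (Re v)) + (Re N - 1) * Re v)"
      by (simp only: exp_add mult_ac)
    also have "\<dots> \<le> norm c * exp (\<bar>Im N\<bar> * (pi / 3)) * (exp ((Re N)\<^sup>2 / a) * exp (- min 1 (Re N - 1) * \<bar>Re v\<bar>))"
      using assms by (intro mult_left_mono exp_neg_exp_decay) auto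
    finally show "norm (weight c a N \<epsilon> v) \<le> ?M * exp (- min 1 (Re N - 1) * \<bar>Re v\<bar>)"
      by (simp only: mult.assoc)
  qed (use assms in auto)
qed

text \<open>Integration by parts moves the derivative of the kernel onto the weight.\<close>

lemma ctrans_weight_ode:
  assumes "a > 0" "Re N > 1" and \<zeta>: "\<zeta> \<in> strip (- (2 * pi)) 0"
  shows "(ctrans 0 (weight c a N 0) has_field_derivative
    (N - 1 - a * exp \<zeta>) * ctrans 0 (weight c a N 0) \<zeta> + a * line_integral 0 (weight c a (N + 1) 0)) (at \<zeta>)"
proof -
  define F where "F = weight c a N 0"
  \<comment> \<open>Differentiating \<open>F\<close> produces the factor exp(v), which raises
    \<open>N\<close> by one.\<close>
  define F1 where "F1 = weight c a (N + 1) 0"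
  have F1: "F1 v = exp v * F v" for v :: complex
    by (simp add: F_def F1_def weight_def ring_distribs flip: exp_add)
  define b where "b = min 1 (Re N - 1)"
  obtain M M1 where "hyp_family (weight c a N) M b (pi / 3)"
    and "hyp_family (weight c a (N + 1)) M1 (min 1 (Re (N + 1) - 1)) (pi / 3)"
    using hyp_family_weight[of a N] hyp_family_weight[of a "N + 1"] assms(1,2) unfolding b_def by force
  then interpret F: hyp_family "weight c a N" M b "pi / 3"
    + F1: hyp_family "weight c a (N + 1)" M1 "min 1 (Re (N + 1) - 1)" "pi / 3" .
  note b = F.b
  have bound: "norm (F (Complex x 0)) \<le> M * exp (- b * \<bar>x\<bar>)" for x
    using F.bound[of 0 "Complex x 0"] by (simp add: F_def)
  have intF: "integrable lborel (\<lambda>x. F (Complex x 0))" and intF1: "integrable lborel (\<lambda>x. F1 (Complex x 0))"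
    using F.f_power_integrable[of 1 0] F1.f_power_integrable[of 1 0] by (simp_all add: F_def F1_def)
  have F_deriv: "(F has_field_derivative (N - 1 - a * exp v) * F v) (at v within S)" for v :: complex and S
    unfolding F_def weight_def by (auto intro!: derivative_eq_intros simp: algebra_simps)
  obtain \<delta> where \<delta>: "0 < \<delta>" "\<delta> \<le> pi / 2" "0 - 2 * pi + 2 * \<delta> \<le> Im \<zeta>" "Im \<zeta> \<le> 0 - 2 * \<delta>"
    using gap_strip[of \<zeta> 0] \<zeta> by auto
  have s: "sin \<delta> > 0" using \<delta> by (intro sin_gt_zero) auto
  have kb: "norm (kern (\<zeta> - Complex x 0)) \<le> 1 / sin \<delta>"
    "norm (exp (\<zeta> - Complex x 0) * kern (\<zeta> - Complex x 0)) \<le> 1 / sin \<delta>" for x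
    using kern_bound[of \<delta> "\<zeta> - Complex x 0"] \<delta> by auto
  have ne: "exp (\<zeta> - v) \<noteq> 1" if "Im v = 0" for v
    using that \<zeta> by (intro exp_neq_1_strip) (auto simp: strip_def)
  have kern_deriv: "((\<lambda>v. kern (\<zeta> - v)) has_field_derivative exp (\<zeta> - v) * (kern (\<zeta> - v))\<^sup>2) (at v)" if "Im v = 0" for v
    unfolding kern_def using ne[OF that]
    by (auto intro!: derivative_eq_intros simp: power2_eq_square field_simps)
  define R where "R = (\<lambda>v. F v * exp (\<zeta> - v) * (kern (\<zeta> - v))\<^sup>2)"
  have contF: "continuous_on S F" for S
    by (rule DERIV_continuous_on[OF F_deriv])
  have contk: "continuous_on {v. Im v = 0} (\<lambda>v. kern (\<zeta> - v))"
    unfolding kern_def using ne by (intro continuous_intros) auto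
  have intP: "integrable lborel (\<lambda>x. F (Complex x 0) * kern (\<zeta> - Complex x 0))"
    and intQ: "integrable lborel (\<lambda>x. F1 (Complex x 0) * kern (\<zeta> - Complex x 0))"
    by (rule ctrans_integrable[OF _ \<delta>(1,2)]; use intF intF1 \<delta> in simp)+
  have intR: "integrable lborel (\<lambda>x. R (Complex x 0))"
  proof (rule line_integrable[OF _ b(1)])
    show "continuous_on {v. Im v = 0} R"
      unfolding R_def by (intro continuous_intros contF contk)
    show "norm (R (Complex x 0)) \<le> M * (1 / sin \<delta>) * (1 / sin \<delta>) * exp (- b * \<bar>x\<bar>)" for x
    proof -
      let ?z = "\<zeta> - Complex x 0"
      have "norm (F (Complex x 0)) * (norm (exp ?z * kern ?z) * norm (kern ?z))
          \<le> M * exp (- b * \<bar>x\<bar>) * ((1 / sin \<delta>) * (1 / sin \<delta>))"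
        using s F.M_nonneg by (intro mult_mono bound kb) auto
      then show ?thesis by (simp add: R_def norm_mult power2_eq_square mult_ac)
    qed
  qed
  define D where "D = (\<lambda>v. (N - 1) * (F v * kern (\<zeta> - v)) - a * (F1 v * kern (\<zeta> - v)) + R v)"
  have intD: "integrable lborel (\<lambda>x. D (Complex x 0))"
    unfolding D_def using intP intQ intR by auto
  have "((\<lambda>v. F v * kern (\<zeta> - v)) has_field_derivative D v) (at v)" if "Im v = 0" for v
    by (rule DERIV_cong[OF DERIV_mult[OF F_deriv kern_deriv[OF that]]])
       (simp add: D_def R_def F1 algebra_simps)
  note FK_deriv = this
  have vec: "((\<lambda>x. F (Complex x 0) * kern (\<zeta> - Complex x 0)) has_vector_derivative D (Complex x 0)) (at x within S)" for x S
  proof -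
    have "(\<lambda>x. Complex x 0) = complex_of_real" by (auto simp: complex_eq_iff)
    then have "((\<lambda>x. Complex x 0) has_vector_derivative 1) (at x within S)"
      using has_vector_derivative_of_real[OF DERIV_ident] by simp
    from field_vector_diff_chain_within[OF this has_field_derivative_at_within[OF FK_deriv[of "Complex x 0"]]]
    show ?thesis by (simp add: o_def)
  qed
  have "integral {- real n..real n} (\<lambda>x. D (Complex x 0)) =
      F (Complex (real n) 0) * kern (\<zeta> - Complex (real n) 0) - F (Complex (- real n) 0) * kern (\<zeta> - Complex (- real n) 0)" for n
    by (rule integral_unique, rule fundamental_theorem_of_calculus) (use vec in auto)
  moreover have "(\<lambda>n. F (Complex (r * real n) 0) * kern (\<zeta> - Complex (r * real n) 0)) \<longlonglongrightarrow> 0" if "\<bar>r\<bar> = 1" for r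
  proof (rule Lim_null_comparison)
    show "\<forall>\<^sub>F n in sequentially. norm (F (Complex (r * real n) 0) * kern (\<zeta> - Complex (r * real n) 0)) \<le> (M * exp (- b * real n)) * (1 / sin \<delta>)"
      unfolding norm_mult using bound[of "r * real _"] that s F.M_nonneg
      by (intro always_eventually allI mult_mono kb) (auto simp: abs_mult)
    show "(\<lambda>n. (M * exp (- b * real n)) * (1 / sin \<delta>)) \<longlonglongrightarrow> 0"
      by (intro tendsto_mult_left_zero tendsto_mult_right_zero exp_neg_nat_tendsto_0 b)
  qed
  from tendsto_diff[OF this[of 1] this[of "-1"]]
  have "(\<lambda>n. F (Complex (real n) 0) * kern (\<zeta> - Complex (real n) 0) - F (Complex (- real n) 0) * kern (\<zeta> - Complex (- real n) 0)) \<longlonglongrightarrow> 0"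
    by simp
  ultimately have "line_integral 0 D = 0"
    using tendsto_line_integral[OF intD] LIMSEQ_unique by simp
  moreover have "line_integral 0 D = (N - 1) * ctrans 0 F \<zeta> - a * ctrans 0 F1 \<zeta> + line_integral 0 R"
    using intP intQ intR by (simp add: line_integral_def ctrans_def D_def)
  \<comment> \<open>This closes the equation: exp(v) \<open>kern (\<zeta> - v)\<close> equals
    exp(\<zeta>) \<open>kern (\<zeta> - v)\<close> - exp(v), so the raised weight leads back to
    \<open>F\<close> up to a constant.\<close>
  moreover have "ctrans 0 F1 \<zeta> = exp \<zeta> * ctrans 0 F \<zeta> - line_integral 0 F1"
  proof -
    have "F1 v * kern (\<zeta> - v) = exp \<zeta> * (F v * kern (\<zeta> - v)) - F1 v" if "Im v = 0" for v
      using ne[OF that] by (simp add: F1 kern_def exp_diff field_simps)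
    then have "ctrans 0 F1 \<zeta> = (LINT x|lborel. exp \<zeta> * (F (Complex x 0) * kern (\<zeta> - Complex x 0)) - F1 (Complex x 0))"
      by (simp add: ctrans_def line_integral_def)
    also have "\<dots> = exp \<zeta> * ctrans 0 F \<zeta> - line_integral 0 F1"
      using intP intF1 by (simp add: ctrans_def line_integral_def)
    finally show ?thesis .
  qed
  ultimately have "(N - 1 - a * exp \<zeta>) * ctrans 0 F \<zeta> + a * line_integral 0 F1 = - line_integral 0 R"
    by (simp add: algebra_simps eq_neg_iff_add_eq_0)
  moreover have "- line_integral 0 R = line_integral 0 (\<lambda>v. - (F v * exp (\<zeta> - v) * (kern (\<zeta> - v))\<^sup>2))"
    by (simp add: line_integral_def R_def)
  moreover have "(ctrans 0 F has_field_derivative line_integral 0 (\<lambda>v. - (F v * exp (\<zeta> - v) * (kern (\<zeta> - v))\<^sup>2))) (at \<zeta>)"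
    by (rule ctrans_has_derivative[OF intF]) (use \<zeta> in simp)
  ultimately show ?thesis by (simp add: F_def F1_def)
qed

text \<open>Variation of constants: \<open>E\<close> is an integrating factor, so \<open>E\<close>
  times the transform has derivative \<open>K * E\<close>. A primitive \<open>Q\<close> of that
  exists on the whole plane, and division by the zero-free \<open>E\<close> gives the
  extension.\<close>

lemma ctrans_weight_entire:
  assumes "a > 0" "Re N > 1"
  obtains g where "g holomorphic_on UNIV"
    "\<And>\<zeta>. \<zeta> \<in> strip (- (2 * pi)) 0 \<Longrightarrow> g \<zeta> = ctrans 0 (weight c a N 0) \<zeta>"
proof -
  define y where "y = ctrans 0 (weight c a N 0)"
  define K where "K = a * line_integral 0 (weight c a (N + 1) 0)"
  define E where "E = (\<lambda>\<zeta>::complex. exp (- ((N - 1) * \<zeta>) + a * exp \<zeta>))"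
  have "(\<lambda>\<zeta>. K * E \<zeta>) holomorphic_on UNIV" unfolding E_def by (intro holomorphic_intros)
  then obtain Q where Q: "\<And>\<zeta>. (Q has_field_derivative K * E \<zeta>) (at \<zeta>)"
    using holomorphic_convex_primitive'[of UNIV "\<lambda>\<zeta>. K * E \<zeta>"] by auto
  have "\<exists>C. \<forall>\<zeta>\<in>strip (- (2 * pi)) 0. Q \<zeta> - E \<zeta> * y \<zeta> = C"
  proof (rule has_field_derivative_zero_constant)
    fix \<zeta> assume \<zeta>: "\<zeta> \<in> strip (- (2 * pi)) 0"
    have E: "(E has_field_derivative (- (N - 1) + a * exp \<zeta>) * E \<zeta>) (at \<zeta>)"
      unfolding E_def by (auto intro!: derivative_eq_intros simp: algebra_simps)
    have "((\<lambda>\<zeta>. Q \<zeta> - E \<zeta> * y \<zeta>) has_field_derivative 0) (at \<zeta>)"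
      by (rule DERIV_cong[OF DERIV_diff[OF Q DERIV_mult[OF E ctrans_weight_ode[OF assms \<zeta>, of c, folded y_def K_def]]]])
         (simp add: algebra_simps)
    then show "((\<lambda>\<zeta>. Q \<zeta> - E \<zeta> * y \<zeta>) has_field_derivative 0) (at \<zeta> within strip (- (2 * pi)) 0)"
      by (rule has_field_derivative_at_within)
  qed simp
  then obtain C where C: "\<And>\<zeta>. \<zeta> \<in> strip (- (2 * pi)) 0 \<Longrightarrow> Q \<zeta> - E \<zeta> * y \<zeta> = C" by blast
  show thesis
  proof (rule that)
    have "Q holomorphic_on UNIV" using Q by (auto simp: holomorphic_on_open)
    then show "(\<lambda>\<zeta>. (Q \<zeta> - C) / E \<zeta>) holomorphic_on UNIV"
      unfolding E_def by (intro holomorphic_intros) auto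
    show "(Q \<zeta> - C) / E \<zeta> = ctrans 0 (weight c a N 0) \<zeta>" if "\<zeta> \<in> strip (- (2 * pi)) 0" for \<zeta>
      using C[OF that] by (simp add: y_def E_def field_simps)
  qed
qed


section \<open>Hyperterminants\<close>

text \<open>Substitution \<open>r = exp x\<close>, with Jacobian \<open>exp x\<close>. Continuity
  provides the measurability needed to pass between Borel and completed Lebesgue measure.\<close>

lemma ray_integral_log:
  assumes cont: "continuous_on UNIV (\<lambda>x. g (lpolar (exp x) \<eta>))"
    and int: "integrable lborel (\<lambda>x. g (lpolar (exp x) \<eta>) * cis \<eta> * exp x)"
  shows "ray_integral \<eta> g = (LINT x|lborel. g (lpolar (exp x) \<eta>) * cis \<eta> * exp x)"
proof -
  define f where "f = (\<lambda>r. g (lpolar r \<eta>) * cis \<eta>)"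
  define h where "h = (\<lambda>x. \<bar>exp x\<bar> *\<^sub>R f (exp x))"
  have h: "h = (\<lambda>x. g (lpolar (exp x) \<eta>) * cis \<eta> * exp x)"
    by (simp add: h_def f_def scaleR_conv_of_real mult_ac fun_eq_iff)
  have hm: "h \<in> borel_measurable borel"
    unfolding h using cont by (intro borel_measurable_continuous_onI continuous_intros) auto
  have im: "exp ` (UNIV :: real set) = {0<..}"
    by (auto intro: exI[of _ "ln _"] simp: image_iff) (metis exp_ln)
  have "h absolutely_integrable_on UNIV"
    unfolding set_integrable_def using int hm by (simp add: integrable_completion h)
  then have "f absolutely_integrable_on (exp ` UNIV) \<and> integral (exp ` UNIV) f = integral UNIV h"
    unfolding h_def
    by (subst has_absolute_integral_change_of_variables_real[symmetric, where h = exp])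
       (auto intro!: derivative_eq_intros simp: inj_on_def)
  then have f: "f absolutely_integrable_on {0<..}" "integral {0<..} f = integral UNIV h"
    unfolding im by auto
  have "continuous_on {0<..} (\<lambda>r. (\<lambda>x. g (lpolar (exp x) \<eta>)) (ln r) * cis \<eta>)"
    by (intro continuous_intros continuous_on_compose2[OF cont]) auto
  then have "continuous_on {0<..} f"
    by (rule continuous_on_eq) (auto simp: f_def)
  then have fm: "(\<lambda>r. indicator {0<..} r *\<^sub>R f r) \<in> borel_measurable borel"
    by (intro borel_measurable_continuous_on_indicator) auto
  have "ray_integral \<eta> g = (LINT r|lebesgue. indicator {0<..} r *\<^sub>R f r)"
    unfolding ray_integral_def set_lebesgue_integral_def f_def[symmetric]
    using fm by (simp add: integral_completion f_def)
  also have "\<dots> = integral UNIV h"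
    using set_lebesgue_integral_eq_integral(2)[OF f(1)] f(2) by (simp add: set_lebesgue_integral_def)
  also have "\<dots> = (LINT x|lborel. h x)"
    using integral_lborel[of h] int by (simp add: h)
  finally show ?thesis by (simp add: h)
qed

lemma iter_ray_integral_mult:
  "iter_ray_integral \<eta>s (\<lambda>ts. c * g ts) = c * iter_ray_integral \<eta>s g"
  by (induction \<eta>s arbitrary: g) (simp_all add: ray_integral_def set_lebesgue_integral_def mult.assoc)

lemma hyp_integral_Nil: "hyp_integral z [] = 1"
  by (simp add: hyp_integral_def)

text \<open>Only the first factor contains \<open>z\<close>; it leaves the inner integrals, in which
  the outermost variable then takes the place of \<open>z\<close>.\<close>

lemma hyp_integral_Cons:
  "hyp_integral z ((N, \<sigma>) # ps) = ray_integral (pi - larg \<sigma>)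
     (\<lambda>t. exp (lval (lmult \<sigma> t)) * lpow t (N - 1) / (lval z - lval t) * hyp_integral t ps)"
  unfolding hyp_integral_def
  by (simp add: prod.lessThan_Suc_shift iter_ray_integral_mult 
    del: prod.lessThan_Suc times_divide_eq_left times_divide_eq_right)

text \<open>The multiples of \<open>\<epsilon>\<close> are counted from the end of the list, so
  removing the first entry leaves the others as they are.\<close>

lemma hyp_perturb_replicate_Suc:
  "hyp_perturb \<epsilon> (replicate (Suc m) (N, \<sigma>)) = (N, lrot (real m * \<epsilon>) \<sigma>) # hyp_perturb \<epsilon> (replicate m (N, \<sigma>))"
proof (rule nth_equalityI)
  fix i assume "i < length (hyp_perturb \<epsilon> (replicate (Suc m) (N, \<sigma>)))"
  then show "hyp_perturb \<epsilon> (replicate (Suc m) (N, \<sigma>)) ! i =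
      ((N, lrot (real m * \<epsilon>) \<sigma>) # hyp_perturb \<epsilon> (replicate m (N, \<sigma>))) ! i"
    by (cases i) (auto simp: hyp_perturb_def nth_append simp del: upt_Suc replicate_Suc)
qed (simp add: hyp_perturb_def)

section \<open>The logarithmic chart and analytic continuation\<close>

definition lcoord :: "lsurf \<Rightarrow> complex" where
  "lcoord z = Complex (ln (lmod z)) (larg z)"

lemma lexp_lcoord [simp]: "lexp (lcoord z) = z"
  by (simp add: lexp_def lcoord_def)

lemma lcoord_lexp [simp]: "lcoord (lexp w) = w"
  by (simp add: lexp_def lcoord_def complex_eq_iff)

lemma larg_lexp [simp]: "larg (lexp w) = Im w"
  by (simp add: lexp_def)

lemma lval_lexp: "lval (lexp w) = exp w"
  by (simp add: lval_def lexp_def rcis_def exp_eq_polar)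

lemma lpow_lexp: "lpow (lexp w) p = exp (p * w)"
  by (simp add: lpow_def lexp_def flip: complex_eq)

lemma lval_lmult: "lval (lmult s t) = lval s * lval t"
  by (simp add: lval_def lmult_def rcis_mult)

lemma lval_lrot: "lval (lrot \<alpha> t) = lval t * cis \<alpha>"
  by (simp add: lval_def lrot_def rcis_def cis_mult mult.assoc)

lemma lrot_0 [simp]: "lrot 0 t = t"
  by (simp add: lrot_def)

text \<open>A sector of the surface is a strip in the chart, and the identity theorem in the plane
  gives the uniqueness on which the description operator in \<open>lcontinuation\<close>
  relies.\<close>

lemma lcontinuation_eqI:
  assumes g: "lholomorphic g" and eq: "\<And>z. z \<in> D \<Longrightarrow> g z = f z"
    and D: "\<alpha> < \<beta>" "{z. \<alpha> < larg z \<and> larg z < \<beta>} \<subseteq> D"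
  shows "lcontinuation D f = g"
  unfolding lcontinuation_def
proof (rule the_equality)
  fix h assume h: "lholomorphic h \<and> (\<forall>z\<in>D. h z = f z)"
  show "h = g"
  proof
    fix z
    have "h (lexp (lcoord z)) = g (lexp (lcoord z))"
    proof (rule analytic_continuation_open[of "strip \<alpha> \<beta>" UNIV "\<lambda>w. h (lexp w)" "\<lambda>w. g (lexp w)"])
      have "Complex 0 ((\<alpha> + \<beta>) / 2) \<in> strip \<alpha> \<beta>" using D by (simp add: strip_def)
      then show "strip \<alpha> \<beta> \<noteq> {}" by blast
      show "h (lexp w) = g (lexp w)" if "w \<in> strip \<alpha> \<beta>" for w
        using that D(2) h eq by (auto simp: strip_def subset_iff)
    qed (use g h in \<open>auto simp: lholomorphic_def\<close>)
    then show "h z = g z" by simp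
  qed
qed (use g eq in auto)

context
  fixes N :: complex and \<sigma> :: lsurf
begin

text \<open>A logarithm of the unit direction of the unperturbed ray: adding it moves the real axis
  onto that ray, on which \<sigma>t is negative.\<close>

definition rotation :: complex where
  "rotation = \<i> * of_real (pi - larg \<sigma>)"

definition fweight :: "real \<Rightarrow> complex \<Rightarrow> complex" where
  "fweight = weight (exp ((N - 1) * rotation)) (lmod \<sigma>) N"

lemma Im_rotation [simp]: "Im rotation = pi - larg \<sigma>" and Re_rotation [simp]: "Re rotation = 0"
  by (simp_all add: rotation_def)

text \<open>One layer of the iterated integral. The inner hyperterminant is kept abstract as
  \<open>u\<close>, with \<open>g\<close> its form in the coordinate, so that the lemma can be
  iterated.\<close>

lemma ray_integral_eq_ctrans:
  assumes \<zeta>: "\<zeta> \<in> strip (- \<epsilon> - 2 * pi) (- \<epsilon>)"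
    and g: "continuous_on {v. Im v = - \<epsilon>} g" "integrable lborel (\<lambda>x. fweight \<epsilon> (Complex x (- \<epsilon>)) * g (Complex x (- \<epsilon>)))"
    and u: "\<And>v. Im v = - \<epsilon> \<Longrightarrow> u (lexp (v + rotation)) = g v"
  shows "ray_integral (pi - larg (lrot \<epsilon> \<sigma>)) (\<lambda>t. exp (lval (lmult (lrot \<epsilon> \<sigma>) t)) * lpow t (N - 1)
      / (lval (lexp (\<zeta> + rotation)) - lval t) * u t) = ctrans (- \<epsilon>) (\<lambda>v. fweight \<epsilon> v * g v) \<zeta>"
proof -
  let ?\<eta> = "pi - larg (lrot \<epsilon> \<sigma>)"
  define F where "F = (\<lambda>t. exp (lval (lmult (lrot \<epsilon> \<sigma>) t)) * lpow t (N - 1)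
      / (lval (lexp (\<zeta> + rotation)) - lval t) * u t)"
  have ne: "exp \<zeta> \<noteq> exp v" if "Im v = - \<epsilon>" for v
  proof
    assume "exp \<zeta> = exp v"
    then have "exp (\<zeta> - v) = 1" by (simp add: exp_diff)
    moreover have "exp (\<zeta> - v) \<noteq> 1"
      using \<zeta> that by (intro exp_neq_1_strip) (auto simp: strip_def)
    ultimately show False by simp
  qed
  have polar: "lpolar (exp x) ?\<eta> = lexp (Complex x (- \<epsilon>) + rotation)" for x
    by (simp add: lexp_def lrot_def algebra_simps)
  have er: "exp rotation = cis (pi - larg \<sigma>)" by (simp only: rotation_def cis_conv_exp)
  have lv: "lval \<sigma> * exp rotation = - of_real (lmod \<sigma>)"
  proof -
    have "lval \<sigma> * exp rotation = of_real (lmod \<sigma>) * cis (larg \<sigma> + (pi - larg \<sigma>))"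
      unfolding er by (simp only: lval_def rcis_def mult.assoc cis_mult)
    then show ?thesis by simp
  qed
  \<comment> \<open>The denominator contributes \<open>1 / exp rotation\<close>, which cancels
    against the direction factor of dt.\<close>
  have Fv: "F (lexp (v + rotation)) = fweight \<epsilon> v * g v / (exp \<zeta> - exp v) / exp rotation" if v: "Im v = - \<epsilon>" for v
  proof -
    have "lval (lmult (lrot \<epsilon> \<sigma>) (lexp (v + rotation))) = (lval \<sigma> * exp rotation) * cis \<epsilon> * exp v"
      by (simp add: lval_lmult lval_lrot lval_lexp exp_add mult_ac)
    then have "exp (lval (lmult (lrot \<epsilon> \<sigma>) (lexp (v + rotation)))) * lpow (lexp (v + rotation)) (N - 1) = fweight \<epsilon> v"
      unfolding lv lpow_lexp fweight_def weight_def
      by (simp add: exp_add[symmetric] algebra_simps)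
    then show ?thesis
      unfolding F_def by (simp add: u[OF v] lval_lexp exp_add divide_simps flip: right_diff_distrib left_diff_distrib)
  qed
  have cis: "cis ?\<eta> * exp (of_real x) = exp (Complex x (- \<epsilon>)) * exp rotation" for x
    by (simp add: er lrot_def exp_eq_polar[of "Complex _ _"] cis_mult algebra_simps flip: exp_of_real)
  have step: "F (lpolar (exp x) ?\<eta>) * cis ?\<eta> * exp x
      = fweight \<epsilon> (Complex x (- \<epsilon>)) * g (Complex x (- \<epsilon>)) * kern (\<zeta> - Complex x (- \<epsilon>))" for x
  proof -
    let ?v = "Complex x (- \<epsilon>)"
    have "F (lpolar (exp x) ?\<eta>) * cis ?\<eta> * exp x = fweight \<epsilon> ?v * g ?v / (exp \<zeta> - exp ?v) / exp rotation * (exp ?v * exp rotation)"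
      unfolding polar cis[symmetric] by (simp add: Fv exp_of_real)
    also have "\<dots> = fweight \<epsilon> ?v * g ?v * (exp ?v / (exp \<zeta> - exp ?v))" by simp
    also have "exp ?v / (exp \<zeta> - exp ?v) = kern (\<zeta> - ?v)"
      using ne[of ?v] by (simp add: kern_def exp_diff divide_simps)
    finally show ?thesis .
  qed
  obtain \<delta> where \<delta>: "0 < \<delta>" "\<delta> \<le> pi / 2" "- \<epsilon> - 2 * pi + 2 * \<delta> \<le> Im \<zeta>" "Im \<zeta> \<le> - \<epsilon> - 2 * \<delta>"
    using gap_strip[OF \<zeta>] .
  have "ray_integral ?\<eta> F = (LINT x|lborel. F (lpolar (exp x) ?\<eta>) * cis ?\<eta> * exp x)"
  proof (rule ray_integral_log)
    have "continuous_on {v. Im v = - \<epsilon>} (\<lambda>v. fweight \<epsilon> v * g v / (exp \<zeta> - exp v) / exp rotation)"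
      unfolding fweight_def weight_def by (intro continuous_intros g(1)) (use ne in auto)
    from continuous_along_line[OF this, of UNIV]
    show "continuous_on UNIV (\<lambda>x. F (lpolar (exp x) ?\<eta>))"
      unfolding polar by (simp add: Fv)
    show "integrable lborel (\<lambda>x. F (lpolar (exp x) ?\<eta>) * cis ?\<eta> * exp x)"
      unfolding step by (rule ctrans_integrable[where g = "\<lambda>v. fweight \<epsilon> v * g v", OF g(2) \<delta>(1,2)]) (use \<delta> in auto)
  qed
  also have "\<dots> = ctrans (- \<epsilon>) (\<lambda>v. fweight \<epsilon> v * g v) \<zeta>"
    unfolding step by (simp add: ctrans_def line_integral_def)
  finally show ?thesis by (simp add: F_def)
qed

context
  assumes N: "Re N > 1"
begin

lemma hyp_family_fweight: "\<exists>M. hyp_family fweight M (min 1 (Re N - 1)) (pi / 3)"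
  unfolding fweight_def by (rule hyp_family_weight) (use N in auto)

text \<open>Every ray integral is one Cauchy transform. The line of the outermost variable is within
  the strip for \<open>m\<close> inner integrals, being \<open>\<epsilon>\<close> below its upper
  edge, so the induction hypothesis applies there.\<close>

lemma hyp_integral_perturb:
  assumes "0 < \<epsilon>" "real m * \<epsilon> \<le> pi / 3" "\<zeta> \<in> strip (- (2 * pi)) ((1 - real m) * \<epsilon>)"
  shows "hyp_integral (lexp (\<zeta> + rotation)) (hyp_perturb \<epsilon> (replicate m (N, \<sigma>))) = hyp_family.G fweight \<epsilon> m \<zeta>"
proof -
  obtain M where "hyp_family fweight M (min 1 (Re N - 1)) (pi / 3)"
    using hyp_family_fweight by blast
  then interpret F: hyp_family fweight M "min 1 (Re N - 1)" "pi / 3" .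
  show ?thesis using assms(2,3)
  proof (induction m arbitrary: \<zeta>)
    case 0
    then show ?case by (simp add: hyp_perturb_def hyp_integral_Nil)
  next
    case (Suc m)
    define e where "e = real m * \<epsilon>"
    have e: "0 \<le> e" "e + \<epsilon> \<le> pi / 3" "(1 - real m) * \<epsilon> = \<epsilon> - e" "(1 - real (Suc m)) * \<epsilon> = - e"
      using assms(1) Suc.prems(1) by (auto simp: e_def algebra_simps)
    have pi: "pi > 0" by simp
    from F.G_regular[OF assms(1), of m] e assms(1) obtain C
      where h: "F.G \<epsilon> m holomorphic_on strip (- (2 * pi)) (\<epsilon> - e)"
      and C: "\<And>\<zeta>. - pi \<le> Im \<zeta> \<Longrightarrow> Im \<zeta> \<le> - e \<Longrightarrow> norm (F.G \<epsilon> m \<zeta>) \<le> C"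
      unfolding e_def[symmetric] by auto
    have cont: "continuous_on {v. Im v = - e} (F.G \<epsilon> m)"
      using e assms(1) pi by (intro continuous_on_line[OF h]) linarith+
    have "ray_integral (pi - larg (lrot e \<sigma>)) (\<lambda>t. exp (lval (lmult (lrot e \<sigma>) t)) * lpow t (N - 1)
      / (lval (lexp (\<zeta> + rotation)) - lval t) * hyp_integral t (hyp_perturb \<epsilon> (replicate m (N, \<sigma>))))
      = ctrans (- e) (\<lambda>v. fweight e v * F.G \<epsilon> m v) \<zeta>"
    proof (rule ray_integral_eq_ctrans)
      show "\<zeta> \<in> strip (- e - 2 * pi) (- e)"
        using Suc.prems(2) e(1) unfolding e strip_def mem_Collect_eq by linarith
      show "integrable lborel (\<lambda>x. fweight e (Complex x (- e)) * F.G \<epsilon> m (Complex x (- e)))"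
      proof (rule F.prod_integrable(1)[OF _ _ _ _ cont])
        show "norm (F.G \<epsilon> m v) \<le> C" if "Im v = - e" for v
          using that e assms(1) pi by (intro C) linarith+
      qed (use e assms(1) in linarith)+
      show "hyp_integral (lexp (v + rotation)) (hyp_perturb \<epsilon> (replicate m (N, \<sigma>))) = F.G \<epsilon> m v"
        if "Im v = - e" for v
      proof (rule Suc.IH)
        show "real m * \<epsilon> \<le> pi / 3" using e assms(1) unfolding e_def[symmetric] by linarith
        show "v \<in> strip (- (2 * pi)) ((1 - real m) * \<epsilon>)"
          using that e assms(1) pi unfolding e strip_def mem_Collect_eq by linarith
      qed
    qed (fact cont)
    then show ?case
      unfolding hyp_perturb_replicate_Suc hyp_integral_Cons F.G.simps e_def .
  qed
qed

text \<open>A single parameter is rotated by 0 times \<open>\<epsilon>\<close>, so the perturbed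
  statement with any admissible value, here \<pi>/3, is already the unperturbed one.\<close>

lemma hyp_integral_single:
  assumes "\<zeta> \<in> strip (- (2 * pi)) 0"
  shows "hyp_integral (lexp (\<zeta> + rotation)) [(N, \<sigma>)] = ctrans 0 (fweight 0) \<zeta>"
proof -
  have "0 < pi / 3" by simp
  have "hyp_integral (lexp (\<zeta> + rotation)) (hyp_perturb (pi / 3) (replicate 1 (N, \<sigma>)))
      = hyp_family.G fweight (pi / 3) 1 \<zeta>"
    by (rule hyp_integral_perturb) (use assms in auto)
  moreover have "hyp_perturb (pi / 3) (replicate 1 (N, \<sigma>)) = [(N, \<sigma>)]"
    by (simp add: hyp_perturb_def)
  moreover obtain M where "hyp_family fweight M (min 1 (Re N - 1)) (pi / 3)"
    using hyp_family_fweight by blast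
  then interpret F: hyp_family fweight M "min 1 (Re N - 1)" "pi / 3" .
  have "F.G (pi / 3) 1 \<zeta> = ctrans 0 (fweight 0) \<zeta>" by simp
  ultimately show ?thesis by simp
qed

lemma hyp_sector_strip:
  assumes "m \<ge> 1"
  shows "lexp (\<zeta> + rotation) \<in> hyp_sector (replicate m (N, \<sigma>)) \<longleftrightarrow> \<zeta> \<in> strip (- (2 * pi)) 0"
proof -
  have "hd (replicate m (N, \<sigma>)) = (N, \<sigma>)" using assms by (cases m) auto
  then show ?thesis by (auto simp: hyp_sector_def lmult_def strip_def abs_less_iff lmod_pos)
qed

text \<open>For \<open>m = 1\<close> there are no neighbouring arguments to compare, so the list is
  generic and the integral is taken as it stands; from \<open>m = 2\<close> on the definition is by
  the limit.\<close>

lemma hyp_on_sector_replicate: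
  assumes "m \<ge> 1" "\<zeta> \<in> strip (- (2 * pi)) 0"
  shows "hyp_on_sector (replicate m (N, \<sigma>)) (lexp (\<zeta> + rotation)) = hyp_family.H fweight m \<zeta>"
proof -
  obtain M where "hyp_family fweight M (min 1 (Re N - 1)) (pi / 3)"
    using hyp_family_fweight by blast
  then interpret F: hyp_family fweight M "min 1 (Re N - 1)" "pi / 3" .
  show ?thesis
  proof (cases "m = 1")
    case True
    have "bell_Y 1 (\<lambda>k. F.Y 0 k \<zeta>) = F.Y 0 1 \<zeta>"
      using bell_Y_recursion[of 1 "\<lambda>k. F.Y 0 k \<zeta>"] by (simp add: bell_Y_0)
    then have "F.H 1 \<zeta> = ctrans 0 (fweight 0) \<zeta>"
      by (simp add: F.H_def F.Y_def)
    then show ?thesis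
      using True hyp_integral_single[OF assms(2)] by (simp add: hyp_on_sector_def hyp_generic_def)
  next
    case False
    with assms(1) have m: "m \<ge> 2" by simp
    then have "\<not> hyp_generic (replicate m (N, \<sigma>))"
      by (auto simp: hyp_generic_def intro!: exI[of _ 0])
    moreover have "((\<lambda>\<epsilon>. hyp_integral (lexp (\<zeta> + rotation)) (hyp_perturb \<epsilon> (replicate m (N, \<sigma>)))) \<longlongrightarrow> F.H m \<zeta>) (at_right 0)"
    proof (rule Lim_transform_eventually[OF F.G_tendsto[OF assms(2)]])
      \<comment> \<open>For \<open>\<epsilon> < r\<close> all rotations stay within \<pi>/3 and
        \<open>\<zeta>\<close> stays below the outermost contour.\<close>
      define r where "r = min (pi / 3) (- Im \<zeta>) / real m"
      have "r > 0" using assms m by (auto simp: r_def strip_def)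
      have "F.G \<epsilon> m \<zeta> = hyp_integral (lexp (\<zeta> + rotation)) (hyp_perturb \<epsilon> (replicate m (N, \<sigma>)))"
        if \<epsilon>: "0 < \<epsilon>" "\<epsilon> < r" for \<epsilon>
      proof (rule hyp_integral_perturb[symmetric])
        have "real m * \<epsilon> \<le> real m * r" using \<epsilon> by (intro mult_left_mono) auto
        also have "\<dots> = min (pi / 3) (- Im \<zeta>)" using m by (simp add: r_def)
        finally have *: "real m * \<epsilon> \<le> pi / 3" "real m * \<epsilon> \<le> - Im \<zeta>" by auto
        then show "real m * \<epsilon> \<le> pi / 3" by simp
        have "(1 - real m) * \<epsilon> = \<epsilon> - real m * \<epsilon>" by (simp add: algebra_simps)
        then show "\<zeta> \<in> strip (- (2 * pi)) ((1 - real m) * \<epsilon>)"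
          using * \<epsilon> assms(2) unfolding strip_def mem_Collect_eq by linarith
      qed (fact \<epsilon>(1))
      then show "\<forall>\<^sub>F \<epsilon> in at_right 0. F.G \<epsilon> m \<zeta> = hyp_integral (lexp (\<zeta> + rotation)) (hyp_perturb \<epsilon> (replicate m (N, \<sigma>)))"
        unfolding eventually_at_right_field using \<open>r > 0\<close> by blast
    qed
    ultimately show ?thesis
      by (simp add: hyp_on_sector_def tendsto_Lim)
  qed
qed

text \<open>Existence of the continuation is left to the candidate \<open>g\<close>: the entire
  solution of the differential equation when \<open>m = 1\<close>, the Bell polynomial in
  general.\<close>

lemma hyperterminant_replicate_eqI:
  assumes "m \<ge> 1" "lholomorphic g"
    and "\<And>\<zeta>. \<zeta> \<in> strip (- (2 * pi)) 0 \<Longrightarrow> g (lexp (\<zeta> + rotation)) = hyp_family.H fweight m \<zeta>"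
  shows "hyperterminant z (replicate m (N, \<sigma>)) = g z"
proof -
  have w: "lexp ((lcoord z - rotation) + rotation) = z" for z by simp
  have "lcontinuation (hyp_sector (replicate m (N, \<sigma>))) (hyp_on_sector (replicate m (N, \<sigma>))) = g"
  proof (rule lcontinuation_eqI[OF assms(2)])
    show "g z = hyp_on_sector (replicate m (N, \<sigma>)) z" if "z \<in> hyp_sector (replicate m (N, \<sigma>))" for z
    proof -
      have "lcoord z - rotation \<in> strip (- (2 * pi)) 0"
        using hyp_sector_strip[OF assms(1), of "lcoord z - rotation"] that unfolding w by simp
      from assms(3)[OF this] hyp_on_sector_replicate[OF assms(1) this] show ?thesis unfolding w by simp
    qed
    show "{z. - pi - larg \<sigma> < larg z \<and> larg z < pi - larg \<sigma>} \<subseteq> hyp_sector (replicate m (N, \<sigma>))"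
    proof safe
      fix z assume "- pi - larg \<sigma> < larg z" "larg z < pi - larg \<sigma>"
      then have "lcoord z - rotation \<in> strip (- (2 * pi)) 0" by (auto simp: strip_def lcoord_def)
      then show "z \<in> hyp_sector (replicate m (N, \<sigma>))"
        using hyp_sector_strip[OF assms(1), of "lcoord z - rotation"] unfolding w by simp
    qed
  qed simp
  then show ?thesis using assms(1) by (cases m) (simp_all add: hyperterminant_def)
qed

lemma hyperterminant_single:
  "lholomorphic (\<lambda>z. hyperterminant z [(N, \<sigma>)])"
  "\<And>\<zeta>. \<zeta> \<in> strip (- (2 * pi)) 0 \<Longrightarrow> hyperterminant (lexp (\<zeta> + rotation)) [(N, \<sigma>)] = ctrans 0 (fweight 0) \<zeta>"
proof -
  obtain g where g: "g holomorphic_on UNIV" and eq: "\<And>\<zeta>. \<zeta> \<in> strip (- (2 * pi)) 0 \<Longrightarrow> g \<zeta> = ctrans 0 (fweight 0) \<zeta>"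
    using ctrans_weight_entire[of "lmod \<sigma>" N] N unfolding fweight_def by auto
  have "(\<lambda>w. g (w - rotation)) holomorphic_on UNIV"
    by (rule holomorphic_on_compose_gen[OF _ g, unfolded o_def]) (auto intro!: holomorphic_intros)
  then have h: "lholomorphic (\<lambda>z. g (lcoord z - rotation))" by (simp add: lholomorphic_def)
  have *: "hyperterminant z [(N, \<sigma>)] = g (lcoord z - rotation)" for z
  proof -
    have "hyperterminant z (replicate 1 (N, \<sigma>)) = g (lcoord z - rotation)"
    proof (rule hyperterminant_replicate_eqI[OF _ h])
      fix \<zeta> assume \<zeta>: "\<zeta> \<in> strip (- (2 * pi)) 0"
      have "g \<zeta> = hyp_on_sector (replicate 1 (N, \<sigma>)) (lexp (\<zeta> + rotation))"
        using hyp_integral_single[OF \<zeta>] eq[OF \<zeta>] by (simp add: hyp_on_sector_def hyp_generic_def)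
      also have "\<dots> = hyp_family.H fweight 1 \<zeta>" by (rule hyp_on_sector_replicate[OF _ \<zeta>]) simp
      finally show "g (lcoord (lexp (\<zeta> + rotation)) - rotation) = hyp_family.H fweight 1 \<zeta>" by simp
    qed simp
    then show ?thesis by simp
  qed
  show "lholomorphic (\<lambda>z. hyperterminant z [(N, \<sigma>)])" unfolding * by (rule h)
  show "hyperterminant (lexp (\<zeta> + rotation)) [(N, \<sigma>)] = ctrans 0 (fweight 0) \<zeta>" if "\<zeta> \<in> strip (- (2 * pi)) 0" for \<zeta>
    unfolding * using eq[OF that] by simp
qed

end

end

lemma rotation_lscale [simp]: "k > 0 \<Longrightarrow> rotation (lscale k \<sigma>) = rotation \<sigma>"
  by (simp add: rotation_def lscale_def)

lemma fweight_power:
  assumes "k \<ge> 1"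
  shows "fweight N \<sigma> 0 v ^ k = fweight (of_nat k * N - of_nat k + 1) (lscale (real k) \<sigma>) 0 v"
proof -
  have "exp ((N - 1) * rotation \<sigma>) ^ k = exp ((of_nat k * N - of_nat k + 1 - 1) * rotation \<sigma>)"
    by (simp add: exp_of_nat_mult[symmetric] algebra_simps)
  moreover have "lmod (lscale (real k) \<sigma>) = real k * lmod \<sigma>" using assms by (simp add: lscale_def)
  ultimately show ?thesis using assms by (simp add: fweight_def weight_power)
qed

theorem theorem4p1:
  fixes N :: complex and \<sigma> z :: lsurf and m :: nat
  assumes "Re N > 1"
  shows "hyperterminant z (replicate m (N, \<sigma>)) =
           bell_Y m (\<lambda>k. (2 * of_real pi * \<i>) ^ (k - 1) / of_nat k *
             hyperterminant z [(of_nat k * N - of_nat k + 1, lscale (real k) \<sigma>)])"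
proof (cases "m = 0")
  case True
  then show ?thesis by (simp add: hyperterminant_def bell_Y_0)
next
  case False
  obtain M where "hyp_family (fweight N \<sigma>) M (min 1 (Re N - 1)) (pi / 3)"
    using hyp_family_fweight[OF assms] by blast
  then interpret F: hyp_family "fweight N \<sigma>" M "min 1 (Re N - 1)" "pi / 3" .
  let ?y = "\<lambda>z k. (2 * of_real pi * \<i>) ^ (k - 1) / of_nat k *
    hyperterminant z [(of_nat k * N - of_nat k + 1, lscale (real k) \<sigma>)]"
  \<comment> \<open>The real part is k(Re N - 1) + 1.\<close>
  have Nk: "Re (of_nat k * N - of_nat k + 1) > 1" if "k \<ge> 1" for k
    using that assms by (simp add: field_simps)
  \<comment> \<open>The right-hand side is itself the candidate for the continuation, so only a
    comparison in the initial sector remains.\<close>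
  have "(\<lambda>w. bell_Y m (?y (lexp w))) holomorphic_on UNIV"
    by (intro bell_Y_holomorphic holomorphic_intros hyperterminant_single(1)[OF Nk, unfolded lholomorphic_def])
  then have "lholomorphic (\<lambda>z. bell_Y m (?y z))" by (simp add: lholomorphic_def)
  then show ?thesis
  proof (rule hyperterminant_replicate_eqI[OF assms, rotated])
    fix \<zeta> assume \<zeta>: "\<zeta> \<in> strip (- (2 * pi)) 0"
    show "bell_Y m (?y (lexp (\<zeta> + rotation \<sigma>))) = F.H m \<zeta>"
      unfolding F.H_def
    proof (rule bell_Y_cong)
      fix k :: nat assume k: "1 \<le> k" "k \<le> m"
      have "hyperterminant (lexp (\<zeta> + rotation \<sigma>)) [(of_nat k * N - of_nat k + 1, lscale (real k) \<sigma>)]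
          = ctrans 0 (\<lambda>v. fweight N \<sigma> 0 v ^ k) \<zeta>"
        using hyperterminant_single(2)[OF Nk[OF k(1)] \<zeta>, of "lscale (real k) \<sigma>"] k(1)
        by (simp add: fweight_power)
      then show "?y (lexp (\<zeta> + rotation \<sigma>)) k = F.Y 0 k \<zeta>" by (simp add: F.Y_def)
    qed
  qed (use False in simp)
qed

end
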